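(* Let $(R,\mathfrak{m})$ be a one-dimensional Cohen-Macaulay local ring with canonical module $\omega$ such that $\mathfrak{m}\subseteq\tau_{\omega}(R)$. Let $x\in\mathfrak{m}^{t}\setminus\mathfrak{m}^{t+1}$, where $t\ge 1$, be such that its initial form $x^{*}\in \mathrm{gr}_{\mathfrak{m}}(R)$ is a regular element. Then $$\mathrm{index}(R)\le \mathrm{g}\ell\ell(R)\le \mathrm{index}(R)+t-1.$$
   Context: Local rings are commutative and Noetherian. The trace $\tau_\omega(R)$ is the ideal of $R$ generated by all $R$-homomorphic images of $\omega$ in $R$. The associated graded ring is $\mathrm{gr}_{\mathfrak{m}}(R)=\bigoplus_{i\ge 0}\mathfrak{m}^i/\mathfrak{m}^{i+1}$, and for $x\in\mathfrak{m}^t\setminus\mathfrak{m}^{t+1}$ the initial form $x^*$ is the class of $x$ in $\mathfrak{m}^t/\mathfrak{m}^{t+1}$. For a finitely generated $R$-module $M$, Auslander's $\delta$-invariant $\delta_R(M)$ is the smallest non-negative integer $n$ such that there is a surjective $R$-linear map $X\oplus R^n\to M$, where $X$ is a maximal Cohen-Macaulay $R$-module with no free direct summand ($X=0$ is allowed). The index of $R$ is $\mathrm{index}(R)=\inf\{n\ge 1 : \delta_R(R/\mathfrak{m}^n)=1\}$. The generalized Loewy length $\mathrm{g}\ell\ell(R)$ is the smallest positive integer $n$ for which $\mathfrak{m}^n$ is contained in the ideal generated by some system of parameters of $R$. *)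

theory Defs
  imports "HOL-Algebra.Module" "HOL-Algebra.Ideal_Product" "HOL-Algebra.QuotRing"
    "HOL-Algebra.Ring_Divisibility" "HOL-Library.Extended_Nat"
begin

section \<open>Modules over a commutative ring\<close>

text \<open>The library's module record extends the ring record; the locale \<^locale>\<open>module\<close> puts no
  condition on the fields mult and one, which are left undefined.\<close>

definition mk_module :: "'b set \<Rightarrow> 'b \<Rightarrow> ('b \<Rightarrow> 'b \<Rightarrow> 'b) \<Rightarrow> ('a \<Rightarrow> 'b \<Rightarrow> 'b) \<Rightarrow> ('a, 'b) module" where
  "mk_module C z p s =
     \<lparr>carrier = C, monoid.mult = undefined, one = undefined, ring.zero = z, ring.add = p, smult = s\<rparr>"

text \<open>Every finitely generated \<open>R\<close>-module is isomorphic to a quotient of some \<open>R\<^sup>n\<close>, so its elements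
  may be taken to be sets of functions \<open>nat \<Rightarrow> 'a\<close>.  Modules that are quantified over inside
  definitions live in this universe.  It also contains, up to isomorphism, every module of
  cardinality at most the maximum of \<open>\<bar>R\<bar>\<close> and \<open>\<aleph>\<^sub>0\<close>, in particular the terms of minimal injective
  resolutions of finitely generated modules over a Noetherian ring.\<close>

type_synonym 'a rmod = "('a, (nat \<Rightarrow> 'a) set) module"

definition regular_module :: "('a, 'r) ring_scheme \<Rightarrow> ('a, 'a) module" where
  "regular_module R = mk_module (carrier R) \<zero>\<^bsub>R\<^esub> (\<oplus>\<^bsub>R\<^esub>) (\<otimes>\<^bsub>R\<^esub>)"

definition module_power :: "('a, 'b) module \<Rightarrow> nat \<Rightarrow> ('a, nat \<Rightarrow> 'b) module" where
  "module_power M n = mk_module ({..<n} \<rightarrow>\<^sub>E carrier M) (\<lambda>i\<in>{..<n}. \<zero>\<^bsub>M\<^esub>)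
     (\<lambda>u v. \<lambda>i\<in>{..<n}. u i \<oplus>\<^bsub>M\<^esub> v i) (\<lambda>r u. \<lambda>i\<in>{..<n}. r \<odot>\<^bsub>M\<^esub> u i)"

abbreviation free_module :: "('a, 'r) ring_scheme \<Rightarrow> nat \<Rightarrow> ('a, nat \<Rightarrow> 'a) module" where
  "free_module R n \<equiv> module_power (regular_module R) n"

definition direct_sum :: "('a, 'b) module \<Rightarrow> ('a, 'c) module \<Rightarrow> ('a, 'b \<times> 'c) module" where
  "direct_sum M N = mk_module (carrier M \<times> carrier N) (\<zero>\<^bsub>M\<^esub>, \<zero>\<^bsub>N\<^esub>)
     (\<lambda>u v. (fst u \<oplus>\<^bsub>M\<^esub> fst v, snd u \<oplus>\<^bsub>N\<^esub> snd v)) (\<lambda>r u. (r \<odot>\<^bsub>M\<^esub> fst u, r \<odot>\<^bsub>N\<^esub> snd u))"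

definition quotient_module :: "('a, 'b) module \<Rightarrow> 'b set \<Rightarrow> ('a, 'b set) module" where
  "quotient_module M N = mk_module (a_rcosets\<^bsub>M\<^esub> N) N (<+>\<^bsub>M\<^esub>) (\<lambda>r C. \<Union>c\<in>C. N +>\<^bsub>M\<^esub> (r \<odot>\<^bsub>M\<^esub> c))"

text \<open>Linear maps are taken to be extensional, so that \<open>Hom R M N\<close> is the actual set of maps.\<close>

definition Hom :: "('a, 'r) ring_scheme \<Rightarrow> ('a, 'b) module \<Rightarrow> ('a, 'c) module \<Rightarrow> ('b \<Rightarrow> 'c) set" where
  "Hom R M N = {f \<in> carrier M \<rightarrow>\<^sub>E carrier N.
     (\<forall>u\<in>carrier M. \<forall>v\<in>carrier M. f (u \<oplus>\<^bsub>M\<^esub> v) = f u \<oplus>\<^bsub>N\<^esub> f v) \<and>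
     (\<forall>r\<in>carrier R. \<forall>u\<in>carrier M. f (r \<odot>\<^bsub>M\<^esub> u) = r \<odot>\<^bsub>N\<^esub> f u)}"

definition Hom_module ::
    "('a, 'r) ring_scheme \<Rightarrow> ('a, 'b) module \<Rightarrow> ('a, 'c) module \<Rightarrow> ('a, 'b \<Rightarrow> 'c) module" where
  "Hom_module R M N = mk_module (Hom R M N) (\<lambda>u\<in>carrier M. \<zero>\<^bsub>N\<^esub>)
     (\<lambda>f g. \<lambda>u\<in>carrier M. f u \<oplus>\<^bsub>N\<^esub> g u) (\<lambda>r f. \<lambda>u\<in>carrier M. r \<odot>\<^bsub>N\<^esub> f u)"

definition module_ker :: "('a, 'b) module \<Rightarrow> ('a, 'c) module \<Rightarrow> ('b \<Rightarrow> 'c) \<Rightarrow> 'b set" where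
  "module_ker M N f = {u \<in> carrier M. f u = \<zero>\<^bsub>N\<^esub>}"

definition module_iso :: "('a, 'r) ring_scheme \<Rightarrow> ('a, 'b) module \<Rightarrow> ('a, 'c) module \<Rightarrow> bool" where
  "module_iso R M N \<longleftrightarrow> (\<exists>f\<in>Hom R M N. bij_betw f (carrier M) (carrier N))"

definition span_module :: "('a, 'r) ring_scheme \<Rightarrow> ('a, 'b) module \<Rightarrow> 'b set \<Rightarrow> 'b set" where
  "span_module R M S = \<Inter>{N. submodule N R M \<and> S \<subseteq> N}"

definition fg_module :: "('a, 'r) ring_scheme \<Rightarrow> ('a, 'b) module \<Rightarrow> bool" where
  "fg_module R M \<longleftrightarrow> module R M \<and> (\<exists>S\<subseteq>carrier M. finite S \<and> span_module R M S = carrier M)"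

section \<open>Local rings, dimension, depth, Cohen-Macaulay modules\<close>

locale noetherian_local_ring = cring R + noetherian_ring R + maximalideal \<mm> R
  for R (structure) and \<mm> +
  assumes maximal_unique: "maximalideal J R \<Longrightarrow> J = \<mm>"

abbreviation ideal_power :: "('a, 'r) ring_scheme \<Rightarrow> 'a set \<Rightarrow> nat \<Rightarrow> 'a set" where
  "ideal_power R I n \<equiv> I [^]\<^bsub>ideals_set R\<^esub> n"

definition krull_dim :: "('a, 'r) ring_scheme \<Rightarrow> enat" where
  "krull_dim R = Sup {enat n | n. \<exists>P :: nat \<Rightarrow> 'a set.
     (\<forall>i\<le>n. primeideal (P i) R) \<and> (\<forall>i<n. P i \<subset> P (Suc i))}"

definition residue_field :: "('a, 'r) ring_scheme \<Rightarrow> 'a set \<Rightarrow> ('a, 'a set) module" where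
  "residue_field R \<mm> = quotient_module (regular_module R) \<mm>"

definition set_smult :: "('a, 'r) ring_scheme \<Rightarrow> 'a set \<Rightarrow> ('a, 'b) module \<Rightarrow> 'b set" where
  "set_smult R S M = span_module R M {r \<odot>\<^bsub>M\<^esub> u | r u. r \<in> S \<and> u \<in> carrier M}"

text \<open>The second clause says that \<open>xs ! i\<close> is a nonzerodivisor on \<open>M / (xs ! 0, \<dots>, xs ! (i - 1)) M\<close>,
  the third that \<open>M / (xs) M\<close> is nonzero.\<close>

definition regular_sequence :: "('a, 'r) ring_scheme \<Rightarrow> ('a, 'b) module \<Rightarrow> 'a list \<Rightarrow> bool" where
  "regular_sequence R M xs \<longleftrightarrow> set xs \<subseteq> carrier R \<and>
     (\<forall>i<length xs. \<forall>u\<in>carrier M. xs ! i \<odot>\<^bsub>M\<^esub> u \<in> set_smult R (set (take i xs)) M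
        \<longrightarrow> u \<in> set_smult R (set (take i xs)) M) \<and>
     set_smult R (set xs) M \<noteq> carrier M"

definition depth :: "('a, 'r) ring_scheme \<Rightarrow> 'a set \<Rightarrow> ('a, 'b) module \<Rightarrow> enat" where
  "depth R \<mm> M = Sup {enat (length xs) | xs. set xs \<subseteq> \<mm> \<and> regular_sequence R M xs}"

definition CM_local_ring :: "('a, 'r) ring_scheme \<Rightarrow> 'a set \<Rightarrow> bool" where
  "CM_local_ring R \<mm> \<longleftrightarrow>
     noetherian_local_ring R \<mm> \<and> depth R \<mm> (regular_module R) = krull_dim R"

text \<open>The zero module counts as maximal Cohen-Macaulay.\<close>

definition MCM :: "('a, 'r) ring_scheme \<Rightarrow> 'a set \<Rightarrow> ('a, 'b) module \<Rightarrow> bool" where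
  "MCM R \<mm> M \<longleftrightarrow> fg_module R M \<and> (carrier M = {\<zero>\<^bsub>M\<^esub>} \<or> depth R \<mm> M = krull_dim R)"

definition system_of_parameters :: "('a, 'r) ring_scheme \<Rightarrow> 'a set \<Rightarrow> 'a list \<Rightarrow> bool" where
  "system_of_parameters R \<mm> xs \<longleftrightarrow> enat (length xs) = krull_dim R \<and> set xs \<subseteq> \<mm> \<and>
     (\<exists>k. ideal_power R \<mm> k \<subseteq> Idl\<^bsub>R\<^esub> (set xs))"

section \<open>Canonical modules\<close>

definition free_resolution ::
    "('a, 'r) ring_scheme \<Rightarrow> ('a, 'b) module \<Rightarrow> (nat \<Rightarrow> nat) \<Rightarrow>
     (nat \<Rightarrow> (nat \<Rightarrow> 'a) \<Rightarrow> (nat \<Rightarrow> 'a)) \<Rightarrow> ((nat \<Rightarrow> 'a) \<Rightarrow> 'b) \<Rightarrow> bool" where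
  "free_resolution R N b d e \<longleftrightarrow>
     e \<in> Hom R (free_module R (b 0)) N \<and> e ` carrier (free_module R (b 0)) = carrier N \<and>
     (\<forall>i. d i \<in> Hom R (free_module R (b (Suc i))) (free_module R (b i))) \<and>
     d 0 ` carrier (free_module R (b 1)) = module_ker (free_module R (b 0)) N e \<and>
     (\<forall>i. d (Suc i) ` carrier (free_module R (b (Suc (Suc i))))
            = module_ker (free_module R (b (Suc i))) (free_module R (b i)) (d i))"

text \<open>\<open>Ext\<^sup>i(N, M)\<close> for finitely generated \<open>N\<close> over a Noetherian ring, as the cohomology of
  \<open>Hom(F, M)\<close> for some resolution \<open>F\<close> of \<open>N\<close> by finitely generated free modules; up to isomorphism
  it does not depend on the choice.\<close>

definition Ext ::
    "('a, 'r) ring_scheme \<Rightarrow> nat \<Rightarrow> ('a, 'b) module \<Rightarrow> ('a, 'c) module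
     \<Rightarrow> ('a, ((nat \<Rightarrow> 'a) \<Rightarrow> 'c) set) module" where
  "Ext R i N M =
     (let (b, d) = (SOME (b, d). \<exists>e. free_resolution R N b d e);
          C = (\<lambda>j. Hom_module R (free_module R (b j)) M);
          cobd = (\<lambda>j f. compose (carrier (free_module R (b (Suc j)))) f (d j));
          B = (case i of 0 \<Rightarrow> {\<zero>\<^bsub>C 0\<^esub>} | Suc j \<Rightarrow> cobd j ` carrier (C j))
      in quotient_module ((C i)\<lparr>carrier := module_ker (C i) (C (Suc i)) (cobd i)\<rparr>) B)"

text \<open>For a nonzero finitely generated \<open>M\<close> of depth \<open>t\<close>, the type of \<open>M\<close> is the dimension of
  \<open>Ext\<^sup>t(R/\<mm>, M)\<close> over \<open>R/\<mm>\<close>.\<close>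

definition has_type :: "('a, 'r) ring_scheme \<Rightarrow> 'a set \<Rightarrow> ('a, 'b) module \<Rightarrow> nat \<Rightarrow> bool" where
  "has_type R \<mm> M n \<longleftrightarrow> depth R \<mm> M \<noteq> \<infinity> \<and>
     module_iso R (Ext R (the_enat (depth R \<mm> M)) (residue_field R \<mm>) M)
       (module_power (residue_field R \<mm>) n)"

text \<open>The test modules \<open>A\<close> and \<open>B\<close> range over a fixed universe; since it contains copies of \<open>R\<close> and
  all its ideals, Baer's criterion shows that this is no restriction.\<close>

definition injective_module :: "('a, 'r) ring_scheme \<Rightarrow> ('a, 'b) module \<Rightarrow> bool" where
  "injective_module R E \<longleftrightarrow> module R E \<and>
     (\<forall>(A :: 'a rmod) (B :: 'a rmod). module R A \<and> module R B \<longrightarrow>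
        (\<forall>i\<in>Hom R A B. \<forall>f\<in>Hom R A E. inj_on i (carrier A) \<longrightarrow>
           (\<exists>g\<in>Hom R B E. \<forall>a\<in>carrier A. g (i a) = f a)))"

text \<open>An exact sequence \<open>0 \<rightarrow> M \<rightarrow> I\<^sup>0 \<rightarrow> \<dots> \<rightarrow> I\<^sup>n \<rightarrow> 0\<close> with injective terms, continued by zeros.\<close>

definition finite_injective_dim :: "('a, 'r) ring_scheme \<Rightarrow> ('a, 'b) module \<Rightarrow> bool" where
  "finite_injective_dim R M \<longleftrightarrow>
     (\<exists>(I :: nat \<Rightarrow> 'a rmod) e d n.
        (\<forall>j. injective_module R (I j)) \<and>
        e \<in> Hom R M (I 0) \<and> inj_on e (carrier M) \<and>
        (\<forall>j. d j \<in> Hom R (I j) (I (Suc j))) \<and>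
        e ` carrier M = module_ker (I 0) (I 1) (d 0) \<and>
        (\<forall>j. d j ` carrier (I j) = module_ker (I (Suc j)) (I (Suc (Suc j))) (d (Suc j))) \<and>
        (\<forall>j>n. carrier (I j) = {\<zero>\<^bsub>I j\<^esub>}))"

definition canonical_module :: "('a, 'r) ring_scheme \<Rightarrow> 'a set \<Rightarrow> ('a, 'b) module \<Rightarrow> bool" where
  "canonical_module R \<mm> \<omega> \<longleftrightarrow> MCM R \<mm> \<omega> \<and> has_type R \<mm> \<omega> 1 \<and> finite_injective_dim R \<omega>"

definition trace_ideal :: "('a, 'r) ring_scheme \<Rightarrow> ('a, 'b) module \<Rightarrow> 'a set" where
  "trace_ideal R M = Idl\<^bsub>R\<^esub> (\<Union>f\<in>Hom R M (regular_module R). f ` carrier M)"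

section \<open>The associated graded ring\<close>

definition gr_component :: "('a, 'r) ring_scheme \<Rightarrow> 'a set \<Rightarrow> nat \<Rightarrow> 'a set set" where
  "gr_component R \<mm> i = {ideal_power R \<mm> (Suc i) +>\<^bsub>R\<^esub> a | a. a \<in> ideal_power R \<mm> i}"

definition gr_product ::
    "('a, 'r) ring_scheme \<Rightarrow> 'a set \<Rightarrow> nat \<Rightarrow> nat \<Rightarrow> 'a set \<Rightarrow> 'a set \<Rightarrow> 'a set" where
  "gr_product R \<mm> i j C D = (\<Union>c\<in>C. \<Union>d\<in>D. ideal_power R \<mm> (Suc (i + j)) +>\<^bsub>R\<^esub> (c \<otimes>\<^bsub>R\<^esub> d))"

text \<open>Elements are families \<open>u\<close> with \<open>u i \<in> \<mm>\<^sup>i / \<mm>\<^sup>i\<^sup>+\<^sup>1\<close>, almost all zero.  The sum of cosets in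
  the \<open>n\<close>-th component of a product is formed in \<open>R / \<mm>\<^sup>n\<^sup>+\<^sup>1\<close>, which contains \<open>\<mm>\<^sup>n / \<mm>\<^sup>n\<^sup>+\<^sup>1\<close>.\<close>

definition gr_ring :: "('a, 'r) ring_scheme \<Rightarrow> 'a set \<Rightarrow> (nat \<Rightarrow> 'a set) ring" where
  "gr_ring R \<mm> =
     \<lparr>carrier = {u. (\<forall>i. u i \<in> gr_component R \<mm> i) \<and> finite {i. u i \<noteq> ideal_power R \<mm> (Suc i)}},
      monoid.mult = (\<lambda>u v n. \<Oplus>\<^bsub>R Quot ideal_power R \<mm> (Suc n)\<^esub>i\<in>{..n}.
                gr_product R \<mm> i (n - i) (u i) (v (n - i))),
      one = (\<lambda>i. if i = 0 then ideal_power R \<mm> 1 +>\<^bsub>R\<^esub> \<one>\<^bsub>R\<^esub> else ideal_power R \<mm> (Suc i)),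
      ring.zero = (\<lambda>i. ideal_power R \<mm> (Suc i)),
      ring.add = (\<lambda>u v i. u i <+>\<^bsub>R\<^esub> v i)\<rparr>"

text \<open>The initial form of \<open>x \<in> \<mm>\<^sup>t - \<mm>\<^sup>t\<^sup>+\<^sup>1\<close>.\<close>

definition initial_form :: "('a, 'r) ring_scheme \<Rightarrow> 'a set \<Rightarrow> nat \<Rightarrow> 'a \<Rightarrow> nat \<Rightarrow> 'a set" where
  "initial_form R \<mm> t x =
     (\<lambda>i. if i = t then ideal_power R \<mm> (Suc t) +>\<^bsub>R\<^esub> x else ideal_power R \<mm> (Suc i))"

definition regular_element :: "('a, 'r) ring_scheme \<Rightarrow> 'a \<Rightarrow> bool" where
  "regular_element S a \<longleftrightarrow> a \<in> carrier S \<and> (\<forall>b\<in>carrier S. a \<otimes>\<^bsub>S\<^esub> b = \<zero>\<^bsub>S\<^esub> \<longrightarrow> b = \<zero>\<^bsub>S\<^esub>)"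

section \<open>Delta invariant, index, generalized Loewy length\<close>

definition has_free_summand :: "('a, 'r) ring_scheme \<Rightarrow> ('a, 'b) module \<Rightarrow> bool" where
  "has_free_summand R X \<longleftrightarrow>
     (\<exists>(Y :: 'a rmod) n. module R Y \<and> n \<ge> 1 \<and> module_iso R X (direct_sum Y (free_module R n)))"

text \<open>For finitely generated \<open>M\<close> the minimum exists, since \<open>X = 0\<close> is allowed.\<close>

definition delta :: "('a, 'r) ring_scheme \<Rightarrow> 'a set \<Rightarrow> ('a, 'b) module \<Rightarrow> nat" where
  "delta R \<mm> M = (LEAST n. \<exists>X :: 'a rmod. MCM R \<mm> X \<and> \<not> has_free_summand R X \<and>
     (\<exists>f\<in>Hom R (direct_sum X (free_module R n)) M.
        f ` carrier (direct_sum X (free_module R n)) = carrier M))"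

text \<open>The infimum of the empty set is \<open>\<infinity>\<close>.\<close>

definition ring_index :: "('a, 'r) ring_scheme \<Rightarrow> 'a set \<Rightarrow> enat" where
  "ring_index R \<mm> = Inf {enat n | n. n \<ge> 1 \<and>
     delta R \<mm> (quotient_module (regular_module R) (ideal_power R \<mm> n)) = 1}"

definition gen_loewy_length :: "('a, 'r) ring_scheme \<Rightarrow> 'a set \<Rightarrow> enat" where
  "gen_loewy_length R \<mm> = Inf {enat n | n. n \<ge> 1 \<and>
     (\<exists>xs. system_of_parameters R \<mm> xs \<and> ideal_power R \<mm> n \<subseteq> Idl\<^bsub>R\<^esub> (set xs))}"

end

theory Submission
  imports Defs
begin

text \<open>The module \<open>R/\<mm>^n\<close> is a quotient of \<open>R\<close>, so \<open>\<delta>(R/\<mm>^n)\<close> is \<open>0\<close> or \<open>1\<close>, and it is \<open>0\<close> exactly if some maximal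
  Cohen-Macaulay module \<open>X\<close> without free summand maps onto \<open>R/\<mm>^n\<close>.  Each inequality is a statement about the
  existence of such an \<open>X\<close>.

  Suppose first that \<open>\<mm>^n\<close> lies in \<open>(y)\<close> for a parameter \<open>y\<close>, and that a maximal Cohen-Macaulay module \<open>X\<close> maps
  onto \<open>R/\<mm>^n\<close>.  Write \<open>X = F/K\<close> with \<open>F\<close> free and lift the map to a functional \<open>\<rho>\<close> on \<open>F\<close>, which has a unit value
  and sends \<open>K\<close> into \<open>(y)\<close>.  The module \<open>\<omega>\<close> has finite injective dimension, so \<open>Ext^1(X, \<omega>) = 0\<close>.  Hence, for
  every \<open>w\<close> in \<open>\<omega>\<close>, the map \<open>u \<mapsto> \<rho>(u) w\<close> can be changed by \<open>y\<close> times some map \<open>h : F \<rightarrow> \<omega>\<close> so as to vanish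
  on \<open>K\<close>.  Composing with functionals \<open>\<phi>_i\<close> on \<open>\<omega>\<close> and summing over a representation of \<open>y\<close> as \<open>\<Sum> \<phi>_i(w_i)\<close>, which
  exists because \<open>\<mm>\<close> lies in the trace ideal, gives a functional \<open>y(\<rho> - \<Sum> \<phi>_i h_i)\<close> on \<open>X\<close>.  If the
  trace ideal is contained in \<open>\<mm>\<close>, division by \<open>y\<close> leaves a functional on \<open>X\<close> that still has a unit value, so \<open>X\<close>
  has a free summand.  If the trace ideal is \<open>R\<close>, the same is achieved directly with \<open>1\<close> in place of
  \<open>y\<close>.  The lemmas are \<open>trace_multiple_lifts\<close> and \<open>unit_functional_if_functional_mod\<close>.

  The vanishing of \<open>Ext^1(X, \<omega>)\<close> is proved with explicit maps instead of derived functors.  Walking down an injective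
  resolution of \<open>\<omega>\<close> from its end (\<open>extends_from_ideals_descent\<close>), one obtains that maps into the first
  cosyzygy extend from \<open>yX\<close> to \<open>X\<close>.  This means that \<open>Ext^1(X, \<omega>)\<close>, the cokernel of the restriction map from
  \<open>Hom(F, \<omega>)\<close> to \<open>Hom(K, \<omega>)\<close>, equals \<open>y\<close> times itself, and Nakayama's lemma finishes the argument
  (\<open>hom_extends_to_free\<close>).

  For the second inequality, suppose that \<open>\<mm>^(n+t-1)\<close> is not contained in \<open>(x)\<close>.  Then the ideal \<open>I = xR + \<mm>^(n+t-1)\<close>
  is not principal, because \<open>x\<close> is a minimal generator of it.  A nonprincipal ideal that contains a nonzerodivisor is a maximal
  Cohen-Macaulay module without free summand.  Regularity of the initial form of \<open>x\<close> makes multiplication by \<open>x\<close>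
  injective from \<open>\<mm>^(n-1)/\<mm>^n\<close> to \<open>\<mm>^(n+t-1)/\<mm>^(n+t)\<close>, and a linear complement of the image yields a map
  from \<open>I\<close> onto \<open>R/\<mm>^n\<close> that sends \<open>x\<close> to \<open>1\<close> (\<open>covered_0_if_power_not_subset\<close>).  So \<open>\<delta>(R/\<mm>^n) = 0\<close>.  Consequently
  \<open>\<mm>^(n+t-1)\<close> lies in \<open>(x)\<close> if \<open>n\<close> is the index.\<close>

section \<open>Ideals of Noetherian local rings\<close>

context cring
begin

lemma ideal_power_0 [simp]: "ideal_power R I 0 = carrier R"
  by (simp add: ideals_set_def nat_pow_def)

lemma ideal_power_Suc: "ideal_power R I (Suc n) = ideal_power R I n \<cdot> I"
  by (simp add: ideals_set_def nat_pow_def)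

lemma ideal_power_ideal: "ideal I R \<Longrightarrow> ideal (ideal_power R I n) R"
proof (induction n)
  case 0
  show ?case unfolding ideal_power_0 by (rule oneideal)
next
  case (Suc n)
  then show ?case unfolding ideal_power_Suc by (intro ideal_prod_is_ideal)
qed

lemma ideal_power_subset: "ideal I R \<Longrightarrow> ideal_power R I n \<subseteq> carrier R"
  using additive_subgroup.a_subset[OF ideal.axioms(1)[OF ideal_power_ideal]] .

lemma ideal_power_1: "ideal I R \<Longrightarrow> ideal_power R I (Suc 0) = I"
  using ideal_prod_commute[OF oneideal, of I] ideal_prod_one[of I]
  unfolding ideal_power_Suc ideal_power_0 by simp

lemma ideal_power_add:
  assumes "ideal I R"
  shows "ideal_power R I (i + j) = ideal_power R I i \<cdot> ideal_power R I j"
proof -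
  interpret M: comm_monoid "ideals_set R" by (rule ideals_set_is_comm_monoid)
  show ?thesis using M.nat_pow_mult[of I i j] assms by (simp add: ideals_set_def)
qed

lemma ideal_power_mult_mem:
  "ideal I R \<Longrightarrow> a \<in> ideal_power R I i \<Longrightarrow> b \<in> ideal_power R I j \<Longrightarrow> a \<otimes> b \<in> ideal_power R I (i + j)"
  by (simp add: ideal_power_add ideal_prod.prod)

lemma pow_mem_ideal_power: "a \<in> I \<Longrightarrow> a [^] (j::nat) \<in> ideal_power R I j"
proof (induction j)
  case 0
  show ?case unfolding ideal_power_0 by simp
next
  case (Suc j)
  then show ?case unfolding ideal_power_Suc nat_pow_Suc by (intro ideal_prod.prod)
qed

lemma ideal_power_antimono:
  assumes "ideal I R" "i \<le> j"
  shows "ideal_power R I j \<subseteq> ideal_power R I i"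
proof -
  have "ideal_power R I (i + (j - i)) \<subseteq> ideal_power R I i"
    unfolding ideal_power_add[OF assms(1)]
    using ideal_prod_inter[OF ideal_power_ideal ideal_power_ideal] assms(1) by blast
  then show ?thesis using assms(2) by simp
qed

lemma ideal_prod_subsetI:
  assumes "ideal P R" "\<And>a b. a \<in> I \<Longrightarrow> b \<in> J \<Longrightarrow> a \<otimes> b \<in> P"
  shows "I \<cdot> J \<subseteq> P"
proof
  fix s assume "s \<in> I \<cdot> J"
  then show "s \<in> P"
    by induction (auto intro: assms additive_subgroup.a_closed[OF ideal.axioms(1)])
qed

lemma set_addI: "a \<in> I \<Longrightarrow> b \<in> J \<Longrightarrow> a \<oplus> b \<in> I <+> J"
  by (auto simp: set_add_defs)

lemma set_addE:
  assumes "(u::'a) \<in> I <+> J"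
  obtains a b where "a \<in> I" "b \<in> J" "u = a \<oplus> b"
  using assms by (auto simp: set_add_defs)

lemma subset_add_ideals:
  assumes "ideal I R" "ideal J R"
  shows "I \<subseteq> I <+> J" "J \<subseteq> I <+> J"
proof -
  interpret I: ideal I R by fact
  interpret J: ideal J R by fact
  show "I \<subseteq> I <+> J" using set_addI[of _ I \<zero> J] by force
  show "J \<subseteq> I <+> J" using set_addI[of \<zero> I _ J] by force
qed

lemma ideal_minus_closed: "ideal I R \<Longrightarrow> a \<in> I \<Longrightarrow> b \<in> I \<Longrightarrow> a \<ominus> b \<in> I"
  by (metis a_minus_def additive_subgroup.a_closed additive_subgroup.a_inv_closed ideal.axioms(1))

lemma idealI':
  assumes "I \<subseteq> carrier R" "\<zero> \<in> I" "\<And>a b. a \<in> I \<Longrightarrow> b \<in> I \<Longrightarrow> a \<oplus> b \<in> I"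
    "\<And>r a. r \<in> carrier R \<Longrightarrow> a \<in> I \<Longrightarrow> r \<otimes> a \<in> I"
  shows "ideal I R"
proof (rule idealI)
  have "\<ominus> a \<in> I" if "a \<in> I" for a
    using assms(4)[of "\<ominus> \<one>" a] that assms(1) by (auto simp: l_minus)
  then show "subgroup I (add_monoid R)"
    using assms by (intro subgroup.intro) (auto simp: a_inv_def[symmetric])
  show "a \<otimes> x \<in> I" if "a \<in> I" "x \<in> carrier R" for a x
    using assms(4)[of x a] that assms(1) m_comm[of a x] by auto
qed (use assms in \<open>auto simp: ring_axioms\<close>)

end

context noetherian_ring
begin

lemma exists_maximal_ideal_with:
  assumes "ideal A R" "Q A"
  obtains M where "ideal M R" "Q M" "\<And>J. ideal J R \<Longrightarrow> Q J \<Longrightarrow> M \<subseteq> J \<Longrightarrow> J = M"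
proof -
  define S where "S = {I. ideal I R \<and> Q I}"
  have "\<exists>M\<in>S. \<forall>J\<in>S. M \<subseteq> J \<longrightarrow> J = M"
  proof (rule subset_Zorn_nonempty)
    show "S \<noteq> {}" using assms by (auto simp: S_def)
    fix C assume C: "C \<noteq> {}" "subset.chain S C"
    then have "subset.chain {I. ideal I R} C" unfolding S_def subset.chain_def by fast
    then have "\<Union>C \<in> C" by (rule ideal_chain_is_trivial[OF C(1)])
    then show "\<Union>C \<in> S" using C(2) unfolding subset.chain_def by fast
  qed
  then show thesis using that unfolding S_def by auto
qed

end

context noetherian_local_ring
begin

lemma m_ideal: "ideal \<mm> R" by (rule is_ideal)

lemma m_proper: "\<one> \<notin> \<mm>"
  using one_imp_carrier I_notcarr by blast

lemma proper_ideal_subset: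
  assumes "ideal I R" "I \<noteq> carrier R"
  shows "I \<subseteq> \<mm>"
proof -
  obtain M where M0: "ideal M R" "I \<subseteq> M \<and> M \<noteq> carrier R"
    and max: "\<And>J. ideal J R \<Longrightarrow> I \<subseteq> J \<and> J \<noteq> carrier R \<Longrightarrow> M \<subseteq> J \<Longrightarrow> J = M"
    by (rule exists_maximal_ideal_with[where Q = "\<lambda>J. I \<subseteq> J \<and> J \<noteq> carrier R", OF assms(1)])
      (use assms(2) in auto)
  then have M: "ideal M R" "I \<subseteq> M" "M \<noteq> carrier R" by auto
  have "maximalideal M R"
  proof (rule maximalidealI)
    show "ideal M R" "carrier R \<noteq> M" using M by auto
    show "J = M \<or> J = carrier R" if "ideal J R" "M \<subseteq> J" for J
      using max[OF that(1)] that(2) M(2) by blast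
  qed
  then show ?thesis using maximal_unique M by blast
qed

lemma m_subset_prime: "primeideal P R \<Longrightarrow> P \<subseteq> \<mm>"
  using proper_ideal_subset primeideal.I_notcarr primeideal.axioms(1) by blast

lemma unit_if_not_mem:
  assumes "r \<in> carrier R" "r \<notin> \<mm>"
  shows "r \<in> Units R"
proof -
  have "PIdl r = carrier R"
  proof (rule ccontr)
    assume "PIdl r \<noteq> carrier R"
    then have "PIdl r \<subseteq> \<mm>" by (rule proper_ideal_subset[OF cgenideal_ideal[OF assms(1)]])
    then show False using cgenideal_self[OF assms(1)] assms(2) by (meson subsetD)
  qed
  then have "\<one> \<in> PIdl r" by simp
  then obtain s where "s \<in> carrier R" "s \<otimes> r = \<one>"
    unfolding cgenideal_def by auto
  then show ?thesis using assms m_comm[of r] unfolding Units_def by force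
qed

lemma mem_if_unit_mult_mem:
  assumes "ideal P R" "a \<in> carrier R" "a \<notin> \<mm>" "s \<in> carrier R" "a \<otimes> s \<in> P"
  shows "s \<in> P"
proof -
  have u: "a \<in> Units R" by (rule unit_if_not_mem[OF assms(2,3)])
  have "inv a \<otimes> (a \<otimes> s) \<in> P" by (rule ideal.I_l_closed[OF assms(1,5) Units_inv_closed[OF u]])
  then show ?thesis using u assms(2,4) by (simp add: m_assoc[symmetric])
qed

lemma one_minus_unit: "a \<in> \<mm> \<Longrightarrow> \<one> \<ominus> a \<in> Units R"
proof (rule unit_if_not_mem)
  assume a: "a \<in> \<mm>"
  then have c: "a \<in> carrier R" by (rule Icarr)
  then show "\<one> \<ominus> a \<in> carrier R" by simp
  have "(\<one> \<ominus> a) \<oplus> a = \<one>" using c by algebra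
  then show "\<one> \<ominus> a \<notin> \<mm>" using a m_proper a_closed by metis
qed

text \<open>A maximal non-member \<open>P\<close> of a product-closed family of ideals is prime: two ideals not contained in \<open>P\<close>
  enlarge it to members, whose product would otherwise put \<open>P\<close> into the family.  Multiplicatively closed
  sets and powers of \<open>\<mm>\<close> both give such families.\<close>

lemma exists_prime_outside:
  assumes fam: "\<And>I J K. ideal I R \<Longrightarrow> ideal J R \<Longrightarrow> ideal K R \<Longrightarrow> F I \<Longrightarrow> F J \<Longrightarrow> I \<cdot> J \<subseteq> K \<Longrightarrow> F K"
    and "F (carrier R)" "ideal A R" "\<not> F A"
  shows "\<exists>P. primeideal P R \<and> A \<subseteq> P \<and> \<not> F P"
proof -
  obtain P where P0: "ideal P R" "A \<subseteq> P \<and> \<not> F P"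
    and max0: "\<And>J. ideal J R \<Longrightarrow> A \<subseteq> J \<and> \<not> F J \<Longrightarrow> P \<subseteq> J \<Longrightarrow> J = P"
    by (rule exists_maximal_ideal_with[where Q = "\<lambda>J. A \<subseteq> J \<and> \<not> F J", OF assms(3)])
      (use assms(4) in auto)
  then have P: "ideal P R" "A \<subseteq> P" "\<not> F P" by auto
  have max: "F J" if "ideal J R" "P \<subseteq> J" "\<not> J \<subseteq> P" for J
    using max0[OF that(1)] P(2) that by auto
  have "primeideal P R"
  proof (rule divides_ideal_prod_imp_primeideal)
    show "ideal P R" "P \<noteq> carrier R" using P assms(2) by auto
    fix I J assume I: "ideal I R" and J: "ideal J R" and IJ: "I \<cdot> J \<subseteq> P"
    show "I \<subseteq> P \<or> J \<subseteq> P"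
    proof (rule ccontr)
      assume n: "\<not> ?thesis"
      have FI: "F (P <+> I)"
        using max[OF add_ideals[OF P(1) I]] subset_add_ideals[OF P(1) I] n by auto
      have FJ: "F (P <+> J)"
        using max[OF add_ideals[OF P(1) J]] subset_add_ideals[OF P(1) J] n by auto
      have "(P <+> I) \<cdot> (P <+> J) \<subseteq> P"
      proof (rule ideal_prod_subsetI[OF P(1)])
        interpret P: ideal P R by (rule P)
        fix a b :: 'a assume "a \<in> P <+> I" "b \<in> P <+> J"
        then obtain p i q j where ab: "a = p \<oplus> i" "b = q \<oplus> j"
          and pi: "p \<in> P" "i \<in> I" "q \<in> P" "j \<in> J" by (auto elim!: set_addE)
        have car: "p \<in> carrier R" "q \<in> carrier R" "i \<in> carrier R" "j \<in> carrier R"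
          using pi ideal.Icarr[OF P(1)] ideal.Icarr[OF I] ideal.Icarr[OF J] by auto
        have "i \<otimes> j \<in> P" using ideal_prod.prod[OF pi(2,4), of R] IJ by (rule_tac subsetD)
        moreover have "a \<otimes> b = (q \<oplus> j) \<otimes> p \<oplus> (i \<otimes> q \<oplus> i \<otimes> j)"
          unfolding ab using car by algebra
        ultimately show "a \<otimes> b \<in> P"
          using pi car by (simp add: P.I_l_closed P.a_closed)
      qed
      then show False
        using fam[OF add_ideals[OF P(1) I] add_ideals[OF P(1) J] P(1) FI FJ] P(3) by blast
    qed
  qed
  then show ?thesis using P by blast
qed

text \<open>If no power of \<open>\<mm>\<close> lies in \<open>(a)\<close>, some prime \<open>P\<close> other than \<open>\<mm>\<close> contains \<open>a\<close>.  The products of powers of \<open>a\<close> with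
  elements outside \<open>P\<close> form a multiplicatively closed set, which avoids \<open>0\<close> because \<open>a\<close> is a nonzerodivisor.
  So \<open>P\<close> contains a prime without \<open>a\<close>, and this is a chain of three primes.\<close>

lemma nonzerodivisor_m_primary:
  assumes dim: "krull_dim R = 1" and a: "a \<in> \<mm>"
    and reg: "\<And>r. r \<in> carrier R \<Longrightarrow> a \<otimes> r = \<zero> \<Longrightarrow> r = \<zero>"
  shows "\<exists>k. ideal_power R \<mm> k \<subseteq> PIdl a"
proof (rule ccontr)
  assume n: "\<not> ?thesis"
  have ac: "a \<in> carrier R" using a by (rule Icarr)
  define F where "F I \<longleftrightarrow> (\<exists>k. ideal_power R \<mm> k \<subseteq> I)" for I
  have "\<exists>P. primeideal P R \<and> PIdl a \<subseteq> P \<and> \<not> F P"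
  proof (rule exists_prime_outside)
    fix I J K assume ids: "ideal I R" "ideal J R" "ideal K R" "F I" "F J" and K: "I \<cdot> J \<subseteq> K"
    then obtain k l where kl: "ideal_power R \<mm> k \<subseteq> I" "ideal_power R \<mm> l \<subseteq> J" by (auto simp: F_def)
    have "ideal_power R \<mm> (k + l) \<subseteq> K"
      unfolding ideal_power_add[OF m_ideal]
    proof (rule ideal_prod_subsetI[OF ids(3)])
      show "x \<otimes> y \<in> K" if "x \<in> ideal_power R \<mm> k" "y \<in> ideal_power R \<mm> l" for x y
        using ideal_prod.prod[of x I y J R] that kl K by auto
    qed
    then show "F K" by (auto simp: F_def)
  next
    show "F (carrier R)" using ideal_power_0[of \<mm>] unfolding F_def by blast
  qed (use n ac in \<open>auto simp: F_def intro: cgenideal_ideal\<close>)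
  then obtain P where P: "primeideal P R" "PIdl a \<subseteq> P" "\<not> F P" by blast
  have Pm: "P \<subset> \<mm>"
    using m_subset_prime[OF P(1)] P(3) ideal_power_1[OF m_ideal] unfolding F_def by (metis psubsetI subset_refl)
  interpret P: primeideal P R by (rule P)
  define G where "G I \<longleftrightarrow> (\<exists>i s. s \<in> carrier R \<and> s \<notin> P \<and> a [^] (i::nat) \<otimes> s \<in> I)" for I
  have "\<exists>Q. primeideal Q R \<and> {\<zero>} \<subseteq> Q \<and> \<not> G Q"
  proof (rule exists_prime_outside)
    fix I J K assume ids: "ideal I R" "ideal J R" "ideal K R" "G I" "G J" and K: "I \<cdot> J \<subseteq> K"
    then obtain i s j u where s: "s \<in> carrier R" "s \<notin> P" "a [^] (i::nat) \<otimes> s \<in> I"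
      and u: "u \<in> carrier R" "u \<notin> P" "a [^] (j::nat) \<otimes> u \<in> J" by (auto simp: G_def)
    have "(a [^] i \<otimes> s) \<otimes> (a [^] j \<otimes> u) \<in> K" using ideal_prod.prod[OF s(3) u(3), of R] K by (rule_tac subsetD)
    moreover have "(a [^] i \<otimes> s) \<otimes> (a [^] j \<otimes> u) = a [^] (i + j) \<otimes> (s \<otimes> u)"
      using s u ac by (simp add: nat_pow_mult[symmetric] m_ac)
    moreover have "s \<otimes> u \<notin> P" using P.I_prime s u by blast
    ultimately show "G K" unfolding G_def using s u by (metis m_closed)
  next
    have "\<one> \<notin> P" using P.I_notcarr P.one_imp_carrier by blast
    then show "G (carrier R)" unfolding G_def using ac by (metis m_closed nat_pow_closed one_closed)
  next
    show "ideal {\<zero>} R" by (rule zeroideal)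
    have "s = \<zero>" if "s \<in> carrier R" "a [^] (i::nat) \<otimes> s = \<zero>" for i s
      using that
    proof (induction i)
      case (Suc i)
      have "a \<otimes> (a [^] i \<otimes> s) = a [^] Suc i \<otimes> s"
        using ac Suc.prems(1) by (simp add: m_ac)
      then have "a [^] i \<otimes> s = \<zero>"
        using reg[of "a [^] i \<otimes> s"] Suc.prems ac by simp
      then show ?case using Suc.IH Suc.prems(1) by simp
    qed simp
    then show "\<not> G {\<zero>}" unfolding G_def by (metis P.zero_closed singletonD)
  qed
  then obtain Q where Q: "primeideal Q R" "\<not> G Q" by blast
  have QP: "Q \<subset> P"
  proof -
    have "Q \<subseteq> P"
    proof
      fix s assume "s \<in> Q"
      moreover from this have "s \<in> carrier R"
        by (rule ideal.Icarr[OF primeideal.axioms(1)[OF Q(1)]])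
      moreover from this have "a [^] (0::nat) \<otimes> s = s" by simp
      ultimately show "s \<in> P" using Q(2) unfolding G_def by metis
    qed
    moreover have "a \<in> P" using P(2) cgenideal_self[OF ac] by blast
    moreover have "a \<notin> Q"
    proof
      assume "a \<in> Q"
      moreover have "a [^] (1::nat) \<otimes> \<one> = a" using ac by simp
      moreover have "\<one> \<notin> P" using P.I_notcarr P.one_imp_carrier by blast
      ultimately show False using Q(2) unfolding G_def by (metis one_closed)
    qed
    ultimately show ?thesis by blast
  qed
  have m_prime: "primeideal \<mm> R" using maximalideal_prime[OF is_maximalideal] .
  define C where "C = (\<lambda>i::nat. if i = 0 then Q else if i = 1 then P else \<mm>)"
  have "(\<forall>i\<le>2. primeideal (C i) R) \<and> (\<forall>i<2. C i \<subset> C (Suc i))"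
    using Q P(1) m_prime QP Pm by (auto simp: C_def numeral_2_eq_2 less_Suc_eq)
  then have "enat 2 \<le> krull_dim R" unfolding krull_dim_def by (intro Sup_upper) blast
  then show False using dim by (simp add: one_enat_def)
qed

end

section \<open>Modules and linear maps\<close>

lemma mk_module_simps [simp]:
  "carrier (mk_module C z p s) = C" "\<zero>\<^bsub>mk_module C z p s\<^esub> = z"
  "u \<oplus>\<^bsub>mk_module C z p s\<^esub> v = p u v" "r \<odot>\<^bsub>mk_module C z p s\<^esub> u = s r u"
  by (simp_all add: mk_module_def)

lemma module_mk_moduleI:
  assumes "cring R" "z \<in> C" "\<And>u v. u \<in> C \<Longrightarrow> v \<in> C \<Longrightarrow> p u v \<in> C"
    "\<And>r u. r \<in> carrier R \<Longrightarrow> u \<in> C \<Longrightarrow> s r u \<in> C"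
    "\<And>u v w. u \<in> C \<Longrightarrow> v \<in> C \<Longrightarrow> w \<in> C \<Longrightarrow> p (p u v) w = p u (p v w)"
    "\<And>u v. u \<in> C \<Longrightarrow> v \<in> C \<Longrightarrow> p u v = p v u"
    "\<And>u. u \<in> C \<Longrightarrow> p z u = u" "\<And>u. u \<in> C \<Longrightarrow> \<exists>v\<in>C. p v u = z"
    "\<And>r q u. r \<in> carrier R \<Longrightarrow> q \<in> carrier R \<Longrightarrow> u \<in> C \<Longrightarrow> s (r \<oplus>\<^bsub>R\<^esub> q) u = p (s r u) (s q u)"
    "\<And>r u v. r \<in> carrier R \<Longrightarrow> u \<in> C \<Longrightarrow> v \<in> C \<Longrightarrow> s r (p u v) = p (s r u) (s r v)"
    "\<And>r q u. r \<in> carrier R \<Longrightarrow> q \<in> carrier R \<Longrightarrow> u \<in> C \<Longrightarrow> s (r \<otimes>\<^bsub>R\<^esub> q) u = s r (s q u)"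
    "\<And>u. u \<in> C \<Longrightarrow> s \<one>\<^bsub>R\<^esub> u = u"
  shows "module R (mk_module C z p s)"
proof (rule moduleI)
  show "abelian_group (mk_module C z p s)"
    by (rule abelian_groupI) (use assms in auto)
qed (use assms in auto)

lemma regular_module_simps [simp]:
  "carrier (regular_module R) = carrier R" "\<zero>\<^bsub>regular_module R\<^esub> = \<zero>\<^bsub>R\<^esub>"
  "u \<oplus>\<^bsub>regular_module R\<^esub> v = u \<oplus>\<^bsub>R\<^esub> v" "r \<odot>\<^bsub>regular_module R\<^esub> u = r \<otimes>\<^bsub>R\<^esub> u"
  by (simp_all add: regular_module_def)

lemma (in cring) regular_module_module: "module R (regular_module R)"
  unfolding regular_module_def
  by (rule module_mk_moduleI)
    (auto simp: is_cring m_assoc l_distr r_distr a_ac intro: bexI[of _ "\<ominus> _"] l_neg)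

context module
begin

lemma submoduleI':
  assumes "H \<subseteq> carrier M" "\<zero>\<^bsub>M\<^esub> \<in> H" "\<And>a b. a \<in> H \<Longrightarrow> b \<in> H \<Longrightarrow> a \<oplus>\<^bsub>M\<^esub> b \<in> H"
    "\<And>r a. r \<in> carrier R \<Longrightarrow> a \<in> H \<Longrightarrow> r \<odot>\<^bsub>M\<^esub> a \<in> H"
  shows "submodule H R M"
proof (rule submoduleI)
  fix a assume "a \<in> H"
  then show "\<ominus>\<^bsub>M\<^esub> a \<in> H" using assms(4)[of "\<ominus> \<one>" a] assms(1) by (auto simp: smult_l_minus)
qed (use assms in auto)

lemma submodule_zero: "submodule H R M \<Longrightarrow> \<zero>\<^bsub>M\<^esub> \<in> H"
  using submodule.axioms(1) subgroup.one_closed by fastforce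

lemma submodule_minus: "submodule H R M \<Longrightarrow> a \<in> H \<Longrightarrow> b \<in> H \<Longrightarrow> a \<ominus>\<^bsub>M\<^esub> b \<in> H"
  unfolding a_minus_def by (intro submoduleE(5) submoduleE(3)) 

lemma smult_minus_left:
  "a \<in> carrier R \<Longrightarrow> b \<in> carrier R \<Longrightarrow> u \<in> carrier M \<Longrightarrow>
    (a \<ominus> b) \<odot>\<^bsub>M\<^esub> u = a \<odot>\<^bsub>M\<^esub> u \<ominus>\<^bsub>M\<^esub> b \<odot>\<^bsub>M\<^esub> u"
  by (simp add: a_minus_def smult_l_distr smult_l_minus M.minus_eq)

lemma smult_minus_right:
  "a \<in> carrier R \<Longrightarrow> u \<in> carrier M \<Longrightarrow> v \<in> carrier M \<Longrightarrow>
    a \<odot>\<^bsub>M\<^esub> (u \<ominus>\<^bsub>M\<^esub> v) = a \<odot>\<^bsub>M\<^esub> u \<ominus>\<^bsub>M\<^esub> a \<odot>\<^bsub>M\<^esub> v"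
  by (simp add: smult_r_distr smult_r_minus M.minus_eq)

lemma smult_commute:
  "a \<in> carrier R \<Longrightarrow> b \<in> carrier R \<Longrightarrow> u \<in> carrier M \<Longrightarrow> a \<odot>\<^bsub>M\<^esub> (b \<odot>\<^bsub>M\<^esub> u) = b \<odot>\<^bsub>M\<^esub> (a \<odot>\<^bsub>M\<^esub> u)"
  by (metis m_comm smult_assoc1)

lemma minus_add_cancel: "u \<in> carrier M \<Longrightarrow> v \<in> carrier M \<Longrightarrow> u \<ominus>\<^bsub>M\<^esub> v \<oplus>\<^bsub>M\<^esub> v = u"
  by (simp add: M.minus_eq M.a_assoc M.l_neg)

lemma minus_eq_zeroD: "u \<in> carrier M \<Longrightarrow> v \<in> carrier M \<Longrightarrow> u \<ominus>\<^bsub>M\<^esub> v = \<zero>\<^bsub>M\<^esub> \<Longrightarrow> u = v"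
  using minus_add_cancel[of u v] by simp

lemma submodule_module: "submodule N R M \<Longrightarrow> module R (M\<lparr>carrier := N\<rparr>)"
  using submodule.submodule_is_module module_axioms by blast

definition adjoin :: "'c set \<Rightarrow> 'c \<Rightarrow> 'c set" where
  "adjoin N b = {n \<oplus>\<^bsub>M\<^esub> r \<odot>\<^bsub>M\<^esub> b | n r. n \<in> N \<and> r \<in> carrier R}"

lemma adjoin:
  assumes N: "submodule N R M" and b: "b \<in> carrier M"
  shows "submodule (adjoin N b) R M" "N \<subseteq> adjoin N b" "b \<in> adjoin N b"
proof -
  have Nc: "N \<subseteq> carrier M" using submoduleE(1)[OF N] .
  show "submodule (adjoin N b) R M"
  proof (rule submoduleI')
    show "adjoin N b \<subseteq> carrier M" using Nc b by (auto simp: adjoin_def)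
    show "\<zero>\<^bsub>M\<^esub> \<in> adjoin N b"
      unfolding adjoin_def using submodule_zero[OF N] b
      by (auto intro!: exI[of _ "\<zero>\<^bsub>M\<^esub>"] exI[of _ \<zero>])
    fix u assume "u \<in> adjoin N b"
    then obtain n r where u: "u = n \<oplus>\<^bsub>M\<^esub> r \<odot>\<^bsub>M\<^esub> b" "n \<in> N" "r \<in> carrier R" by (auto simp: adjoin_def)
    { fix v assume "v \<in> adjoin N b"
      then obtain p q where v: "v = p \<oplus>\<^bsub>M\<^esub> q \<odot>\<^bsub>M\<^esub> b" "p \<in> N" "q \<in> carrier R" by (auto simp: adjoin_def)
      have "u \<oplus>\<^bsub>M\<^esub> v = (n \<oplus>\<^bsub>M\<^esub> p) \<oplus>\<^bsub>M\<^esub> (r \<oplus> q) \<odot>\<^bsub>M\<^esub> b"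
        using u v b Nc by (auto simp: smult_l_distr M.a_ac subset_iff)
      then show "u \<oplus>\<^bsub>M\<^esub> v \<in> adjoin N b"
        using u v submoduleE(5)[OF N] unfolding adjoin_def by blast }
    fix c assume c: "c \<in> carrier R"
    have "c \<odot>\<^bsub>M\<^esub> u = c \<odot>\<^bsub>M\<^esub> n \<oplus>\<^bsub>M\<^esub> (c \<otimes> r) \<odot>\<^bsub>M\<^esub> b"
      using u b Nc c by (auto simp: smult_r_distr smult_assoc1 subset_iff)
    then show "c \<odot>\<^bsub>M\<^esub> u \<in> adjoin N b"
      using u c submoduleE(4)[OF N] unfolding adjoin_def by blast
  qed
  show "N \<subseteq> adjoin N b"
  proof
    fix n assume "n \<in> N"
    then have "n = n \<oplus>\<^bsub>M\<^esub> \<zero> \<odot>\<^bsub>M\<^esub> b" using Nc b by auto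
    then show "n \<in> adjoin N b" using \<open>n \<in> N\<close> unfolding adjoin_def by blast
  qed
  have "b = \<zero>\<^bsub>M\<^esub> \<oplus>\<^bsub>M\<^esub> \<one> \<odot>\<^bsub>M\<^esub> b" using b by auto
  then show "b \<in> adjoin N b" using submodule_zero[OF N] unfolding adjoin_def by blast
qed

end

lemma span_submodule:
  assumes "module R M" "S \<subseteq> carrier M"
  shows "submodule (span_module R M S) R M"
proof -
  interpret M: module R M by fact
  show ?thesis
  proof (rule M.submoduleI')
    show "span_module R M S \<subseteq> carrier M"
      using M.carrier_is_submodule assms(2) by (auto simp: span_module_def)
  qed (auto simp: span_module_def M.submodule_zero M.submoduleE)
qed

lemma span_superset: "S \<subseteq> span_module R M S"
  by (auto simp: span_module_def)

lemma span_minimal: "submodule N R M \<Longrightarrow> S \<subseteq> N \<Longrightarrow> span_module R M S \<subseteq> N"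
  by (auto simp: span_module_def)

lemma span_of_submodule: "submodule N R M \<Longrightarrow> span_module R M N = N"
  using span_minimal[of N R M N] span_superset[of N R M] by auto

lemma (in cring) submodule_regular_iff: "submodule I R (regular_module R) \<longleftrightarrow> ideal I R"
proof
  interpret M: module R "regular_module R" by (rule regular_module_module)
  show "ideal I R" if I: "submodule I R (regular_module R)"
    using M.submoduleE(1,4,5)[OF I] M.submodule_zero[OF I] by (intro idealI') auto
  show "submodule I R (regular_module R)" if I: "ideal I R"
    using additive_subgroup.zero_closed[OF ideal.axioms(1)[OF I]] ideal.Icarr[OF I]
      additive_subgroup.a_closed[OF ideal.axioms(1)[OF I]] ideal.I_l_closed[OF I]
    by (intro M.submoduleI') auto
qed

text \<open>In contrast to the elements of \<open>Hom\<close>, these maps need not be extensional, so that composites and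
  restrictions to submodules are again linear without being truncated.\<close>

definition linear_map ::
    "('a, 'r) ring_scheme \<Rightarrow> ('a, 'b) module \<Rightarrow> ('a, 'c) module \<Rightarrow> ('b \<Rightarrow> 'c) \<Rightarrow> bool" where
  "linear_map R M N f \<longleftrightarrow> (\<forall>u\<in>carrier M. f u \<in> carrier N) \<and>
     (\<forall>u\<in>carrier M. \<forall>v\<in>carrier M. f (u \<oplus>\<^bsub>M\<^esub> v) = f u \<oplus>\<^bsub>N\<^esub> f v) \<and>
     (\<forall>r\<in>carrier R. \<forall>u\<in>carrier M. f (r \<odot>\<^bsub>M\<^esub> u) = r \<odot>\<^bsub>N\<^esub> f u)"

lemma linear_mapI:
  assumes "\<And>u. u \<in> carrier M \<Longrightarrow> f u \<in> carrier N"
    "\<And>u v. u \<in> carrier M \<Longrightarrow> v \<in> carrier M \<Longrightarrow> f (u \<oplus>\<^bsub>M\<^esub> v) = f u \<oplus>\<^bsub>N\<^esub> f v"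
    "\<And>r u. r \<in> carrier R \<Longrightarrow> u \<in> carrier M \<Longrightarrow> f (r \<odot>\<^bsub>M\<^esub> u) = r \<odot>\<^bsub>N\<^esub> f u"
  shows "linear_map R M N f"
  using assms by (auto simp: linear_map_def)

lemma linear_mapD:
  assumes "linear_map R M N f"
  shows "u \<in> carrier M \<Longrightarrow> f u \<in> carrier N"
    "u \<in> carrier M \<Longrightarrow> v \<in> carrier M \<Longrightarrow> f (u \<oplus>\<^bsub>M\<^esub> v) = f u \<oplus>\<^bsub>N\<^esub> f v"
    "r \<in> carrier R \<Longrightarrow> u \<in> carrier M \<Longrightarrow> f (r \<odot>\<^bsub>M\<^esub> u) = r \<odot>\<^bsub>N\<^esub> f u"
  using assms by (auto simp: linear_map_def)

lemma Hom_linear: "f \<in> Hom R M N \<Longrightarrow> linear_map R M N f"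
  by (auto simp: Hom_def linear_map_def PiE_def Pi_def)

lemma linear_restrict_Hom:
  assumes "module R M" "linear_map R M N f"
  shows "restrict f (carrier M) \<in> Hom R M N"
proof -
  interpret M: module R M by fact
  show ?thesis using linear_mapD[OF assms(2)] by (auto simp: Hom_def)
qed

lemma linear_map_restrict:
  "linear_map R M N f \<Longrightarrow> H \<subseteq> carrier M \<Longrightarrow> linear_map R (M\<lparr>carrier := H\<rparr>) N f"
  by (auto simp: linear_map_def subset_iff)

lemma linear_map_into_sub:
  "linear_map R M N f \<Longrightarrow> (\<And>u. u \<in> carrier M \<Longrightarrow> f u \<in> Z) \<Longrightarrow> linear_map R M (N\<lparr>carrier := Z\<rparr>) f"
  by (auto simp: linear_map_def)

lemma linear_map_out_of_sub:
  "linear_map R M (N\<lparr>carrier := Z\<rparr>) f \<Longrightarrow> Z \<subseteq> carrier N \<Longrightarrow> linear_map R M N f"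
  by (auto simp: linear_map_def)

lemma linear_map_comp:
  "linear_map R M N f \<Longrightarrow> linear_map R N P g \<Longrightarrow> linear_map R M P (\<lambda>u. g (f u))"
  by (auto simp: linear_map_def)

lemma linear_map_add:
  assumes "module R N" "linear_map R M N f" "linear_map R M N g"
  shows "linear_map R M N (\<lambda>u. f u \<oplus>\<^bsub>N\<^esub> g u)"
proof -
  interpret N: module R N by fact
  show ?thesis using linear_mapD[OF assms(2)] linear_mapD[OF assms(3)]
    by (intro linear_mapI) (auto simp: N.M.a_ac N.smult_r_distr)
qed

lemma linear_map_smult:
  assumes "module R N" "linear_map R M N f" "r \<in> carrier R"
  shows "linear_map R M N (\<lambda>u. r \<odot>\<^bsub>N\<^esub> f u)"
proof -
  interpret N: module R N by fact
  show ?thesis using linear_mapD[OF assms(2)] assms(3)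
    by (intro linear_mapI) (auto simp: N.smult_commute N.smult_r_distr)
qed

lemma linear_map_minus:
  assumes "module R N" "linear_map R M N f" "linear_map R M N g"
  shows "linear_map R M N (\<lambda>u. f u \<ominus>\<^bsub>N\<^esub> g u)"
proof -
  interpret N: module R N by fact
  show ?thesis using linear_mapD[OF assms(2)] linear_mapD[OF assms(3)]
    by (intro linear_mapI) (auto simp: N.M.minus_eq N.M.a_ac N.smult_r_distr N.M.minus_add N.smult_r_minus)
qed

lemma linear_zero:
  assumes "module R M" "module R N" "linear_map R M N f"
  shows "f \<zero>\<^bsub>M\<^esub> = \<zero>\<^bsub>N\<^esub>"
proof -
  interpret M: module R M by fact
  interpret N: module R N by fact
  have "f (\<zero>\<^bsub>R\<^esub> \<odot>\<^bsub>M\<^esub> \<zero>\<^bsub>M\<^esub>) = \<zero>\<^bsub>R\<^esub> \<odot>\<^bsub>N\<^esub> f \<zero>\<^bsub>M\<^esub>" 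
    by (rule linear_mapD(3)[OF assms(3) M.R.zero_closed M.M.zero_closed])
  then show ?thesis using linear_mapD(1)[OF assms(3), of "\<zero>\<^bsub>M\<^esub>"] by simp
qed

lemma linear_minus:
  assumes "module R M" "module R N" "linear_map R M N f" "u \<in> carrier M" "v \<in> carrier M"
  shows "f (u \<ominus>\<^bsub>M\<^esub> v) = f u \<ominus>\<^bsub>N\<^esub> f v"
proof -
  interpret M: module R M by fact
  interpret N: module R N by fact
  have "f (u \<ominus>\<^bsub>M\<^esub> v) \<oplus>\<^bsub>N\<^esub> f v = f u"
    using linear_mapD(2)[OF assms(3), of "u \<ominus>\<^bsub>M\<^esub> v" v] assms(4,5) by (simp add: M.minus_add_cancel)
  then show ?thesis
    using assms(4,5) linear_mapD(1)[OF assms(3)]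
    by (metis M.M.minus_closed N.M.add.r_cancel N.M.minus_closed N.minus_add_cancel)
qed

lemma ker_submodule:
  assumes "module R M" "module R N" "linear_map R M N f"
  shows "submodule (module_ker M N f) R M"
proof -
  interpret M: module R M by fact
  interpret N: module R N by fact
  show ?thesis
    using linear_mapD[OF assms(3)] linear_zero[OF assms]
    by (intro M.submoduleI') (auto simp: module_ker_def)
qed

lemma equalizer_submodule:
  assumes "module R M" "module R N" "linear_map R M N f" "linear_map R M N g"
  shows "submodule {u \<in> carrier M. f u = g u} R M"
proof -
  interpret M: module R M by fact
  interpret N: module R N by fact
  show ?thesis
    using linear_mapD[OF assms(3)] linear_mapD[OF assms(4)] linear_zero[OF assms(1-3)]
      linear_zero[OF assms(1,2,4)]
    by (intro M.submoduleI') auto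
qed

lemma image_submodule:
  assumes "module R M" "module R N" "linear_map R M N f" "submodule H R M"
  shows "submodule (f ` H) R N"
proof -
  interpret M: module R M by fact
  interpret N: module R N by fact
  have c: "H \<subseteq> carrier M" by (rule M.submoduleE(1)[OF assms(4)])
  show ?thesis
  proof (rule N.submoduleI')
    show "f ` H \<subseteq> carrier N" using c linear_mapD(1)[OF assms(3)] by auto
    show "\<zero>\<^bsub>N\<^esub> \<in> f ` H" using linear_zero[OF assms(1-3)] M.submodule_zero[OF assms(4)] by force
    fix a b assume "a \<in> f ` H" "b \<in> f ` H"
    then obtain u v where *: "a = f u" "b = f v" "u \<in> H" "v \<in> H" by blast
    then have "a \<oplus>\<^bsub>N\<^esub> b = f (u \<oplus>\<^bsub>M\<^esub> v)" using linear_mapD(2)[OF assms(3), of u v] c by (auto simp: subset_iff)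
    then show "a \<oplus>\<^bsub>N\<^esub> b \<in> f ` H" using * M.submoduleE(5)[OF assms(4)] by blast
  next
    fix r a assume r: "r \<in> carrier R" and "a \<in> f ` H"
    then obtain u where *: "a = f u" "u \<in> H" by blast
    then have "r \<odot>\<^bsub>N\<^esub> a = f (r \<odot>\<^bsub>M\<^esub> u)" using linear_mapD(3)[OF assms(3), of r u] c r by (auto simp: subset_iff)
    then show "r \<odot>\<^bsub>N\<^esub> a \<in> f ` H" using * r M.submoduleE(4)[OF assms(4)] by blast
  qed
qed

lemma preimage_submodule:
  assumes "module R M" "module R N" "linear_map R M N f" "submodule Z R N"
  shows "submodule {u \<in> carrier M. f u \<in> Z} R M"
proof -
  interpret M: module R M by fact
  interpret N: module R N by fact
  show ?thesis
    using linear_mapD[OF assms(3)] linear_zero[OF assms(1-3)] N.submodule_zero[OF assms(4)]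
      N.submoduleE[OF assms(4)]
    by (intro M.submoduleI') auto
qed

text \<open>The factorization property of the quotient \<open>M / ker p\<close>.\<close>

lemma linear_map_factor:
  assumes "module R M" "module R X" "module R N" "linear_map R M X p" "p ` carrier M = carrier X"
    "linear_map R M N f" "\<And>u. u \<in> carrier M \<Longrightarrow> p u = \<zero>\<^bsub>X\<^esub> \<Longrightarrow> f u = \<zero>\<^bsub>N\<^esub>"
  obtains g where "linear_map R X N g" "\<And>u. u \<in> carrier M \<Longrightarrow> g (p u) = f u"
proof -
  interpret M: module R M by fact
  interpret X: module R X by fact
  interpret N: module R N by fact
  define s where "s = inv_into (carrier M) p"
  have s: "s z \<in> carrier M" "p (s z) = z" if "z \<in> carrier X" for z
    using that assms(5) by (auto simp: s_def inv_into_into f_inv_into_f)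
  have eq: "f u = f v" if "u \<in> carrier M" "v \<in> carrier M" "p u = p v" for u v
  proof (rule N.minus_eq_zeroD)
    have "p (u \<ominus>\<^bsub>M\<^esub> v) = \<zero>\<^bsub>X\<^esub>"
      using linear_minus[OF assms(1,2,4) that(1,2)] that(2,3) linear_mapD(1)[OF assms(4)]
      by (simp add: X.M.minus_eq X.M.r_neg)
    then show "f u \<ominus>\<^bsub>N\<^esub> f v = \<zero>\<^bsub>N\<^esub>"
      using assms(7) linear_minus[OF assms(1,3,6) that(1,2)] that by simp
  qed (use that linear_mapD(1)[OF assms(6)] in auto)
  show thesis
  proof (rule that)
    show g: "f (s (p u)) = f u" if "u \<in> carrier M" for u
      using that s[of "p u"] linear_mapD(1)[OF assms(4)] by (intro eq) auto
    show "linear_map R X N (\<lambda>z. f (s z))"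
    proof (rule linear_mapI)
      fix z assume z: "z \<in> carrier X"
      then show "f (s z) \<in> carrier N" using s linear_mapD(1)[OF assms(6)] by auto
      { fix w assume w: "w \<in> carrier X"
        have "p (s z \<oplus>\<^bsub>M\<^esub> s w) = z \<oplus>\<^bsub>X\<^esub> w"
          using s z w linear_mapD(2)[OF assms(4)] by auto
        then have "f (s (z \<oplus>\<^bsub>X\<^esub> w)) = f (s z \<oplus>\<^bsub>M\<^esub> s w)" using s z w by (intro eq) auto
        then show "f (s (z \<oplus>\<^bsub>X\<^esub> w)) = f (s z) \<oplus>\<^bsub>N\<^esub> f (s w)"
          using s z w linear_mapD(2)[OF assms(6)] by auto }
      fix r assume r: "r \<in> carrier R"
      have "p (r \<odot>\<^bsub>M\<^esub> s z) = r \<odot>\<^bsub>X\<^esub> z"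
        using s z r linear_mapD(3)[OF assms(4)] by auto
      then have "f (s (r \<odot>\<^bsub>X\<^esub> z)) = f (r \<odot>\<^bsub>M\<^esub> s z)" using s z r by (intro eq) auto
      then show "f (s (r \<odot>\<^bsub>X\<^esub> z)) = r \<odot>\<^bsub>N\<^esub> f (s z)"
        using s z r linear_mapD(3)[OF assms(6)] by auto
    qed
  qed
qed

section \<open>Free modules, finite generation and Nakayama's lemma\<close>

lemma module_power_simps [simp]:
  "carrier (module_power M n) = {..<n} \<rightarrow>\<^sub>E carrier M"
  "\<zero>\<^bsub>module_power M n\<^esub> = (\<lambda>i\<in>{..<n}. \<zero>\<^bsub>M\<^esub>)"
  "u \<oplus>\<^bsub>module_power M n\<^esub> v = (\<lambda>i\<in>{..<n}. u i \<oplus>\<^bsub>M\<^esub> v i)"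
  "r \<odot>\<^bsub>module_power M n\<^esub> u = (\<lambda>i\<in>{..<n}. r \<odot>\<^bsub>M\<^esub> u i)"
  by (simp_all add: module_power_def)

lemma module_power_module:
  assumes "module R M"
  shows "module R (module_power M n)"
proof -
  interpret M: module R M by fact
  show ?thesis
    unfolding module_power_def
  proof (rule module_mk_moduleI)
    fix u assume u: "u \<in> {..<n} \<rightarrow>\<^sub>E carrier M"
    then have uc: "i < n \<Longrightarrow> u i \<in> carrier M" for i by auto
    show "(\<lambda>i\<in>{..<n}. (\<lambda>i\<in>{..<n}. \<zero>\<^bsub>M\<^esub>) i \<oplus>\<^bsub>M\<^esub> u i) = u"
      using u uc by (intro extensionalityI[of _ "{..<n}"]) (auto simp: PiE_def)
    show "(\<lambda>i\<in>{..<n}. \<one>\<^bsub>R\<^esub> \<odot>\<^bsub>M\<^esub> u i) = u"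
      using u uc by (intro extensionalityI[of _ "{..<n}"]) (auto simp: PiE_def)
    show "\<exists>v\<in>{..<n} \<rightarrow>\<^sub>E carrier M. (\<lambda>i\<in>{..<n}. v i \<oplus>\<^bsub>M\<^esub> u i) = (\<lambda>i\<in>{..<n}. \<zero>\<^bsub>M\<^esub>)"
      using uc by (intro bexI[of _ "\<lambda>i\<in>{..<n}. \<ominus>\<^bsub>M\<^esub> u i"] restrict_ext) (auto simp: M.M.l_neg)
  qed (auto simp: M.is_cring PiE_iff fun_eq_iff M.M.a_ac M.smult_l_distr
      M.smult_r_distr M.smult_assoc1)
qed

lemma (in cring) free_module_module: "module R (free_module R n)"
  by (rule module_power_module[OF regular_module_module])

definition unit_vec :: "('a, 'r) ring_scheme \<Rightarrow> nat \<Rightarrow> nat \<Rightarrow> nat \<Rightarrow> 'a" where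
  "unit_vec R n i = (\<lambda>j\<in>{..<n}. if i = j then \<one>\<^bsub>R\<^esub> else \<zero>\<^bsub>R\<^esub>)"

definition free_map :: "('a, 'b) module \<Rightarrow> nat \<Rightarrow> (nat \<Rightarrow> 'b) \<Rightarrow> (nat \<Rightarrow> 'a) \<Rightarrow> 'b" where
  "free_map M n v u = (\<Oplus>\<^bsub>M\<^esub>i\<in>{..<n}. u i \<odot>\<^bsub>M\<^esub> v i)"

lemma (in cring) unit_vec_closed: "unit_vec R n i \<in> carrier (free_module R n)"
  by (auto simp: unit_vec_def)

lemma free_map_linear:
  assumes "module R M" "\<And>i. i < n \<Longrightarrow> v i \<in> carrier M"
  shows "linear_map R (free_module R n) M (free_map M n v)"
proof -
  interpret M: module R M by fact
  show ?thesis
  proof (rule linear_mapI)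
    fix u assume u: "u \<in> carrier (free_module R n)"
    then have uc: "i < n \<Longrightarrow> u i \<in> carrier R" for i by auto
    show "free_map M n v u \<in> carrier M"
      unfolding free_map_def using uc assms(2) by (intro M.M.finsum_closed) auto
    { fix w assume "w \<in> carrier (free_module R n)"
      then have wc: "i < n \<Longrightarrow> w i \<in> carrier R" for i by auto
      have "free_map M n v (u \<oplus>\<^bsub>free_module R n\<^esub> w)
          = (\<Oplus>\<^bsub>M\<^esub>i\<in>{..<n}. u i \<odot>\<^bsub>M\<^esub> v i \<oplus>\<^bsub>M\<^esub> w i \<odot>\<^bsub>M\<^esub> v i)"
        unfolding free_map_def using uc wc assms(2)
        by (intro M.M.finsum_cong') (auto simp: M.smult_l_distr)
      also have "\<dots> = free_map M n v u \<oplus>\<^bsub>M\<^esub> free_map M n v w"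
        unfolding free_map_def using uc wc assms(2) by (intro M.M.finsum_addf) auto
      finally show "free_map M n v (u \<oplus>\<^bsub>free_module R n\<^esub> w)
          = free_map M n v u \<oplus>\<^bsub>M\<^esub> free_map M n v w" . }
    fix r assume r: "r \<in> carrier R"
    have "free_map M n v (r \<odot>\<^bsub>free_module R n\<^esub> u) = (\<Oplus>\<^bsub>M\<^esub>i\<in>{..<n}. r \<odot>\<^bsub>M\<^esub> (u i \<odot>\<^bsub>M\<^esub> v i))"
      unfolding free_map_def using uc r assms(2)
      by (intro M.M.finsum_cong') (auto simp: M.smult_assoc1)
    also have "\<dots> = r \<odot>\<^bsub>M\<^esub> free_map M n v u"
      unfolding free_map_def using uc r assms(2) by (intro M.finsum_smult_ldistr[symmetric]) auto
    finally show "free_map M n v (r \<odot>\<^bsub>free_module R n\<^esub> u) = r \<odot>\<^bsub>M\<^esub> free_map M n v u" .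
  qed
qed

lemma free_map_unit_vec:
  assumes "module R M" "\<And>i. i < n \<Longrightarrow> v i \<in> carrier M" "i < n"
  shows "free_map M n v (unit_vec R n i) = v i"
proof -
  interpret M: module R M by fact
  have "free_map M n v (unit_vec R n i) = (\<Oplus>\<^bsub>M\<^esub>j\<in>{..<n}. if i = j then v j else \<zero>\<^bsub>M\<^esub>)"
    unfolding free_map_def unit_vec_def using assms(2) by (intro M.M.finsum_cong') auto
  also have "\<dots> = v i" using assms by (intro M.M.add.finprod_singleton) auto
  finally show ?thesis .
qed

lemma (in cring) submodule_free_eq_carrier:
  assumes D: "submodule D R (free_module R n)" and e: "\<And>i. i < n \<Longrightarrow> unit_vec R n i \<in> D"
  shows "D = carrier (free_module R n)"
proof -
  interpret F: module R "free_module R n" by (rule free_module_module)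
  have "u \<in> D" if "u \<in> carrier (free_module R n)" "j \<le> n" "\<And>i. j \<le> i \<Longrightarrow> i < n \<Longrightarrow> u i = \<zero>" for u j
    using that
  proof (induction j arbitrary: u)
    case 0
    then have "u = \<zero>\<^bsub>free_module R n\<^esub>"
      by (intro extensionalityI[of _ "{..<n}"]) (auto simp: PiE_def)
    then show ?case using F.submodule_zero[OF D] by metis
  next
    case (Suc j)
    define w where "w = (\<lambda>i\<in>{..<n}. if i = j then \<zero> else u i)"
    have uc: "i < n \<Longrightarrow> u i \<in> carrier R" for i using Suc.prems(1) by auto
    have "w \<in> D"
      using Suc.prems uc by (intro Suc.IH) (auto simp: w_def le_less_Suc_eq Suc_le_eq)
    moreover have "u j \<odot>\<^bsub>free_module R n\<^esub> unit_vec R n j \<in> D"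
      using Suc.prems(2) uc by (intro F.submoduleE(4)[OF D] e) auto
    moreover have "u = w \<oplus>\<^bsub>free_module R n\<^esub> u j \<odot>\<^bsub>free_module R n\<^esub> unit_vec R n j"
      using Suc.prems(1,2) uc
      by (intro extensionalityI[of _ "{..<n}"]) (auto simp: PiE_def w_def unit_vec_def)
    ultimately show ?case using F.submoduleE(5)[OF D] by metis
  qed
  from this[of _ n] show ?thesis using F.submoduleE(1)[OF D] by auto
qed

lemma linear_eq_on_free:
  assumes "module R N" "linear_map R (free_module R n) N f" "linear_map R (free_module R n) N g"
    "\<And>i. i < n \<Longrightarrow> f (unit_vec R n i) = g (unit_vec R n i)" "u \<in> carrier (free_module R n)"
  shows "f u = g u"
proof -
  interpret N: module R N by fact
  have "{u \<in> carrier (free_module R n). f u = g u} = carrier (free_module R n)"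
    using assms(4) N.unit_vec_closed
    by (intro N.submodule_free_eq_carrier
        equalizer_submodule[OF N.free_module_module assms(1-3)]) auto
  then show ?thesis using assms(5) by blast
qed

lemma free_module_projective:
  assumes "module R M" "module R N" "linear_map R M N d" "linear_map R (free_module R n) N f"
    "\<And>u. u \<in> carrier (free_module R n) \<Longrightarrow> f u \<in> d ` carrier M"
  obtains g where "linear_map R (free_module R n) M g"
    "\<And>u. u \<in> carrier (free_module R n) \<Longrightarrow> d (g u) = f u"
proof -
  interpret M: module R M by fact
  have "\<forall>i. \<exists>c. i < n \<longrightarrow> c \<in> carrier M \<and> d c = f (unit_vec R n i)"
    using assms(5)[OF M.unit_vec_closed] by (metis image_iff)
  then obtain c where c: "\<And>i. i < n \<Longrightarrow> c i \<in> carrier M" "\<And>i. i < n \<Longrightarrow> d (c i) = f (unit_vec R n i)"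
    by metis
  have g: "linear_map R (free_module R n) M (free_map M n c)"
    using c by (intro free_map_linear assms(1)) auto
  show thesis
  proof (rule that[OF g])
    show "d (free_map M n c u) = f u" if "u \<in> carrier (free_module R n)" for u
    proof (rule linear_eq_on_free[OF assms(2) linear_map_comp[OF g assms(3)] assms(4) _ that])
      show "d (free_map M n c (unit_vec R n i)) = f (unit_vec R n i)" if "i < n" for i
        using that c free_map_unit_vec[OF assms(1), of n c i] by simp
    qed
  qed
qed

lemma fg_module_free_cover:
  assumes "fg_module R M"
  obtains n v where "\<And>i. i < n \<Longrightarrow> v i \<in> carrier M"
    "free_map M n v ` carrier (free_module R n) = carrier M"
proof -
  have M: "module R M" using assms by (auto simp: fg_module_def)
  interpret M: module R M by fact
  obtain S where S: "S \<subseteq> carrier M" "finite S" "span_module R M S = carrier M"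
    using assms by (auto simp: fg_module_def)
  obtain n and v :: "nat \<Rightarrow> _" where v: "S = v ` {i. i < n}"
    using finite_imp_nat_seg_image_inj_on[OF S(2)] by metis
  have vc: "v i \<in> carrier M" if "i < n" for i using S v that by auto
  have lin: "linear_map R (free_module R n) M (free_map M n v)"
    using vc by (rule free_map_linear[OF M])
  have "submodule (free_map M n v ` carrier (free_module R n)) R M"
    by (rule image_submodule[OF M.free_module_module M lin module.carrier_is_submodule[OF M.free_module_module]])
  moreover have "S \<subseteq> free_map M n v ` carrier (free_module R n)"
  proof
    fix s assume "s \<in> S"
    then obtain i where i: "i < n" "s = v i" unfolding v by blast
    show "s \<in> free_map M n v ` carrier (free_module R n)"
      by (rule image_eqI[OF _ M.unit_vec_closed[of n i]]) (simp add: i free_map_unit_vec[OF M vc i(1)])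
  qed
  ultimately have "carrier M \<subseteq> free_map M n v ` carrier (free_module R n)"
    using span_minimal S(3) by metis
  then show thesis
    using linear_mapD(1)[OF lin] by (intro that[OF vc]) auto
qed

definition fg_submodule :: "('a, 'r) ring_scheme \<Rightarrow> ('a, 'b) module \<Rightarrow> 'b set \<Rightarrow> bool" where
  "fg_submodule R M N \<longleftrightarrow> (\<exists>S\<subseteq>carrier M. finite S \<and> span_module R M S = N)"

text \<open>Generators of the kernel part and preimages of generators of the image together generate \<open>H\<close>.\<close>

lemma fg_submodule_extension:
  assumes "module R M" "module R N" "linear_map R M N f" "submodule H R M"
    and im: "fg_submodule R N (f ` H)" and ker: "fg_submodule R M (H \<inter> module_ker M N f)"
  shows "fg_submodule R M H"
proof -
  interpret M: module R M by fact
  interpret N: module R N by fact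
  have Hc: "H \<subseteq> carrier M" by (rule M.submoduleE(1)[OF assms(4)])
  obtain T where T: "finite T" "span_module R N T = f ` H"
    using im by (auto simp: fg_submodule_def)
  obtain S where S: "finite S" "span_module R M S = H \<inter> module_ker M N f"
    using ker by (auto simp: fg_submodule_def)
  have "T \<subseteq> f ` H" using T span_superset by metis
  then obtain T' where T': "T' \<subseteq> H" "finite T'" "T = f ` T'"
    using T(1) finite_subset_image by metis
  have SH: "S \<subseteq> H" using S span_superset[of S R M] by auto
  define D where "D = span_module R M (S \<union> T')"
  have D: "submodule D R M" unfolding D_def using SH T' Hc by (intro span_submodule assms(1)) auto
  have sup: "S \<union> T' \<subseteq> D" unfolding D_def by (rule span_superset)
  have DH: "D \<subseteq> H" unfolding D_def using SH T' by (intro span_minimal assms(4)) auto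
  have "H \<subseteq> D"
  proof
    fix u assume u: "u \<in> H"
    have "span_module R N T \<subseteq> f ` D"
      using T'(3) sup by (intro span_minimal image_submodule[OF assms(1-3) D]) auto
    then obtain d where d: "d \<in> D" "f u = f d" using u T(2) by blast
    have c: "u \<in> carrier M" "d \<in> carrier M" using u d DH Hc by auto
    have "f (u \<ominus>\<^bsub>M\<^esub> d) = \<zero>\<^bsub>N\<^esub>"
      using linear_minus[OF assms(1-3) c] d linear_mapD(1)[OF assms(3) c(2)]
      by (simp add: N.M.minus_eq N.M.r_neg)
    then have "u \<ominus>\<^bsub>M\<^esub> d \<in> span_module R M S"
      unfolding S(2) module_ker_def using c M.submodule_minus[OF assms(4) u, of d] d(1) DH M.M.minus_closed
      by (simp add: subset_iff)
    also have "\<dots> \<subseteq> D" using sup by (intro span_minimal D) auto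
    finally show "u \<in> D"
      using M.submoduleE(5)[OF D _ d(1), of "u \<ominus>\<^bsub>M\<^esub> d"] M.minus_add_cancel[OF c] by simp
  qed
  then have "span_module R M (S \<union> T') = H" using DH D_def by auto
  then show ?thesis unfolding fg_submodule_def using S T' SH Hc
    by (intro exI[of _ "S \<union> T'"]) auto
qed

text \<open>A module that embeds into a finite power of a Noetherian module is Noetherian.  Phrased with the
  coordinate maps of the embedding, it covers free modules and Hom modules alike.\<close>

lemma fg_submodule_of_coordinates:
  assumes "module R M" "module R N" "\<And>H. submodule H R N \<Longrightarrow> fg_submodule R N H"
    "\<And>j. j < (s::nat) \<Longrightarrow> linear_map R M N (f j)" "submodule H R M"
    "\<And>u. u \<in> H \<Longrightarrow> (\<And>j. j < s \<Longrightarrow> f j u = \<zero>\<^bsub>N\<^esub>) \<Longrightarrow> u = \<zero>\<^bsub>M\<^esub>"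
  shows "fg_submodule R M H"
  using assms(4-)
proof (induction s arbitrary: H)
  case 0
  interpret M: module R M by fact
  have "submodule (span_module R M {}) R M" by (rule span_submodule[OF assms(1)]) simp
  then have "\<zero>\<^bsub>M\<^esub> \<in> span_module R M {}" by (rule M.submodule_zero)
  moreover have "u = \<zero>\<^bsub>M\<^esub>" if "u \<in> H" for u by (rule "0.prems"(3)[OF that]) simp
  ultimately have "span_module R M {} = H" using span_minimal[OF "0.prems"(2), of "{}"] by auto
  then show ?case unfolding fg_submodule_def by (intro exI[of _ "{}"]) auto
next
  case (Suc s)
  interpret M: module R M by fact
  have lin: "linear_map R M N (f s)" using Suc.prems(1) by simp
  show ?case
  proof (rule fg_submodule_extension[OF assms(1,2) lin Suc.prems(2)])
    show "fg_submodule R N (f s ` H)"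
      by (rule assms(3)[OF image_submodule[OF assms(1,2) lin Suc.prems(2)]])
    have K: "submodule (module_ker M N (f s)) R M" by (rule ker_submodule[OF assms(1,2) lin])
    show "fg_submodule R M (H \<inter> module_ker M N (f s))"
    proof (rule Suc.IH)
      show "submodule (H \<inter> module_ker M N (f s)) R M"
        using M.submoduleE(1,4,5)[OF K] M.submoduleE(1,4,5)[OF Suc.prems(2)]
          M.submodule_zero[OF K] M.submodule_zero[OF Suc.prems(2)]
        by (intro M.submoduleI') auto
      fix u assume u: "u \<in> H \<inter> module_ker M N (f s)" "\<And>j. j < s \<Longrightarrow> f j u = \<zero>\<^bsub>N\<^esub>"
      then show "u = \<zero>\<^bsub>M\<^esub>"
        by (intro Suc.prems(3)) (auto simp: module_ker_def less_Suc_eq)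
    qed (use Suc.prems(1) in auto)
  qed
qed

context noetherian_local_ring
begin

lemma fg_submodule_regular:
  assumes "submodule H R (regular_module R)"
  shows "fg_submodule R (regular_module R) H"
proof -
  have "ideal H R" using assms by (simp add: submodule_regular_iff)
  then obtain A where "A \<subseteq> carrier R" "finite A" "H = Idl A" using finetely_gen by blast
  then show ?thesis unfolding fg_submodule_def
    by (intro exI[of _ A]) (auto simp: span_module_def genideal_def submodule_regular_iff)
qed

lemma fg_submodule_free:
  assumes "submodule H R (free_module R n)"
  shows "fg_submodule R (free_module R n) H"
proof (rule fg_submodule_of_coordinates[OF free_module_module regular_module_module fg_submodule_regular])
  interpret F: module R "free_module R n" by (rule free_module_module)
  show "linear_map R (free_module R n) (regular_module R) (\<lambda>u. u j)" if "j < n" for j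
    using that by (intro linear_mapI) auto
  fix u assume "u \<in> H" "\<And>j. j < n \<Longrightarrow> u j = \<zero>\<^bsub>regular_module R\<^esub>"
  then show "u = \<zero>\<^bsub>free_module R n\<^esub>" using F.submoduleE(1)[OF assms]
    by (intro extensionalityI[of _ "{..<n}"]) (auto simp: PiE_def)
qed (use assms in auto)

lemma fg_module_noetherian:
  assumes "fg_module R M" "submodule H R M"
  shows "fg_submodule R M H"
proof -
  have M: "module R M" using assms by (auto simp: fg_module_def)
  interpret M: module R M by fact
  obtain n v where v: "\<And>i. i < n \<Longrightarrow> v i \<in> carrier M"
    "free_map M n v ` carrier (free_module R n) = carrier M"
    using fg_module_free_cover[OF assms(1)] by metis
  let ?f = "free_map M n v"
  have lin: "linear_map R (free_module R n) M ?f" by (rule free_map_linear[OF M v(1)])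
  let ?H = "{u \<in> carrier (free_module R n). ?f u \<in> H}"
  have "fg_submodule R (free_module R n) ?H"
    by (rule fg_submodule_free[OF preimage_submodule[OF free_module_module M lin assms(2)]])
  then obtain S where S: "finite S" "S \<subseteq> carrier (free_module R n)" "span_module R (free_module R n) S = ?H"
    unfolding fg_submodule_def by auto
  have Hf: "H = ?f ` ?H"
  proof (intro equalityI subsetI)
    fix h assume h: "h \<in> H"
    then have "h \<in> ?f ` carrier (free_module R n)" using M.submoduleE(1)[OF assms(2)] v(2) by (simp add: subset_iff)
    then show "h \<in> ?f ` ?H" using h by blast
  qed blast
  have SH: "S \<subseteq> ?H" using S(3) span_superset by metis
  have sp: "submodule (span_module R M (?f ` S)) R M"
    using SH M.submoduleE(1)[OF assms(2)] by (intro span_submodule[OF M]) auto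
  have "span_module R (free_module R n) S \<subseteq> {u \<in> carrier (free_module R n). ?f u \<in> span_module R M (?f ` S)}"
    using S(2) span_superset[of "?f ` S" R M]
    by (intro span_minimal preimage_submodule[OF free_module_module M lin sp]) auto
  then have "?f ` ?H \<subseteq> span_module R M (?f ` S)" unfolding S(3) by auto
  then have "H \<subseteq> span_module R M (?f ` S)" using Hf by simp
  moreover have "span_module R M (?f ` S) \<subseteq> H"
    by (rule span_minimal[OF assms(2)]) (use SH in auto)
  ultimately show ?thesis
    unfolding fg_submodule_def using S(1,2) linear_mapD(1)[OF lin]
    by (intro exI[of _ "?f ` S"] conjI) auto
qed

text \<open>Generators of \<open>H\<close> over \<open>L\<close> can be dropped one at a time: writing a generator \<open>s\<close> as \<open>l + y h'\<close>
  and expanding \<open>h'\<close> gives a relation in which \<open>s\<close> has the unit coefficient \<open>1 - y r\<close>.\<close>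

lemma nakayama:
  assumes M: "module R M" and H: "fg_submodule R M H" and L: "submodule L R M" and y: "y \<in> \<mm>"
    and dec: "\<And>h. h \<in> H \<Longrightarrow> \<exists>l\<in>L. \<exists>h'\<in>H. h = l \<oplus>\<^bsub>M\<^esub> y \<odot>\<^bsub>M\<^esub> h'"
  shows "H \<subseteq> L"
proof -
  interpret M: module R M by fact
  obtain S0 where S0: "S0 \<subseteq> carrier M" "finite S0" "span_module R M S0 = H"
    using H by (auto simp: fg_submodule_def)
  have Hsub: "submodule H R M" using span_submodule[OF M S0(1)] S0(3) by simp
  have Hc: "H \<subseteq> carrier M" by (rule M.submoduleE(1)[OF Hsub])
  have Lc: "L \<subseteq> carrier M" by (rule M.submoduleE(1)[OF L])
  have yc: "y \<in> carrier R" using y by (rule Icarr)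
  have "H \<subseteq> L" if "finite S" "S \<subseteq> H" "H \<subseteq> span_module R M (L \<union> S)" for S
    using that
  proof (induction S)
    case empty
    then show ?case using span_of_submodule[OF L] by simp
  next
    case (insert s S)
    let ?N = "span_module R M (L \<union> S)"
    have N: "submodule ?N R M" using Lc insert.prems Hc by (intro span_submodule[OF M]) auto
    have Nc: "?N \<subseteq> carrier M" by (rule M.submoduleE(1)[OF N])
    have s: "s \<in> H" "s \<in> carrier M" using insert.prems Hc by auto
    have "span_module R M (L \<union> insert s S) \<subseteq> M.adjoin ?N s"
      using M.adjoin[OF N s(2)] span_superset[of "L \<union> S" R M] by (intro span_minimal) auto
    then have HN: "H \<subseteq> M.adjoin ?N s" using insert.prems by blast
    obtain l h' where lh: "l \<in> L" "h' \<in> H" "s = l \<oplus>\<^bsub>M\<^esub> y \<odot>\<^bsub>M\<^esub> h'" using dec[OF s(1)] by blast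
    have "h' \<in> M.adjoin ?N s" using lh(2) HN by (rule_tac subsetD)
    then obtain n r where nr: "n \<in> ?N" "r \<in> carrier R" "h' = n \<oplus>\<^bsub>M\<^esub> r \<odot>\<^bsub>M\<^esub> s"
      unfolding M.adjoin_def by auto
    have c: "l \<in> carrier M" "n \<in> carrier M" using lh(1) nr(1) Lc Nc by auto
    have "(\<one> \<ominus> y \<otimes> r) \<odot>\<^bsub>M\<^esub> s = l \<oplus>\<^bsub>M\<^esub> y \<odot>\<^bsub>M\<^esub> n"
    proof -
      have "s = (l \<oplus>\<^bsub>M\<^esub> y \<odot>\<^bsub>M\<^esub> n) \<oplus>\<^bsub>M\<^esub> (y \<otimes> r) \<odot>\<^bsub>M\<^esub> s"
        using lh(3) nr c s yc by (simp add: M.smult_r_distr M.smult_assoc1 M.M.a_assoc)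
      moreover have "(\<one> \<ominus> y \<otimes> r) \<odot>\<^bsub>M\<^esub> s \<oplus>\<^bsub>M\<^esub> (y \<otimes> r) \<odot>\<^bsub>M\<^esub> s = s"
        using yc nr s by (simp add: M.smult_minus_left M.minus_add_cancel)
      ultimately have eq: "(\<one> \<ominus> y \<otimes> r) \<odot>\<^bsub>M\<^esub> s \<oplus>\<^bsub>M\<^esub> (y \<otimes> r) \<odot>\<^bsub>M\<^esub> s
          = (l \<oplus>\<^bsub>M\<^esub> y \<odot>\<^bsub>M\<^esub> n) \<oplus>\<^bsub>M\<^esub> (y \<otimes> r) \<odot>\<^bsub>M\<^esub> s" by (rule_tac trans)
      show ?thesis by (rule M.M.add.r_cancel[OF eq]) (use c yc nr(2) s(2) in simp_all)
    qed
    also have "\<dots> \<in> ?N"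
      using lh(1) nr(1) yc span_superset[of "L \<union> S" R M] by (intro M.submoduleE(4,5)[OF N]) auto
    finally have "(\<one> \<ominus> y \<otimes> r) \<odot>\<^bsub>M\<^esub> s \<in> ?N" .
    moreover have unit: "\<one> \<ominus> y \<otimes> r \<in> Units R"
      using y nr by (intro one_minus_unit I_r_closed)
    ultimately have "inv (\<one> \<ominus> y \<otimes> r) \<odot>\<^bsub>M\<^esub> ((\<one> \<ominus> y \<otimes> r) \<odot>\<^bsub>M\<^esub> s) \<in> ?N"
      by (rule_tac M.submoduleE(4)[OF N Units_inv_closed])
    then have "s \<in> ?N" using unit s Units_closed[OF unit] by (simp add: M.smult_assoc1[symmetric])
    then have "M.adjoin ?N s \<subseteq> ?N"
      using M.submoduleE(4,5)[OF N] by (auto simp: M.adjoin_def)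
    then show ?case using insert.IH insert.prems HN by auto
  qed
  moreover have "H \<subseteq> span_module R M (L \<union> S0)"
    unfolding S0(3)[symmetric]
    by (rule span_minimal[OF span_submodule[OF M]]) (use S0 Lc span_superset[of "L \<union> S0" R M] in auto)
  ultimately show ?thesis using S0 span_superset[of S0 R M] by blast
qed

end

section \<open>Hom modules, isomorphic copies and free summands\<close>

lemma Hom_module_simps [simp]:
  "carrier (Hom_module R M N) = Hom R M N"
  "\<zero>\<^bsub>Hom_module R M N\<^esub> = (\<lambda>u\<in>carrier M. \<zero>\<^bsub>N\<^esub>)"
  "f \<oplus>\<^bsub>Hom_module R M N\<^esub> g = (\<lambda>u\<in>carrier M. f u \<oplus>\<^bsub>N\<^esub> g u)"
  "r \<odot>\<^bsub>Hom_module R M N\<^esub> f = (\<lambda>u\<in>carrier M. r \<odot>\<^bsub>N\<^esub> f u)"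
  by (simp_all add: Hom_module_def)

lemma Hom_ext:
  assumes "f \<in> Hom R M N" "g \<in> Hom R M N" "\<And>u. u \<in> carrier M \<Longrightarrow> f u = g u"
  shows "f = g"
  using assms by (intro extensionalityI[of _ "carrier M"]) (auto simp: Hom_def PiE_def)

lemma linear_map_zero: "module R N \<Longrightarrow> linear_map R M N (\<lambda>_. \<zero>\<^bsub>N\<^esub>)"
  by (intro linear_mapI) (simp_all add: module.smult_r_null module.axioms abelian_group.axioms abelian_monoid.zero_closed abelian_monoid.l_zero)

lemma Hom_module_module:
  assumes "module R M" "module R N"
  shows "module R (Hom_module R M N)"
proof -
  interpret M: module R M by fact
  interpret N: module R N by fact
  note lin = Hom_linear linear_map_zero[OF assms(2)] linear_map_add[OF assms(2)] linear_map_smult[OF assms(2)]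
  have c: "f u \<in> carrier N" if "f \<in> Hom R M N" "u \<in> carrier M" for f u
    using linear_mapD(1)[OF Hom_linear[OF that(1)] that(2)] .
  have e: "f u = undefined" if "f \<in> Hom R M N" "u \<notin> carrier M" for f u
    using that by (auto simp: Hom_def PiE_def extensional_def)
  show ?thesis
    unfolding Hom_module_def
  proof (rule module_mk_moduleI)
    fix f assume f: "f \<in> Hom R M N"
    have "linear_map R M N (\<lambda>u. (\<ominus>\<^bsub>R\<^esub> \<one>\<^bsub>R\<^esub>) \<odot>\<^bsub>N\<^esub> f u)"
      using f by (intro lin) auto
    then show "\<exists>g\<in>Hom R M N. (\<lambda>u\<in>carrier M. g u \<oplus>\<^bsub>N\<^esub> f u) = (\<lambda>u\<in>carrier M. \<zero>\<^bsub>N\<^esub>)"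
      using c[OF f]
      by (intro bexI[OF _ linear_restrict_Hom[OF assms(1)]] restrict_ext)
        (auto simp: N.smult_l_minus N.M.l_neg)
    fix g assume "g \<in> Hom R M N"
    then show "(\<lambda>u\<in>carrier M. f u \<oplus>\<^bsub>N\<^esub> g u) \<in> Hom R M N"
      using f by (intro linear_restrict_Hom[OF assms(1)] lin)
  next
    fix r f assume "r \<in> carrier R" "f \<in> Hom R M N"
    then show "(\<lambda>u\<in>carrier M. r \<odot>\<^bsub>N\<^esub> f u) \<in> Hom R M N"
      by (intro linear_restrict_Hom[OF assms(1)] lin)
  next
    show "(\<lambda>u\<in>carrier M. \<zero>\<^bsub>N\<^esub>) \<in> Hom R M N"
      by (intro linear_restrict_Hom[OF assms(1)] lin)
  qed (auto simp: M.is_cring fun_eq_iff restrict_def c e N.M.a_ac N.smult_l_distr N.smult_r_distr N.smult_assoc1)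
qed

definition copy_module :: "('b \<Rightarrow> 'c) \<Rightarrow> ('a, 'b) module \<Rightarrow> ('a, 'c) module" where
  "copy_module c M = (let d = inv_into (carrier M) c in
     mk_module (c ` carrier M) (c \<zero>\<^bsub>M\<^esub>) (\<lambda>u v. c (d u \<oplus>\<^bsub>M\<^esub> d v)) (\<lambda>r u. c (r \<odot>\<^bsub>M\<^esub> d u)))"

lemma copy_module:
  assumes "module R M" "inj_on c (carrier M)"
  shows "module R (copy_module c M)" "carrier (copy_module c M) = c ` carrier M"
    "linear_map R M (copy_module c M) c"
    "linear_map R (copy_module c M) M (inv_into (carrier M) c)"
proof -
  interpret M: module R M by fact
  show "module R (copy_module c M)"
    unfolding copy_module_def Let_def
  proof (rule module_mk_moduleI)
    fix u assume "u \<in> c ` carrier M"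
    then obtain m where "u = c m" "m \<in> carrier M" by blast
    then show "\<exists>v\<in>c ` carrier M. c (inv_into (carrier M) c v \<oplus>\<^bsub>M\<^esub> inv_into (carrier M) c u) = c \<zero>\<^bsub>M\<^esub>"
      using assms(2) by (intro bexI[of _ "c (\<ominus>\<^bsub>M\<^esub> m)"]) (auto simp: M.M.l_neg)
  qed (use assms(2) in \<open>auto simp: M.is_cring M.M.a_ac M.smult_l_distr M.smult_r_distr M.smult_assoc1\<close>)
  show "carrier (copy_module c M) = c ` carrier M" "linear_map R M (copy_module c M) c"
    "linear_map R (copy_module c M) M (inv_into (carrier M) c)"
    using assms(2) by (auto simp: copy_module_def Let_def linear_map_def)
qed

lemma direct_sum_simps [simp]:
  "carrier (direct_sum M N) = carrier M \<times> carrier N"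
  "\<zero>\<^bsub>direct_sum M N\<^esub> = (\<zero>\<^bsub>M\<^esub>, \<zero>\<^bsub>N\<^esub>)"
  "u \<oplus>\<^bsub>direct_sum M N\<^esub> v = (fst u \<oplus>\<^bsub>M\<^esub> fst v, snd u \<oplus>\<^bsub>N\<^esub> snd v)"
  "r \<odot>\<^bsub>direct_sum M N\<^esub> u = (r \<odot>\<^bsub>M\<^esub> fst u, r \<odot>\<^bsub>N\<^esub> snd u)"
  by (simp_all add: direct_sum_def)

lemma regular_module_minus: "u \<ominus>\<^bsub>regular_module R\<^esub> v = u \<ominus>\<^bsub>R\<^esub> v"
  by (simp add: a_minus_def a_inv_def m_inv_def regular_module_def mk_module_def)

text \<open>A functional taking the value \<open>1\<close> splits off a free summand of rank one, the complement being its kernel.\<close>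

lemma has_free_summand_if_functional:
  fixes X :: "'a rmod"
  assumes X: "module R X" and t: "linear_map R X (regular_module R) t"
    and e: "e \<in> carrier X" "t e = \<one>\<^bsub>R\<^esub>"
  shows "has_free_summand R X"
proof -
  interpret X: module R X by fact
  note reg = X.regular_module_module
  define K where "K = module_ker X (regular_module R) t"
  define Y where "Y = X\<lparr>carrier := K\<rparr>"
  have K: "submodule K R X" unfolding K_def by (rule ker_submodule[OF X reg t])
  have Y: "module R Y" unfolding Y_def by (rule X.submodule_module[OF K])
  have tc: "t u \<in> carrier R" if "u \<in> carrier X" for u using linear_mapD(1)[OF t that] by simp
  define f where "f u = (u \<ominus>\<^bsub>X\<^esub> t u \<odot>\<^bsub>X\<^esub> e, \<lambda>i\<in>{..<1::nat}. t u)" for u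
  have tf: "t (u \<ominus>\<^bsub>X\<^esub> t u \<odot>\<^bsub>X\<^esub> e) = \<zero>\<^bsub>R\<^esub>" if "u \<in> carrier X" for u
    using linear_minus[OF X reg t that, of "t u \<odot>\<^bsub>X\<^esub> e"] tc[OF that] e linear_mapD(3)[OF t, of "t u" e]
    by (simp add: regular_module_minus a_minus_def[of R] X.R.r_neg)
  have lin: "linear_map R X (direct_sum Y (free_module R 1)) f"
  proof (rule linear_mapI)
    fix u assume u: "u \<in> carrier X"
    then show "f u \<in> carrier (direct_sum Y (free_module R 1))"
      using tc tf e(1) by (auto simp: f_def Y_def K_def module_ker_def)
    { fix v assume v: "v \<in> carrier X"
      have "(u \<oplus>\<^bsub>X\<^esub> v) \<ominus>\<^bsub>X\<^esub> (t u \<odot>\<^bsub>X\<^esub> e \<oplus>\<^bsub>X\<^esub> t v \<odot>\<^bsub>X\<^esub> e)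
          = (u \<ominus>\<^bsub>X\<^esub> t u \<odot>\<^bsub>X\<^esub> e) \<oplus>\<^bsub>X\<^esub> (v \<ominus>\<^bsub>X\<^esub> t v \<odot>\<^bsub>X\<^esub> e)"
        using u v tc e(1) by (simp add: a_minus_def X.M.minus_add X.M.a_ac)
      then show "f (u \<oplus>\<^bsub>X\<^esub> v) = f u \<oplus>\<^bsub>direct_sum Y (free_module R 1)\<^esub> f v"
        using u v tc e(1) linear_mapD(2)[OF t u v]
        by (simp add: f_def Y_def X.smult_l_distr restrict_def fun_eq_iff) }
    fix r assume r: "r \<in> carrier R"
    then show "f (r \<odot>\<^bsub>X\<^esub> u) = r \<odot>\<^bsub>direct_sum Y (free_module R 1)\<^esub> f u"
      using u tc e(1) linear_mapD(3)[OF t r u]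
      by (simp add: f_def Y_def X.smult_minus_right X.smult_assoc1 restrict_def fun_eq_iff)
  qed
  have "bij_betw f (carrier X) (carrier (direct_sum Y (free_module R 1)))"
  proof (rule bij_betw_byWitness[where f' = "\<lambda>(k, g). k \<oplus>\<^bsub>X\<^esub> g (0::nat) \<odot>\<^bsub>X\<^esub> e"])
    show "\<forall>u\<in>carrier X. (\<lambda>(k, g). k \<oplus>\<^bsub>X\<^esub> g 0 \<odot>\<^bsub>X\<^esub> e) (f u) = u"
      using tc e(1) by (simp add: f_def X.minus_add_cancel)
    have "f (k \<oplus>\<^bsub>X\<^esub> g 0 \<odot>\<^bsub>X\<^esub> e) = (k, g)" if k: "k \<in> K" and g: "g \<in> {..<1} \<rightarrow>\<^sub>E carrier R" for k g
    proof -
      have kc: "k \<in> carrier X" "t k = \<zero>\<^bsub>R\<^esub>" using k by (auto simp: K_def module_ker_def)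
      have gc: "g 0 \<in> carrier R" using g by auto
      have tk: "t (k \<oplus>\<^bsub>X\<^esub> g 0 \<odot>\<^bsub>X\<^esub> e) = g 0"
        using linear_mapD(2)[OF t kc(1), of "g 0 \<odot>\<^bsub>X\<^esub> e"] linear_mapD(3)[OF t gc e(1)] kc gc e by simp
      have "(k \<oplus>\<^bsub>X\<^esub> g 0 \<odot>\<^bsub>X\<^esub> e) \<ominus>\<^bsub>X\<^esub> g 0 \<odot>\<^bsub>X\<^esub> e = k"
        using kc gc e(1) by (simp add: a_minus_def X.M.a_assoc X.M.r_neg)
      moreover have "(\<lambda>i\<in>{..<1}. g 0) = g"
        using g by (auto simp: fun_eq_iff PiE_iff extensional_def)
      ultimately show ?thesis unfolding f_def tk by simp
    qed
    then show "\<forall>a'\<in>carrier (direct_sum Y (free_module R 1)). f ((\<lambda>(k, g). k \<oplus>\<^bsub>X\<^esub> g 0 \<odot>\<^bsub>X\<^esub> e) a') = a'"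
      by (auto simp: Y_def simp del: One_nat_def)
    show "f ` carrier X \<subseteq> carrier (direct_sum Y (free_module R 1))"
      using linear_mapD(1)[OF lin] by blast
    show "(\<lambda>(k, g). k \<oplus>\<^bsub>X\<^esub> g 0 \<odot>\<^bsub>X\<^esub> e) ` carrier (direct_sum Y (free_module R 1)) \<subseteq> carrier X"
      using X.submoduleE(1)[OF K] e(1) by (auto simp: Y_def)
  qed
  then have "bij_betw (restrict f (carrier X)) (carrier X) (carrier (direct_sum Y (free_module R 1)))"
    by (subst bij_betw_cong) auto
  then have "module_iso R X (direct_sum Y (free_module R 1))"
    unfolding module_iso_def using linear_restrict_Hom[OF X lin] by blast
  then show ?thesis unfolding has_free_summand_def using Y by (intro exI[of _ Y] exI[of _ 1]) simp
qed

lemma functional_if_has_free_summand: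
  fixes X :: "('a, 'b) module"
  assumes X: "module R X" and "has_free_summand R X"
  shows "\<exists>t e. linear_map R X (regular_module R) t \<and> e \<in> carrier X \<and> t e = \<one>\<^bsub>R\<^esub>"
proof -
  interpret X: module R X by fact
  obtain Y :: "'a rmod" and n f where Y: "module R Y" and n: "n \<ge> 1"
    and f: "f \<in> Hom R X (direct_sum Y (free_module R n))"
      "bij_betw f (carrier X) (carrier (direct_sum Y (free_module R n)))"
    using assms(2) by (auto simp: has_free_summand_def module_iso_def)
  interpret Y: module R Y by fact
  note lin = Hom_linear[OF f(1)]
  have "linear_map R X (regular_module R) (\<lambda>u. snd (f u) 0)"
  proof (rule linear_mapI)
    fix u assume u: "u \<in> carrier X"
    have "snd (f u) \<in> {..<n} \<rightarrow>\<^sub>E carrier R"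
      using linear_mapD(1)[OF lin u] unfolding direct_sum_simps mem_Times_iff by simp
    from PiE_mem[OF this, of 0] show "snd (f u) 0 \<in> carrier (regular_module R)"
      using n by simp
    show "snd (f (u \<oplus>\<^bsub>X\<^esub> v)) 0 = snd (f u) 0 \<oplus>\<^bsub>regular_module R\<^esub> snd (f v) 0" if "v \<in> carrier X" for v
      using linear_mapD(2)[OF lin u that] n by simp
    show "snd (f (r \<odot>\<^bsub>X\<^esub> u)) 0 = r \<odot>\<^bsub>regular_module R\<^esub> snd (f u) 0" if "r \<in> carrier R" for r
      using linear_mapD(3)[OF lin that u] n by simp
  qed
  moreover have "(\<zero>\<^bsub>Y\<^esub>, unit_vec R n 0) \<in> f ` carrier X"
    using f(2) X.unit_vec_closed[of n 0] by (simp add: bij_betw_def)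
  then obtain e where "e \<in> carrier X" "f e = (\<zero>\<^bsub>Y\<^esub>, unit_vec R n 0)" by force
  moreover from this have "snd (f e) 0 = \<one>\<^bsub>R\<^esub>" using n by (simp add: unit_vec_def)
  ultimately show ?thesis by blast
qed

section \<open>Injective modules\<close>

text \<open>Injectivity is tested in a fixed universe; isomorphic copies carry it over to every module that embeds
  into that universe as a set.\<close>

lemma injective_extend:
  fixes M :: "('a, 'b) module" and c :: "'b \<Rightarrow> (nat \<Rightarrow> 'a) set"
  assumes E: "injective_module R E" and M: "module R M" and c: "inj_on c (carrier M)"
    and N: "submodule N R M" and h: "linear_map R (M\<lparr>carrier := N\<rparr>) E h"
  obtains g where "linear_map R M E g" "\<And>u. u \<in> N \<Longrightarrow> g u = h u"
proof -
  interpret M: module R M by fact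
  have NM: "N \<subseteq> carrier M" by (rule M.submoduleE(1)[OF N])
  let ?N = "M\<lparr>carrier := N\<rparr>"
  have Nm: "module R ?N" by (rule M.submodule_module[OF N])
  have cN: "inj_on c (carrier ?N)" using c NM by (simp add: inj_on_subset)
  let ?A = "copy_module c ?N" and ?B = "copy_module c M"
  note A = copy_module[OF Nm cN] and B = copy_module[OF M c]
  have id: "linear_map R ?N M (\<lambda>u. u)" using NM by (intro linear_mapI) auto
  define i where "i = restrict (\<lambda>u. c (inv_into N c u)) (carrier ?A)"
  define f where "f = restrict (\<lambda>u. h (inv_into N c u)) (carrier ?A)"
  have "i \<in> Hom R ?A ?B"
    unfolding i_def using linear_map_comp[OF linear_map_comp[OF A(4) id] B(3)]
    by (intro linear_restrict_Hom[OF A(1)]) simp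
  moreover have "f \<in> Hom R ?A E"
    unfolding f_def using linear_map_comp[OF A(4) h] by (intro linear_restrict_Hom[OF A(1)]) simp
  moreover have ic: "i (c u) = c u" "f (c u) = h u" "c u \<in> carrier ?A" if "u \<in> N" for u
    using that cN by (auto simp: i_def f_def A(2))
  moreover have "inj_on i (carrier ?A)" using ic by (intro inj_onI) (auto simp: A(2))
  ultimately obtain g where g: "g \<in> Hom R ?B E" "\<And>a. a \<in> carrier ?A \<Longrightarrow> g (i a) = f a"
    using E[unfolded injective_module_def, THEN conjunct2, rule_format, OF conjI[OF A(1) B(1)]]
    by metis
  show thesis
  proof (rule that)
    show "linear_map R M E (\<lambda>u. g (c u))" by (rule linear_map_comp[OF B(3) Hom_linear[OF g(1)]])
    show "g (c u) = h u" if "u \<in> N" for u using g(2)[OF ic(3)[OF that]] ic[OF that] by simp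
  qed
qed

lemma injective_ideal_extend:
  assumes E: "injective_module R E" and I: "ideal I R"
    and h: "linear_map R ((regular_module R)\<lparr>carrier := I\<rparr>) E h"
  obtains v where "v \<in> carrier E" "\<And>a. a \<in> I \<Longrightarrow> h a = a \<odot>\<^bsub>E\<^esub> v"
proof -
  have "module R E" using E by (auto simp: injective_module_def)
  then interpret E: module R E .
  have "inj_on (\<lambda>a. {\<lambda>_::nat. a}) (carrier (regular_module R))" by (auto simp: inj_on_def fun_eq_iff)
  then obtain g where g: "linear_map R (regular_module R) E g" "\<And>u. u \<in> I \<Longrightarrow> g u = h u"
    using injective_extend[OF E E.regular_module_module _ _ h] I by (metis E.submodule_regular_iff)
  show thesis
  proof (rule that)
    show "g \<one>\<^bsub>R\<^esub> \<in> carrier E" using linear_mapD(1)[OF g(1)] by simp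
    fix a assume a: "a \<in> I"
    then have ac: "a \<in> carrier R" using ideal.Icarr[OF I] by simp
    show "h a = a \<odot>\<^bsub>E\<^esub> g \<one>\<^bsub>R\<^esub>"
      using linear_mapD(3)[OF g(1), of a "\<one>\<^bsub>R\<^esub>"] g(2)[OF a] ac by simp
  qed
qed

text \<open>The map \<open>r y \<mapsto> r u\<close> extends from the ideal \<open>(y)\<close> to \<open>R\<close>.\<close>

lemma injective_divisible:
  assumes E: "injective_module R E" and y: "y \<in> carrier R"
    and reg: "\<And>r. r \<in> carrier R \<Longrightarrow> y \<otimes>\<^bsub>R\<^esub> r = \<zero>\<^bsub>R\<^esub> \<Longrightarrow> r = \<zero>\<^bsub>R\<^esub>" and u: "u \<in> carrier E"
  obtains v where "v \<in> carrier E" "u = y \<odot>\<^bsub>E\<^esub> v"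
proof -
  have Em: "module R E" using E by (auto simp: injective_module_def)
  interpret E: module R E by (rule Em)
  note rm = E.regular_module_module
  let ?I = "PIdl\<^bsub>R\<^esub> y"
  have mul: "linear_map R (regular_module R) ((regular_module R)\<lparr>carrier := ?I\<rparr>) (\<lambda>r. r \<otimes>\<^bsub>R\<^esub> y)"
    using y by (intro linear_mapI) (auto simp: cgenideal_def E.l_distr E.m_assoc)
  have fu: "linear_map R (regular_module R) E (\<lambda>r. r \<odot>\<^bsub>E\<^esub> u)"
    using u by (intro linear_mapI) (auto simp: E.smult_l_distr E.smult_assoc1)
  have I: "ideal ?I R" by (rule E.cgenideal_ideal[OF y])
  have Im: "module R ((regular_module R)\<lparr>carrier := ?I\<rparr>)"
    using I by (intro module.submodule_module[OF rm]) (simp add: E.submodule_regular_iff)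
  obtain h where h: "linear_map R ((regular_module R)\<lparr>carrier := ?I\<rparr>) E h"
    "\<And>r. r \<in> carrier R \<Longrightarrow> h (r \<otimes>\<^bsub>R\<^esub> y) = r \<odot>\<^bsub>E\<^esub> u"
  proof (rule linear_map_factor[OF rm Im Em mul _ fu])
    show "(\<lambda>r. r \<otimes>\<^bsub>R\<^esub> y) ` carrier (regular_module R) = carrier ((regular_module R)\<lparr>carrier := ?I\<rparr>)"
      by (auto simp: cgenideal_def)
    show "r \<odot>\<^bsub>E\<^esub> u = \<zero>\<^bsub>E\<^esub>" if "r \<in> carrier (regular_module R)"
      "r \<otimes>\<^bsub>R\<^esub> y = \<zero>\<^bsub>(regular_module R)\<lparr>carrier := ?I\<rparr>\<^esub>" for r
      using that reg[of r] y u by (simp add: E.m_comm)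
  qed auto
  obtain v where v: "v \<in> carrier E" "\<And>a. a \<in> ?I \<Longrightarrow> h a = a \<odot>\<^bsub>E\<^esub> v"
    using injective_ideal_extend[OF E I h(1)] by blast
  have "u = y \<odot>\<^bsub>E\<^esub> v"
    using h(2)[of "\<one>\<^bsub>R\<^esub>"] v(2)[OF E.cgenideal_self[OF y]] y u by simp
  then show thesis using v(1) that by blast
qed

lemma injective_extend_free:
  assumes "injective_module R E" "submodule K R (free_module R n)"
    "linear_map R ((free_module R n)\<lparr>carrier := K\<rparr>) E h"
  obtains g where "linear_map R (free_module R n) E g" "\<And>u. u \<in> K \<Longrightarrow> g u = h u"
proof -
  have "module R E" using assms by (auto simp: injective_module_def)
  then interpret E: module R E .
  show thesis
    by (rule injective_extend[OF assms(1) E.free_module_module _ assms(2,3), of "\<lambda>u. {u}"]) (use that in auto)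
qed

section \<open>Vanishing of Ext against a module of finite injective dimension\<close>

lemma direct_sum_module:
  assumes "module R M" "module R N"
  shows "module R (direct_sum M N)"
proof -
  interpret M: module R M by fact
  interpret N: module R N by fact
  show ?thesis
    unfolding direct_sum_def
  proof (rule module_mk_moduleI)
    fix u assume "u \<in> carrier M \<times> carrier N"
    then show "\<exists>v\<in>carrier M \<times> carrier N. (fst v \<oplus>\<^bsub>M\<^esub> fst u, snd v \<oplus>\<^bsub>N\<^esub> snd u) = (\<zero>\<^bsub>M\<^esub>, \<zero>\<^bsub>N\<^esub>)"
      by (intro bexI[of _ "(\<ominus>\<^bsub>M\<^esub> fst u, \<ominus>\<^bsub>N\<^esub> snd u)"]) (auto simp: M.M.l_neg N.M.l_neg)
  qed (auto simp: M.is_cring M.M.a_ac N.M.a_ac M.smult_l_distr N.smult_l_distr M.smult_r_distr N.smult_r_distr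
      M.smult_assoc1 N.smult_assoc1)
qed

lemma linear_map_of_element:
  assumes "module R M" "w \<in> carrier M"
  shows "linear_map R (regular_module R) M (\<lambda>r. r \<odot>\<^bsub>M\<^esub> w)"
proof -
  interpret M: module R M by fact
  show ?thesis using assms(2) by (intro linear_mapI) (auto simp: M.smult_l_distr M.smult_assoc1)
qed

text \<open>\<open>N + R b\<close> is the quotient of \<open>N \<oplus> R\<close> by the pairs \<open>(n, r)\<close> with \<open>n + r b = 0\<close>, and the compatibility
  condition says that the map given by \<open>h\<close> and \<open>v\<close> vanishes on these pairs.\<close>

lemma linear_extend_adjoin:
  assumes M: "module R M" and E: "module R E" and N: "submodule N R M"
    and h: "linear_map R (M\<lparr>carrier := N\<rparr>) E h" and b: "b \<in> carrier M" and v: "v \<in> carrier E"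
    and compat: "\<And>a. a \<in> carrier R \<Longrightarrow> a \<odot>\<^bsub>M\<^esub> b \<in> N \<Longrightarrow> h (a \<odot>\<^bsub>M\<^esub> b) = a \<odot>\<^bsub>E\<^esub> v"
  obtains g where "linear_map R (M\<lparr>carrier := module.adjoin R M N b\<rparr>) E g"
    "\<And>u. u \<in> N \<Longrightarrow> g u = h u" "g b = v"
proof -
  interpret M: module R M by fact
  interpret E: module R E by fact
  have Nc: "N \<subseteq> carrier M" by (rule M.submoduleE(1)[OF N])
  let ?N = "M\<lparr>carrier := N\<rparr>" and ?A = "M\<lparr>carrier := M.adjoin N b\<rparr>"
  note Nm = M.submodule_module[OF N]
  note adj = M.adjoin[OF N b]
  let ?D = "direct_sum ?N (regular_module R)"
  have D: "module R ?D" by (rule direct_sum_module[OF Nm M.regular_module_module])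
  have fst: "linear_map R ?D ?N fst" and snd: "linear_map R ?D (regular_module R) snd"
    by (auto simp: linear_map_def)
  have p: "linear_map R ?D ?A (\<lambda>z. fst z \<oplus>\<^bsub>M\<^esub> snd z \<odot>\<^bsub>M\<^esub> b)"
  proof (rule linear_map_into_sub)
    have "linear_map R ?D M fst" using linear_map_out_of_sub[OF fst Nc] .
    then show "linear_map R ?D M (\<lambda>z. fst z \<oplus>\<^bsub>M\<^esub> snd z \<odot>\<^bsub>M\<^esub> b)"
      by (intro linear_map_add[OF M] linear_map_comp[OF snd] linear_map_of_element[OF M b])
    fix z assume "z \<in> carrier ?D"
    then show "fst z \<oplus>\<^bsub>M\<^esub> snd z \<odot>\<^bsub>M\<^esub> b \<in> M.adjoin N b"
      unfolding M.adjoin_def by (cases z) (simp, blast)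
  qed
  have f: "linear_map R ?D E (\<lambda>z. h (fst z) \<oplus>\<^bsub>E\<^esub> snd z \<odot>\<^bsub>E\<^esub> v)"
    by (intro linear_map_add[OF E] linear_map_comp[OF fst h] linear_map_comp[OF snd] linear_map_of_element[OF E v])
  obtain g where g: "linear_map R ?A E g"
    "\<And>z. z \<in> carrier ?D \<Longrightarrow> g (fst z \<oplus>\<^bsub>M\<^esub> snd z \<odot>\<^bsub>M\<^esub> b) = h (fst z) \<oplus>\<^bsub>E\<^esub> snd z \<odot>\<^bsub>E\<^esub> v"
  proof (rule linear_map_factor[OF D M.submodule_module[OF adj(1)] E p _ f])
    show "(\<lambda>z. fst z \<oplus>\<^bsub>M\<^esub> snd z \<odot>\<^bsub>M\<^esub> b) ` carrier ?D = carrier ?A"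
      by (force simp: M.adjoin_def)
    fix z assume z: "z \<in> carrier ?D" "fst z \<oplus>\<^bsub>M\<^esub> snd z \<odot>\<^bsub>M\<^esub> b = \<zero>\<^bsub>?A\<^esub>"
    then obtain n r where nr: "z = (n, r)" "n \<in> N" "r \<in> carrier R" by auto
    have nc: "n \<in> carrier M" using nr Nc by auto
    have sum: "n \<oplus>\<^bsub>M\<^esub> r \<odot>\<^bsub>M\<^esub> b = \<zero>\<^bsub>M\<^esub>" using z nr by simp
    have rc: "r \<odot>\<^bsub>M\<^esub> b \<in> carrier M" using nr b by simp
    have "r \<odot>\<^bsub>M\<^esub> b \<oplus>\<^bsub>M\<^esub> n = \<zero>\<^bsub>M\<^esub>" using sum nc rc by (simp add: M.M.a_comm)
    then have rb: "r \<odot>\<^bsub>M\<^esub> b = \<ominus>\<^bsub>M\<^esub> n" using nc rc M.M.minus_equality[of "r \<odot>\<^bsub>M\<^esub> b" n] by simp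
    then have rbN: "r \<odot>\<^bsub>M\<^esub> b \<in> N" using M.submoduleE(3)[OF N nr(2)] by simp
    have "h n \<oplus>\<^bsub>E\<^esub> r \<odot>\<^bsub>E\<^esub> v = h (n \<oplus>\<^bsub>M\<^esub> r \<odot>\<^bsub>M\<^esub> b)"
      using linear_mapD(2)[OF h, of n "r \<odot>\<^bsub>M\<^esub> b"] compat[OF nr(3) rbN] rbN nr(2) by simp
    also have "\<dots> = \<zero>\<^bsub>E\<^esub>" using linear_zero[OF Nm E h] sum by simp
    finally show "h (fst z) \<oplus>\<^bsub>E\<^esub> snd z \<odot>\<^bsub>E\<^esub> v = \<zero>\<^bsub>E\<^esub>" using nr by simp
  qed auto
  show thesis
  proof (rule that[OF g(1)])
    show "g u = h u" if "u \<in> N" for u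
      using g(2)[of "(u, \<zero>\<^bsub>R\<^esub>)"] that Nc linear_mapD(1)[OF h, of u] b v by (simp add: subset_iff)
    show "g b = v"
      using g(2)[of "(\<zero>\<^bsub>M\<^esub>, \<one>\<^bsub>R\<^esub>)"] M.submodule_zero[OF N] linear_zero[OF Nm E h] b v by simp
  qed
qed

text \<open>The condition that \<open>Ext\<^sup>1(R/I, Z) = 0\<close> for every ideal \<open>I\<close> containing \<open>y\<close>.\<close>

definition extends_from_ideals :: "('a, 'r) ring_scheme \<Rightarrow> 'a \<Rightarrow> ('a, 'b) module \<Rightarrow> bool" where
  "extends_from_ideals R y Z \<longleftrightarrow> (\<forall>I h. ideal I R \<longrightarrow> y \<in> I \<longrightarrow>
     linear_map R ((regular_module R)\<lparr>carrier := I\<rparr>) Z h \<longrightarrow>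
     (\<exists>v\<in>carrier Z. \<forall>a\<in>I. h a = a \<odot>\<^bsub>Z\<^esub> v))"

context noetherian_local_ring
begin

text \<open>Any element of \<open>\<mm>^(j - 1)\<close> outside \<open>P\<close> will do, for the least \<open>j\<close> with \<open>\<mm>^j \<subseteq> P\<close>.\<close>

lemma exists_socle_element:
  assumes "ideal P R" "P \<noteq> carrier R" "ideal_power R \<mm> k \<subseteq> P"
  obtains s where "s \<in> carrier R" "s \<notin> P" "\<And>a. a \<in> \<mm> \<Longrightarrow> a \<otimes> s \<in> P"
proof -
  define j where "j = (LEAST j. ideal_power R \<mm> j \<subseteq> P)"
  have j: "ideal_power R \<mm> j \<subseteq> P" unfolding j_def by (rule LeastI) (rule assms(3))
  have "P \<subseteq> carrier R" using additive_subgroup.a_subset[OF ideal.axioms(1)[OF assms(1)]] .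
  then have "j \<noteq> 0" using j assms(2) ideal_power_0[of \<mm>] by (metis subset_antisym)
  then obtain i where i: "j = Suc i" using not0_implies_Suc by blast
  have "\<not> ideal_power R \<mm> i \<subseteq> P" using not_less_Least[of i "\<lambda>j. ideal_power R \<mm> j \<subseteq> P"] i j_def by simp
  then obtain s where s: "s \<in> ideal_power R \<mm> i" "s \<notin> P" by auto
  have "a \<otimes> s \<in> P" if "a \<in> \<mm>" for a
  proof -
    have "a \<otimes> s = s \<otimes> a" using that s ideal_power_subset[OF m_ideal, of i] by (intro m_comm) auto
    also have "\<dots> \<in> ideal_power R \<mm> j" unfolding i ideal_power_Suc by (rule ideal_prod.prod[OF s(1) that])
    finally show ?thesis using j by (rule_tac subsetD)
  qed
  then show thesis using that s ideal_power_subset[OF m_ideal, of i] by auto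
qed

text \<open>Every proper ideal containing \<open>y\<close> has a socle element modulo it, so that maps can be extended one
  copy of the residue field at a time.\<close>

lemma extends_from_ideals_if_from_m:
  assumes Z: "module R Z" and k: "ideal_power R \<mm> k \<subseteq> PIdl y" and y: "y \<in> \<mm>"
    and m: "\<And>g. linear_map R ((regular_module R)\<lparr>carrier := \<mm>\<rparr>) Z g \<Longrightarrow>
      \<exists>v\<in>carrier Z. \<forall>a\<in>\<mm>. g a = a \<odot>\<^bsub>Z\<^esub> v"
  shows "extends_from_ideals R y Z"
  unfolding extends_from_ideals_def
proof (intro allI impI)
  interpret Z: module R Z by fact
  interpret RM: module R "regular_module R" by (rule regular_module_module)
  fix I h assume I: "ideal I R" "y \<in> I" and h: "linear_map R ((regular_module R)\<lparr>carrier := I\<rparr>) Z h"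
  define ext where "ext J f \<longleftrightarrow> linear_map R ((regular_module R)\<lparr>carrier := J\<rparr>) Z f \<and> (\<forall>a\<in>I. f a = h a)" for J f
  obtain J where J: "ideal J R" "I \<subseteq> J \<and> (\<exists>f. ext J f)"
    and max: "\<And>J'. ideal J' R \<Longrightarrow> I \<subseteq> J' \<and> (\<exists>f. ext J' f) \<Longrightarrow> J \<subseteq> J' \<Longrightarrow> J' = J"
    by (rule exists_maximal_ideal_with[where Q = "\<lambda>J. I \<subseteq> J \<and> (\<exists>f. ext J f)", OF I(1)])
      (use h ext_def in auto)
  obtain f where f: "linear_map R ((regular_module R)\<lparr>carrier := J\<rparr>) Z f" "\<And>a. a \<in> I \<Longrightarrow> f a = h a"
    using J(2) by (auto simp: ext_def)
  have Js: "submodule J R (regular_module R)" using J(1) by (simp add: submodule_regular_iff)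
  have "J = carrier R"
  proof (rule ccontr)
    assume nJ: "J \<noteq> carrier R"
    have "PIdl y \<subseteq> J" using cgenideal_minimal[OF J(1)] J(2) I(2) by auto
    then have "ideal_power R \<mm> k \<subseteq> J" using k by auto
    then obtain s where s: "s \<in> carrier R" "s \<notin> J" "\<And>a. a \<in> \<mm> \<Longrightarrow> a \<otimes> s \<in> J"
      using exists_socle_element[OF J(1) nJ] by metis
    have "linear_map R ((regular_module R)\<lparr>carrier := \<mm>\<rparr>) Z (\<lambda>a. f (a \<otimes> s))"
    proof (rule linear_mapI)
      fix a assume a: "a \<in> carrier ((regular_module R)\<lparr>carrier := \<mm>\<rparr>)"
      then have ac: "a \<in> \<mm>" "a \<in> carrier R" using Icarr by auto
      show "f (a \<otimes> s) \<in> carrier Z" using linear_mapD(1)[OF f(1)] s(3) ac by simp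
      show "f ((a \<oplus>\<^bsub>(regular_module R)\<lparr>carrier := \<mm>\<rparr>\<^esub> b) \<otimes> s) = f (a \<otimes> s) \<oplus>\<^bsub>Z\<^esub> f (b \<otimes> s)"
        if "b \<in> carrier ((regular_module R)\<lparr>carrier := \<mm>\<rparr>)" for b
        using linear_mapD(2)[OF f(1), of "a \<otimes> s" "b \<otimes> s"] s ac that Icarr by (simp add: l_distr)
      show "f ((r \<odot>\<^bsub>(regular_module R)\<lparr>carrier := \<mm>\<rparr>\<^esub> a) \<otimes> s) = r \<odot>\<^bsub>Z\<^esub> f (a \<otimes> s)"
        if "r \<in> carrier R" for r
        using linear_mapD(3)[OF f(1), of r "a \<otimes> s"] s ac that by (simp add: m_assoc)
    qed
    then obtain v where v: "v \<in> carrier Z" "\<And>a. a \<in> \<mm> \<Longrightarrow> f (a \<otimes> s) = a \<odot>\<^bsub>Z\<^esub> v"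
      using m by blast
    have mem: "a \<in> \<mm>" if a: "a \<in> carrier R" "a \<otimes> s \<in> J" for a
      using mem_if_unit_mult_mem[OF J(1) a(1) _ s(1) a(2)] s(2) by (rule_tac ccontr) simp
    obtain g where g: "linear_map R ((regular_module R)\<lparr>carrier := RM.adjoin J s\<rparr>) Z g"
      "\<And>u. u \<in> J \<Longrightarrow> g u = f u"
    proof (rule linear_extend_adjoin[OF regular_module_module Z Js f(1) _ v(1)])
      show "f (a \<odot>\<^bsub>regular_module R\<^esub> s) = a \<odot>\<^bsub>Z\<^esub> v" if "a \<in> carrier R" "a \<odot>\<^bsub>regular_module R\<^esub> s \<in> J" for a
        using v(2)[OF mem] that by simp
    qed (use s in auto)
    have adj: "submodule (RM.adjoin J s) R (regular_module R)" "J \<subseteq> RM.adjoin J s" "s \<in> RM.adjoin J s"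
      using RM.adjoin[OF Js] s(1) by auto
    have "ext (RM.adjoin J s) g" unfolding ext_def using g f(2) J(2) by auto
    then have "RM.adjoin J s = J"
      using max[of "RM.adjoin J s"] adj(1,2) J(2) by (auto simp: submodule_regular_iff)
    then show False using adj(3) s(2) by simp
  qed
  then have lf: "linear_map R (regular_module R) Z f" using f(1) by (simp add: linear_map_def)
  show "\<exists>v\<in>carrier Z. \<forall>a\<in>I. h a = a \<odot>\<^bsub>Z\<^esub> v"
  proof (intro bexI ballI)
    show "f \<one> \<in> carrier Z" using linear_mapD(1)[OF lf] by simp
    fix a assume a: "a \<in> I"
    then have "a \<in> carrier R" by (rule ideal.Icarr[OF I(1)])
    then show "h a = a \<odot>\<^bsub>Z\<^esub> f \<one>" using linear_mapD(3)[OF lf, of a \<one>] f(2)[OF a] by simp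
  qed
qed

text \<open>Generators of \<open>X\<close> are adjoined to \<open>N\<close> one at a time.  The multiples of a generator that lie in the part
  already reached are given by an ideal that contains \<open>y\<close>, to which the hypothesis on \<open>Z\<close> applies.\<close>

lemma extends_to_fg_module:
  assumes ext: "extends_from_ideals R y Z" and Z: "module R Z" and y: "y \<in> carrier R"
    and X: "fg_module R X" and N: "submodule N R X"
    and yN: "\<And>u. u \<in> carrier X \<Longrightarrow> y \<odot>\<^bsub>X\<^esub> u \<in> N" and h: "linear_map R (X\<lparr>carrier := N\<rparr>) Z h"
  obtains g where "linear_map R X Z g" "\<And>u. u \<in> N \<Longrightarrow> g u = h u"
proof -
  have Xm: "module R X" using X by (auto simp: fg_module_def)
  interpret X: module R X by (rule Xm)
  obtain S0 where S0: "S0 \<subseteq> carrier X" "finite S0" "span_module R X S0 = carrier X"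
    using X by (auto simp: fg_module_def)
  have "\<exists>N' g. submodule N' R X \<and> N \<subseteq> N' \<and> S \<subseteq> N' \<and> linear_map R (X\<lparr>carrier := N'\<rparr>) Z g \<and> (\<forall>u\<in>N. g u = h u)"
    if "finite S" "S \<subseteq> carrier X" for S
    using that
  proof (induction S)
    case empty
    then show ?case using N h by (intro exI[of _ N] exI[of _ h]) auto
  next
    case (insert s S)
    then obtain N' g where N': "submodule N' R X" "N \<subseteq> N'" "S \<subseteq> N'"
      "linear_map R (X\<lparr>carrier := N'\<rparr>) Z g" "\<forall>u\<in>N. g u = h u" by auto
    have s: "s \<in> carrier X" using insert.prems by simp
    define I where "I = {a \<in> carrier R. a \<odot>\<^bsub>X\<^esub> s \<in> N'}"
    note mul = linear_map_of_element[OF Xm s]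
    have I: "ideal I R"
      using preimage_submodule[OF regular_module_module Xm mul N'(1)]
      by (simp add: submodule_regular_iff I_def)
    have yI: "y \<in> I" using yN[OF s] N'(2) y by (auto simp: I_def)
    have "linear_map R ((regular_module R)\<lparr>carrier := I\<rparr>) (X\<lparr>carrier := N'\<rparr>) (\<lambda>a. a \<odot>\<^bsub>X\<^esub> s)"
      by (intro linear_map_into_sub linear_map_restrict[OF mul]) (auto simp: I_def)
    from linear_map_comp[OF this N'(4)]
    obtain v where v: "v \<in> carrier Z" "\<And>a. a \<in> I \<Longrightarrow> g (a \<odot>\<^bsub>X\<^esub> s) = a \<odot>\<^bsub>Z\<^esub> v"
      using ext I yI unfolding extends_from_ideals_def by metis
    obtain g' where g': "linear_map R (X\<lparr>carrier := X.adjoin N' s\<rparr>) Z g'" "\<And>u. u \<in> N' \<Longrightarrow> g' u = g u"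
      by (rule linear_extend_adjoin[OF Xm Z N'(1,4) s v(1)]) (use v(2) in \<open>auto simp: I_def\<close>)
    show ?case
      using X.adjoin[OF N'(1) s] N' g' by (intro exI[of _ "X.adjoin N' s"] exI[of _ g']) auto
  qed
  from this[OF S0(2,1)] obtain N' g where N': "submodule N' R X" "N \<subseteq> N'" "S0 \<subseteq> N'"
    "linear_map R (X\<lparr>carrier := N'\<rparr>) Z g" "\<forall>u\<in>N. g u = h u" by blast
  have "N' = carrier X" using span_minimal[OF N'(1,3)] S0(3) X.submoduleE(1)[OF N'(1)] by simp
  then have "linear_map R X Z g" using N'(4) by (simp add: linear_map_def)
  then show thesis using that N'(5) by blast
qed

text \<open>One step of the descent along an injective resolution.  In cohomological terms: \<open>R/\<mm>\<close> embeds into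
  \<open>R/(y)\<close>.  So for \<open>i \<ge> 2\<close> the module \<open>Ext^i(R/\<mm>, \<omega>)\<close> lies in an exact sequence between \<open>Ext^i(R/(y), \<omega>)\<close>, which is zero
  because \<open>R/(y)\<close> has projective dimension one, and an \<open>Ext^(i+1)\<close> of a module of finite length, which is
  zero by the previous step.  The proof carries this
  out on elements: \<open>w\<close> is the obstruction to extending \<open>g\<close>, a socle element of \<open>W\<close>, and it has to be lifted
  to an element of \<open>E\<close> killed by \<open>\<mm>\<close>.\<close>

lemma extends_from_ideals_descent:
  assumes y: "y \<in> \<mm>" and reg: "\<And>r. r \<in> carrier R \<Longrightarrow> y \<otimes> r = \<zero> \<Longrightarrow> r = \<zero>"
    and k: "ideal_power R \<mm> k \<subseteq> PIdl y"
    and D: "injective_module R D" and E: "injective_module R E" and W: "module R W"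
    and d0: "linear_map R D E d0" and d1: "linear_map R E W d1" "d1 ` carrier E = carrier W"
    and exact: "d0 ` carrier D = module_ker E W d1"
    and ext: "extends_from_ideals R y W"
  shows "extends_from_ideals R y (E\<lparr>carrier := module_ker E W d1\<rparr>)"
proof -
  have Em: "module R E" and Dm: "module R D" using E D by (auto simp: injective_module_def)
  interpret E: module R E by (rule Em)
  interpret D: module R D by (rule Dm)
  interpret W: module R W by (rule W)
  interpret RM: module R "regular_module R" by (rule regular_module_module)
  let ?Z = "module_ker E W d1"
  have yc: "y \<in> carrier R" using y by (rule Icarr)
  have Zs: "submodule ?Z R E" by (rule ker_submodule[OF Em W d1(1)])
  have P: "ideal (PIdl y) R" by (rule cgenideal_ideal[OF yc])
  have Ps: "submodule (PIdl y) R (regular_module R)" using P by (simp add: submodule_regular_iff)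
  have "PIdl y \<subseteq> \<mm>" by (rule cgenideal_minimal[OF m_ideal y])
  then have "PIdl y \<noteq> carrier R" using m_proper one_closed by (metis subsetD)
  then obtain s where s: "s \<in> carrier R" "s \<notin> PIdl y" "\<And>a. a \<in> \<mm> \<Longrightarrow> a \<otimes> s \<in> PIdl y"
    using exists_socle_element[OF P _ k] by metis
  show ?thesis
  proof (rule extends_from_ideals_if_from_m[OF E.submodule_module[OF Zs] k y])
    fix g assume g: "linear_map R ((regular_module R)\<lparr>carrier := \<mm>\<rparr>) (E\<lparr>carrier := ?Z\<rparr>) g"
    have gZ: "g a \<in> ?Z" if "a \<in> \<mm>" for a using linear_mapD(1)[OF g] that by simp
    have "linear_map R ((regular_module R)\<lparr>carrier := \<mm>\<rparr>) E g"
      using linear_map_out_of_sub[OF g E.submoduleE(1)[OF Zs]] .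
    then obtain v where v: "v \<in> carrier E" "\<And>a. a \<in> \<mm> \<Longrightarrow> g a = a \<odot>\<^bsub>E\<^esub> v"
      using injective_ideal_extend[OF E m_ideal] by blast
    define w where "w = d1 v"
    have w: "w \<in> carrier W" using linear_mapD(1)[OF d1(1) v(1)] by (simp add: w_def)
    have mw: "a \<odot>\<^bsub>W\<^esub> w = \<zero>\<^bsub>W\<^esub>" if "a \<in> \<mm>" for a
      using gZ[OF that] v(2)[OF that] linear_mapD(3)[OF d1(1) Icarr[OF that] v(1)]
      by (simp add: module_ker_def w_def)
    \<comment> \<open>\<open>s\<close> spans a copy of \<open>R/\<mm>\<close> in \<open>R/(y)\<close>, so that \<open>s \<mapsto> w\<close> is well defined\<close>
    obtain f where f: "linear_map R ((regular_module R)\<lparr>carrier := RM.adjoin (PIdl y) s\<rparr>) W f"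
      "\<And>a. a \<in> PIdl y \<Longrightarrow> f a = \<zero>\<^bsub>W\<^esub>" "f s = w"
    proof (rule linear_extend_adjoin[OF regular_module_module W Ps linear_map_zero[OF W] _ w])
      fix a assume a: "a \<in> carrier R" "a \<odot>\<^bsub>regular_module R\<^esub> s \<in> PIdl y"
      have "a \<in> \<mm>"
        using mem_if_unit_mult_mem[OF P a(1) _ s(1)] a(2) s(2) by (rule_tac ccontr) simp
      then show "\<zero>\<^bsub>W\<^esub> = a \<odot>\<^bsub>W\<^esub> w" using mw by simp
    qed (use s(1) in auto)
    have adj: "ideal (RM.adjoin (PIdl y) s) R" "PIdl y \<subseteq> RM.adjoin (PIdl y) s" "s \<in> RM.adjoin (PIdl y) s"
      using RM.adjoin[OF Ps] s(1) by (auto simp: submodule_regular_iff)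
    have yy: "y \<in> PIdl y" by (rule cgenideal_self[OF yc])
    obtain u where u: "u \<in> carrier W" "\<And>a. a \<in> RM.adjoin (PIdl y) s \<Longrightarrow> f a = a \<odot>\<^bsub>W\<^esub> u"
      using ext[unfolded extends_from_ideals_def, rule_format, OF adj(1) subsetD[OF adj(2) yy] f(1)] by auto
    have yu: "y \<odot>\<^bsub>W\<^esub> u = \<zero>\<^bsub>W\<^esub>" and su: "s \<odot>\<^bsub>W\<^esub> u = w"
      using u(2)[of y] u(2)[of s] f(2)[OF yy] f(3) adj yy by auto
    \<comment> \<open>a preimage of \<open>u\<close> killed by \<open>y\<close>, found by divisibility of \<open>D\<close>\<close>
    obtain v1 where v1: "v1 \<in> carrier E" "d1 v1 = u" using d1(2) u(1) by (metis imageE)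
    have "y \<odot>\<^bsub>E\<^esub> v1 \<in> ?Z" using linear_mapD(3)[OF d1(1) yc v1(1)] v1 yu yc by (simp add: module_ker_def)
    then obtain c where c: "c \<in> carrier D" "y \<odot>\<^bsub>E\<^esub> v1 = d0 c" using exact by (metis imageE)
    obtain c' where c': "c' \<in> carrier D" "c = y \<odot>\<^bsub>D\<^esub> c'"
      using injective_divisible[OF D yc reg c(1)] by metis
    have d0c: "d0 c' \<in> carrier E" by (rule linear_mapD(1)[OF d0 c'(1)])
    have d10: "d1 (d0 c') = \<zero>\<^bsub>W\<^esub>" using exact c'(1) by (auto simp: module_ker_def)
    define v2 where "v2 = v1 \<ominus>\<^bsub>E\<^esub> d0 c'"
    have v2: "v2 \<in> carrier E" unfolding v2_def using v1 d0c by simp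
    have yv2: "y \<odot>\<^bsub>E\<^esub> v2 = \<zero>\<^bsub>E\<^esub>"
      unfolding v2_def using E.smult_minus_right[OF yc v1(1) d0c] c(2) c' linear_mapD(3)[OF d0 yc c'(1)] yc d0c
      by (simp add: a_minus_def E.M.r_neg)
    have d1v2: "d1 v2 = u"
      unfolding v2_def using linear_minus[OF Em W d1(1) v1(1) d0c] d10 v1 u(1)
      by (simp add: a_minus_def)
    define v' where "v' = s \<odot>\<^bsub>E\<^esub> v2"
    have v': "v' \<in> carrier E" "d1 v' = w"
      unfolding v'_def using v2 s(1) linear_mapD(3)[OF d1(1) s(1) v2] d1v2 su by auto
    have av': "a \<odot>\<^bsub>E\<^esub> v' = \<zero>\<^bsub>E\<^esub>" if a: "a \<in> \<mm>" for a
    proof -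
      obtain r where r: "r \<in> carrier R" "a \<otimes> s = r \<otimes> y" using s(3)[OF a] by (auto simp: cgenideal_def)
      have "a \<odot>\<^bsub>E\<^esub> v' = (a \<otimes> s) \<odot>\<^bsub>E\<^esub> v2" using Icarr[OF a] s(1) v2 by (simp add: v'_def E.smult_assoc1)
      also have "\<dots> = r \<odot>\<^bsub>E\<^esub> (y \<odot>\<^bsub>E\<^esub> v2)" using r yc v2 by (simp add: E.smult_assoc1)
      finally show ?thesis using yv2 r by simp
    qed
    show "\<exists>v\<in>carrier (E\<lparr>carrier := ?Z\<rparr>). \<forall>a\<in>\<mm>. g a = a \<odot>\<^bsub>E\<lparr>carrier := ?Z\<rparr>\<^esub> v"
    proof (intro bexI[of _ "v \<ominus>\<^bsub>E\<^esub> v'"] ballI)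
      have "d1 (v \<ominus>\<^bsub>E\<^esub> v') = \<zero>\<^bsub>W\<^esub>"
        using linear_minus[OF Em W d1(1) v(1) v'(1)] v'(2) w by (simp add: w_def a_minus_def W.M.r_neg)
      then show "v \<ominus>\<^bsub>E\<^esub> v' \<in> carrier (E\<lparr>carrier := ?Z\<rparr>)" using v(1) v'(1) by (simp add: module_ker_def)
      fix a assume a: "a \<in> \<mm>"
      show "g a = a \<odot>\<^bsub>E\<lparr>carrier := ?Z\<rparr>\<^esub> (v \<ominus>\<^bsub>E\<^esub> v')"
        using E.smult_minus_right[OF Icarr[OF a] v(1) v'(1)] v(2)[OF a] av'[OF a] v(1) Icarr[OF a]
        by (simp add: a_minus_def)
    qed
  qed
qed

text \<open>Beyond the end of the resolution there is nothing to extend, and the descent leads back to the first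
  cosyzygy.  In cohomological terms, \<open>Ext^i(R/I, \<omega>) = 0\<close> for all \<open>i \<ge> 2\<close> and all ideals \<open>I\<close> containing \<open>y\<close>.\<close>

lemma cosyzygy_extends_from_ideals:
  assumes y: "y \<in> \<mm>" and reg: "\<And>r. r \<in> carrier R \<Longrightarrow> y \<otimes> r = \<zero> \<Longrightarrow> r = \<zero>"
    and k: "ideal_power R \<mm> k \<subseteq> PIdl y"
    and I: "\<And>j. injective_module R (I j)" and d: "\<And>j. d j \<in> Hom R (I j) (I (Suc j))"
    and exact: "\<And>j. d j ` carrier (I j) = module_ker (I (Suc j)) (I (Suc (Suc j))) (d (Suc j))"
    and fin: "\<And>j. j > n \<Longrightarrow> carrier (I j) = {\<zero>\<^bsub>I j\<^esub>}"
  shows "extends_from_ideals R y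
    ((I (Suc j))\<lparr>carrier := module_ker (I (Suc j)) (I (Suc (Suc j))) (d (Suc j))\<rparr>)"
proof -
  let ?Z = "\<lambda>j. (I (Suc j))\<lparr>carrier := module_ker (I (Suc j)) (I (Suc (Suc j))) (d (Suc j))\<rparr>"
  have Im: "module R (I j)" for j using I[of j] by (auto simp: injective_module_def)
  note lin = Hom_linear[OF d]
  have base: "extends_from_ideals R y (?Z j)" if "n \<le> j" for j
  proof -
    interpret Ij: module R "I (Suc j)" by (rule Im)
    have zero: "carrier (I (Suc j)) = {\<zero>\<^bsub>I (Suc j)\<^esub>}" using that by (intro fin) simp
    have Z: "carrier (?Z j) = {\<zero>\<^bsub>I (Suc j)\<^esub>}"
      using zero linear_zero[OF Im Im lin, of "Suc j"] by (auto simp: module_ker_def)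
    show ?thesis
      unfolding extends_from_ideals_def
    proof (intro allI impI bexI ballI)
      fix J h a assume J: "ideal J R" "linear_map R ((regular_module R)\<lparr>carrier := J\<rparr>) (?Z j) h" "a \<in> J"
      show "h a = a \<odot>\<^bsub>?Z j\<^esub> \<zero>\<^bsub>I (Suc j)\<^esub>"
        using linear_mapD(1)[OF J(2), of a] J(3) Z Ij.smult_r_null[OF ideal.Icarr[OF J(1,3)]] by simp
    qed (use Z in simp)
  qed
  have step: "extends_from_ideals R y (?Z j)" if ext: "extends_from_ideals R y (?Z (Suc j))" for j
  proof -
    interpret W: module R "I (Suc (Suc j))" by (rule Im)
    have ker: "module_ker (I (Suc j)) (?Z (Suc j)) (d (Suc j)) = module_ker (I (Suc j)) (I (Suc (Suc j))) (d (Suc j))"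
      by (simp add: module_ker_def)
    have "extends_from_ideals R y ((I (Suc j))\<lparr>carrier := module_ker (I (Suc j)) (?Z (Suc j)) (d (Suc j))\<rparr>)"
    proof (rule extends_from_ideals_descent[OF y reg k I I _ lin _ _ _ ext])
      show "module R (?Z (Suc j))" by (rule W.submodule_module[OF ker_submodule[OF Im Im lin]])
      show "linear_map R (I (Suc j)) (?Z (Suc j)) (d (Suc j))"
        by (rule linear_map_into_sub[OF lin]) (use exact[of "Suc j"] in auto)
      show "d (Suc j) ` carrier (I (Suc j)) = carrier (?Z (Suc j))" using exact[of "Suc j"] by simp
      show "d j ` carrier (I j) = module_ker (I (Suc j)) (?Z (Suc j)) (d (Suc j))"
        using exact[of j] ker by simp
    qed auto
    then show ?thesis unfolding ker .
  qed
  show ?thesis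
  proof (cases "n \<le> j")
    case False
    then have "j \<le> n" by simp
    then show ?thesis by (induction rule: inc_induct) (use base[of n] step in auto)
  qed (rule base)
qed

end

lemma (in module) submodule_of_submodule:
  assumes "submodule K R M" "submodule N R (M\<lparr>carrier := K\<rparr>)"
  shows "submodule N R M"
proof -
  interpret K: module R "M\<lparr>carrier := K\<rparr>" by (rule submodule_module[OF assms(1)])
  show ?thesis
    using K.submoduleE(1,4,5)[OF assms(2)] K.submodule_zero[OF assms(2)] submoduleE(1)[OF assms(1)]
    by (intro submoduleI') auto
qed

text \<open>The setting of the next lemmas: \<open>y\<close> is a parameter of \<open>R\<close>, the module \<open>W\<close> stands for \<open>\<omega>\<close>, and
  \<open>X = F/K\<close> is a finitely generated module on which \<open>y\<close> is regular.\<close>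

locale presented_module = noetherian_local_ring R \<mm>
    for R :: "('a, 'r) ring_scheme" (structure) and \<mm> +
  fixes y :: 'a and k :: nat and W :: "('a, 'w) module" and X :: "('a, 'x) module"
    and m :: nat and p :: "(nat \<Rightarrow> 'a) \<Rightarrow> 'x"
  assumes y: "y \<in> \<mm>" and reg: "\<And>r. r \<in> carrier R \<Longrightarrow> y \<otimes> r = \<zero> \<Longrightarrow> r = \<zero>"
    and k: "ideal_power R \<mm> k \<subseteq> PIdl y"
    and W: "fg_module R W" and fid: "finite_injective_dim R W"
    and X: "fg_module R X" and Xreg: "\<And>u. u \<in> carrier X \<Longrightarrow> y \<odot>\<^bsub>X\<^esub> u = \<zero>\<^bsub>X\<^esub> \<Longrightarrow> u = \<zero>\<^bsub>X\<^esub>"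
    and p: "linear_map R (free_module R m) X p" "p ` carrier (free_module R m) = carrier X"
begin

abbreviation F where "F \<equiv> free_module R m"
abbreviation K where "K \<equiv> module_ker F X p"
abbreviation KM where "KM \<equiv> F\<lparr>carrier := K\<rparr>"

lemma yc: "y \<in> carrier R"
  using y by (rule Icarr)

lemma Wm: "module R W" and Xm: "module R X" and Fm: "module R F"
  using W X free_module_module by (auto simp: fg_module_def)

lemma K: "submodule K R F" and Kc: "K \<subseteq> carrier F"
  using ker_submodule[OF Fm Xm p(1)] by (auto simp: module_ker_def)

text \<open>Since \<open>Ext^2(X/yX, \<omega>) = 0\<close>, multiplication by \<open>y\<close> is onto on \<open>Ext^1(X, \<omega>)\<close>, which is the cokernel of the
  restriction map from \<open>Hom(F, \<omega>)\<close> to \<open>Hom(K, \<omega>)\<close>.\<close>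

lemma hom_mod_restrictions_divisible:
  assumes h: "linear_map R KM W h"
  obtains h' g where "linear_map R KM W h'" "linear_map R F W g"
    "\<And>u. u \<in> K \<Longrightarrow> h u = g u \<oplus>\<^bsub>W\<^esub> y \<odot>\<^bsub>W\<^esub> h' u"
proof -
  interpret W: module R W by (rule Wm)
  interpret X: module R X by (rule Xm)
  obtain I :: "nat \<Rightarrow> 'a rmod" and e d n where res: "(\<forall>j. injective_module R (I j)) \<and>
      e \<in> Hom R W (I 0) \<and> inj_on e (carrier W) \<and> (\<forall>j. d j \<in> Hom R (I j) (I (Suc j))) \<and>
      e ` carrier W = module_ker (I 0) (I 1) (d 0) \<and>
      (\<forall>j. d j ` carrier (I j) = module_ker (I (Suc j)) (I (Suc (Suc j))) (d (Suc j))) \<and>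
      (\<forall>j>n. carrier (I j) = {\<zero>\<^bsub>I j\<^esub>})"
    using fid unfolding finite_injective_dim_def by (elim exE) (erule that)
  have I: "\<And>j. injective_module R (I j)" and e: "e \<in> Hom R W (I 0)" "inj_on e (carrier W)"
    and d: "\<And>j. d j \<in> Hom R (I j) (I (Suc j))"
    and ex0: "e ` carrier W = module_ker (I 0) (I (Suc 0)) (d 0)"
    and ex: "\<And>j. d j ` carrier (I j) = module_ker (I (Suc j)) (I (Suc (Suc j))) (d (Suc j))"
    and fin: "\<And>j. j > n \<Longrightarrow> carrier (I j) = {\<zero>\<^bsub>I j\<^esub>}"
    using res by simp_all
  have Im: "module R (I j)" for j using I[of j] by (auto simp: injective_module_def)
  interpret I0: module R "I 0" by (rule Im)
  interpret I1: module R "I (Suc 0)" by (rule Im)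
  note d0 = Hom_linear[OF d[of 0]] and elin = Hom_linear[OF e(1)]
  let ?ker = "module_ker (I 0) (I (Suc 0)) (d 0)"
  let ?Z = "(I (Suc 0))\<lparr>carrier := module_ker (I (Suc 0)) (I (Suc (Suc 0))) (d (Suc 0))\<rparr>"
  have ext: "extends_from_ideals R y ?Z"
    by (rule cosyzygy_extends_from_ideals[where I = I and d = d and n = n, OF y reg k I d ex fin])
  have Zs: "submodule (carrier ?Z) R (I (Suc 0))"
    using ker_submodule[OF Im Im Hom_linear[OF d[of "Suc 0"]]] by simp
  have Zm: "module R ?Z" using I1.submodule_module[OF Zs] by simp
  have kers: "submodule ?ker R (I 0)" by (rule ker_submodule[OF Im Im d0])
  note kerm = I0.submodule_module[OF kers]

  \<comment> \<open>\<open>h\<close> defines a class in \<open>Ext\<^sup>1(X, \<omega>)\<close>, represented by a map \<open>q\<close> from \<open>X\<close> to the first cosyzygy\<close>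
  obtain H0 where H0: "linear_map R F (I 0) H0" "\<And>u. u \<in> K \<Longrightarrow> H0 u = e (h u)"
    using injective_extend_free[OF I K linear_map_comp[OF h elin]] by metis
  have dH0: "linear_map R F ?Z (\<lambda>u. d 0 (H0 u))"
    using linear_mapD(1)[OF H0(1)] ex[of 0]
    by (intro linear_map_into_sub linear_map_comp[OF H0(1) d0]) auto
  obtain q where q: "linear_map R X ?Z q" "\<And>u. u \<in> carrier F \<Longrightarrow> q (p u) = d 0 (H0 u)"
  proof (rule linear_map_factor[OF Fm Xm Zm p dH0])
    fix u assume "u \<in> carrier F" "p u = \<zero>\<^bsub>X\<^esub>"
    then have u: "u \<in> K" by (simp add: module_ker_def)
    then have "h u \<in> carrier W" using linear_mapD(1)[OF h] by simp
    then have "H0 u \<in> ?ker" using H0(2)[OF u] ex0 by auto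
    then show "d 0 (H0 u) = \<zero>\<^bsub>?Z\<^esub>" by (simp add: module_ker_def)
  qed auto

  \<comment> \<open>division of \<open>q\<close> by \<open>y\<close>\<close>
  have ymap: "linear_map R X X (\<lambda>u. y \<odot>\<^bsub>X\<^esub> u)"
    by (rule linear_map_smult[OF Xm _ yc]) (simp add: linear_map_def)
  let ?N = "(\<lambda>u. y \<odot>\<^bsub>X\<^esub> u) ` carrier X"
  have N: "submodule ?N R X" by (rule image_submodule[OF Xm Xm ymap X.carrier_is_submodule])
  obtain h0 where h0: "linear_map R (X\<lparr>carrier := ?N\<rparr>) ?Z h0" "\<And>u. u \<in> carrier X \<Longrightarrow> h0 (y \<odot>\<^bsub>X\<^esub> u) = q u"
  proof (rule linear_map_factor[OF Xm X.submodule_module[OF N] Zm _ _ q(1)])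
    show "linear_map R X (X\<lparr>carrier := ?N\<rparr>) (\<lambda>u. y \<odot>\<^bsub>X\<^esub> u)"
      by (rule linear_map_into_sub[OF ymap]) auto
    show "q u = \<zero>\<^bsub>?Z\<^esub>" if "u \<in> carrier X" "y \<odot>\<^bsub>X\<^esub> u = \<zero>\<^bsub>X\<lparr>carrier := ?N\<rparr>\<^esub>" for u
      using Xreg[OF that(1)] that(2) linear_zero[OF Xm Zm q(1)] by simp
  qed auto
  obtain q' where q': "linear_map R X ?Z q'" "\<And>u. u \<in> ?N \<Longrightarrow> q' u = h0 u"
    by (rule extends_to_fg_module[OF ext Zm yc X N _ h0(1)]) auto
  have q'y: "y \<odot>\<^bsub>I (Suc 0)\<^esub> q' u = q u" if "u \<in> carrier X" for u
    using linear_mapD(3)[OF q'(1) yc that] q'(2)[of "y \<odot>\<^bsub>X\<^esub> u"] h0(2)[OF that] that by simp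
  have q'1: "linear_map R F (I (Suc 0)) (\<lambda>u. q' (p u))"
    using linear_map_out_of_sub[OF linear_map_comp[OF p(1) q'(1)]] I1.submoduleE(1)[OF Zs] by simp
  have q'im: "q' (p u) \<in> d 0 ` carrier (I 0)" if "u \<in> carrier F" for u
    using linear_mapD(1)[OF linear_map_comp[OF p(1) q'(1)] that] ex[of 0] by simp
  obtain H' where H': "linear_map R F (I 0) H'" "\<And>u. u \<in> carrier F \<Longrightarrow> d 0 (H' u) = q' (p u)"
    by (rule free_module_projective[OF Im Im d0 q'1 q'im]) auto

  \<comment> \<open>transport back to \<open>\<omega>\<close> along \<open>e\<close>\<close>
  obtain i where i: "linear_map R ((I 0)\<lparr>carrier := ?ker\<rparr>) W i" "\<And>w. w \<in> carrier W \<Longrightarrow> i (e w) = w"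
  proof (rule linear_map_factor[OF Wm kerm Wm])
    show "linear_map R W ((I 0)\<lparr>carrier := ?ker\<rparr>) e"
      by (rule linear_map_into_sub[OF elin]) (use ex0 in auto)
    show "linear_map R W W (\<lambda>w. w)" by (simp add: linear_map_def)
    show "w = \<zero>\<^bsub>W\<^esub>" if "w \<in> carrier W" "e w = \<zero>\<^bsub>(I 0)\<lparr>carrier := ?ker\<rparr>\<^esub>" for w
      using inj_onD[OF e(2), of w "\<zero>\<^bsub>W\<^esub>"] that linear_zero[OF Wm Im elin] by simp
  qed (use ex0 in auto)
  have H'c: "H' u \<in> carrier (I 0)" and H0c: "H0 u \<in> carrier (I 0)" if "u \<in> carrier F" for u
    using linear_mapD(1)[OF H'(1) that] linear_mapD(1)[OF H0(1) that] .
  have ker1: "H' u \<in> ?ker" if "u \<in> K" for u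
  proof -
    have u: "u \<in> carrier F" "p u = \<zero>\<^bsub>X\<^esub>" using that by (auto simp: module_ker_def)
    then show ?thesis using H'(2)[OF u(1)] H'c[OF u(1)] linear_zero[OF Xm Zm q'(1)] by (simp add: module_ker_def)
  qed
  have ker2: "H0 u \<ominus>\<^bsub>I 0\<^esub> y \<odot>\<^bsub>I 0\<^esub> H' u \<in> ?ker" if u: "u \<in> carrier F" for u
  proof -
    have pu: "p u \<in> carrier X" by (rule linear_mapD(1)[OF p(1) u])
    have qc: "q (p u) \<in> carrier (I (Suc 0))" using linear_mapD(1)[OF q(1) pu] by (simp add: module_ker_def)
    have "d 0 (H0 u \<ominus>\<^bsub>I 0\<^esub> y \<odot>\<^bsub>I 0\<^esub> H' u) = d 0 (H0 u) \<ominus>\<^bsub>I (Suc 0)\<^esub> y \<odot>\<^bsub>I (Suc 0)\<^esub> d 0 (H' u)"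
      using linear_minus[OF Im Im d0 H0c[OF u], of "y \<odot>\<^bsub>I 0\<^esub> H' u"] linear_mapD(3)[OF d0 yc H'c[OF u]] H'c[OF u] yc
      by simp
    also have "\<dots> = \<zero>\<^bsub>I (Suc 0)\<^esub>"
      using q(2)[OF u] H'(2)[OF u] q'y[OF pu] qc by (simp add: a_minus_def I1.M.r_neg)
    finally show ?thesis using H0c[OF u] H'c[OF u] yc by (simp add: module_ker_def)
  qed
  show thesis
  proof (rule that)
    show "linear_map R KM W (\<lambda>u. i (H' u))"
      by (intro linear_map_comp[OF _ i(1)] linear_map_into_sub linear_map_restrict[OF H'(1) Kc]) (simp add: ker1)
    show "linear_map R F W (\<lambda>u. i (H0 u \<ominus>\<^bsub>I 0\<^esub> y \<odot>\<^bsub>I 0\<^esub> H' u))"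
      by (intro linear_map_comp[OF _ i(1)] linear_map_into_sub linear_map_minus[OF Im H0(1)]
          linear_map_smult[OF Im H'(1) yc]) (rule ker2)
    fix u assume u: "u \<in> K"
    then have uF: "u \<in> carrier F" using Kc by auto
    have hu: "h u \<in> carrier W" using linear_mapD(1)[OF h] u by simp
    let ?a = "H0 u \<ominus>\<^bsub>I 0\<^esub> y \<odot>\<^bsub>I 0\<^esub> H' u"
    have "h u = i (?a \<oplus>\<^bsub>I 0\<^esub> y \<odot>\<^bsub>I 0\<^esub> H' u)"
      using i(2)[OF hu] H0(2)[OF u] I0.minus_add_cancel[OF H0c[OF uF], of "y \<odot>\<^bsub>I 0\<^esub> H' u"] H'c[OF uF] yc by simp
    also have "\<dots> = i ?a \<oplus>\<^bsub>W\<^esub> i (y \<odot>\<^bsub>I 0\<^esub> H' u)"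
      using linear_mapD(2)[OF i(1), of ?a "y \<odot>\<^bsub>I 0\<^esub> H' u"] ker2[OF uF] I0.submoduleE(4)[OF kers yc ker1[OF u]]
      by simp
    also have "i (y \<odot>\<^bsub>I 0\<^esub> H' u) = y \<odot>\<^bsub>W\<^esub> i (H' u)"
      using linear_mapD(3)[OF i(1) yc, of "H' u"] ker1[OF u] by simp
    finally show "h u = i ?a \<oplus>\<^bsub>W\<^esub> y \<odot>\<^bsub>W\<^esub> i (H' u)" .
  qed
qed

text \<open>\<open>Ext^1(X, \<omega>)\<close> is finitely generated, because \<open>Hom(K, \<omega>)\<close> embeds into a power of \<open>\<omega>\<close> by evaluation at
  generators of \<open>K\<close>.  So Nakayama's lemma makes it vanish.\<close>

lemma hom_extends_to_free:
  assumes h: "linear_map R KM W h"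
  obtains g where "linear_map R F W g" "\<And>u. u \<in> K \<Longrightarrow> g u = h u"
proof -
  interpret F: module R F by (rule Fm)
  note Km = F.submodule_module[OF K]
  let ?H = "Hom_module R KM W"
  have Hm: "module R ?H" by (rule Hom_module_module[OF Km Wm])
  interpret H: module R ?H by (rule Hm)
  obtain S where S: "finite S" "span_module R F S = K"
    using fg_submodule_free[OF K] by (auto simp: fg_submodule_def)
  obtain s and v :: "nat \<Rightarrow> _" where v: "S = v ` {j. j < (s::nat)}"
    using finite_imp_nat_seg_image_inj_on[OF S(1)] by metis
  have vK: "v j \<in> K" if "j < s" for j using span_superset[of S R F] S(2) v that by auto
  have fgH: "fg_submodule R ?H (carrier ?H)"
  proof (rule fg_submodule_of_coordinates[OF Hm Wm fg_module_noetherian[OF W]])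
    show "linear_map R ?H W (\<lambda>f. f (v j))" if "j < s" for j
    proof (rule linear_mapI)
      show "f (v j) \<in> carrier W" if "f \<in> carrier ?H" for f
        using linear_mapD(1)[OF Hom_linear, of f R KM W "v j"] vK[OF \<open>j < s\<close>] that by simp
    qed (use vK[OF that] in auto)
    fix f assume f: "f \<in> carrier ?H" "\<And>j. j < s \<Longrightarrow> f (v j) = \<zero>\<^bsub>W\<^esub>"
    have "submodule (module_ker KM W f) R F"
      using f(1) by (intro F.submodule_of_submodule[OF K] ker_submodule[OF Km Wm] Hom_linear) simp
    moreover have "S \<subseteq> module_ker KM W f" using f(2) vK v by (auto simp: module_ker_def)
    ultimately have "K \<subseteq> module_ker KM W f" using span_minimal S(2) by metis
    then have ker: "f u = \<zero>\<^bsub>W\<^esub>" if "u \<in> K" for u using that by (auto simp: module_ker_def)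
    show "f = \<zero>\<^bsub>?H\<^esub>"
      by (rule Hom_ext[of _ R KM W]) (use f(1) H.M.zero_closed ker in auto)
  next
    show "submodule (carrier ?H) R ?H" by (rule H.carrier_is_submodule)
  qed auto
  let ?r = "\<lambda>f. restrict f K"
  have r: "linear_map R (Hom_module R F W) ?H ?r"
  proof (rule linear_mapI)
    fix f assume "f \<in> carrier (Hom_module R F W)"
    then have "linear_map R KM W f" using linear_map_restrict[OF Hom_linear Kc] by simp
    from linear_restrict_Hom[OF Km this] show "restrict f K \<in> carrier ?H" by simp
  qed (use Kc in \<open>auto simp: fun_eq_iff restrict_def\<close>)
  let ?L = "?r ` carrier (Hom_module R F W)"
  have L: "submodule ?L R ?H"
    by (rule image_submodule[OF Hom_module_module[OF Fm Wm] Hm r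
          module.carrier_is_submodule[OF Hom_module_module[OF Fm Wm]]])
  have "carrier ?H \<subseteq> ?L"
  proof (rule nakayama[OF Hm fgH L y])
    fix f assume f: "f \<in> carrier ?H"
    then have lin: "linear_map R KM W f" by (simp add: Hom_linear)
    obtain h' g where h'g: "linear_map R KM W h'" "linear_map R F W g"
      "\<And>u. u \<in> K \<Longrightarrow> f u = g u \<oplus>\<^bsub>W\<^esub> y \<odot>\<^bsub>W\<^esub> h' u"
      by (rule hom_mod_restrictions_divisible[OF lin]) auto
    have h'H: "restrict h' K \<in> carrier ?H" using linear_restrict_Hom[OF Km h'g(1)] by simp
    have gL: "?r (restrict g (carrier F)) \<in> ?L"
      unfolding Hom_module_simps(1) by (rule imageI[OF linear_restrict_Hom[OF Fm h'g(2)]])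
    have "f = ?r (restrict g (carrier F)) \<oplus>\<^bsub>?H\<^esub> y \<odot>\<^bsub>?H\<^esub> restrict h' K"
    proof (rule Hom_ext[of _ R KM W])
      show "f \<in> Hom R KM W" using f by simp
      show "?r (restrict g (carrier F)) \<oplus>\<^bsub>?H\<^esub> y \<odot>\<^bsub>?H\<^esub> restrict h' K \<in> Hom R KM W"
        using H.M.a_closed[OF subsetD[OF H.submoduleE(1)[OF L] gL] H.smult_closed[OF Icarr[OF y] h'H]]
        unfolding Hom_module_simps(1) .
      fix u assume "u \<in> carrier KM"
      then show "f u = (?r (restrict g (carrier F)) \<oplus>\<^bsub>?H\<^esub> y \<odot>\<^bsub>?H\<^esub> restrict h' K) u"
        using h'g(3)[of u] Kc by auto
    qed
    then show "\<exists>l\<in>?L. \<exists>h'\<in>carrier ?H. f = l \<oplus>\<^bsub>?H\<^esub> y \<odot>\<^bsub>?H\<^esub> h'" using gL h'H by blast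
  qed
  moreover have "restrict h K \<in> carrier ?H" using linear_restrict_Hom[OF Km h] by simp
  ultimately obtain g where g: "g \<in> Hom R F W" "restrict h K = restrict g K" by auto
  show thesis
  proof (rule that[OF Hom_linear[OF g(1)]])
    show "g u = h u" if "u \<in> K" for u using fun_cong[OF g(2), of u] that by simp
  qed
qed

section \<open>Functionals from the trace ideal\<close>

text \<open>If a functional \<open>\<rho>\<close> on \<open>F\<close> is a functional on \<open>X = F/K\<close> modulo \<open>y\<close>, then its multiples by elements of
  the trace ideal lift to functionals on \<open>X\<close>: for \<open>c = \<phi>(w)\<close> one lifts \<open>u \<mapsto> \<rho>(u) w\<close> modulo \<open>y\<close> to a map
  \<open>X \<rightarrow> \<omega>\<close>, which is possible since \<open>Ext\<^sup>1(X, \<omega>) = 0\<close>, and applies \<open>\<phi>\<close>.  The error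
  term then has its values in \<open>y\<close> times the trace ideal.\<close>

lemma trace_multiple_lifts:
  assumes rho: "linear_map R F (regular_module R) \<rho>" "\<And>u. u \<in> K \<Longrightarrow> \<rho> u \<in> PIdl y"
    and c: "c \<in> trace_ideal R W"
  obtains l g where "linear_map R F (regular_module R) l" "\<And>u. u \<in> K \<Longrightarrow> l u = \<zero>"
    "linear_map R F (regular_module R) g" "\<And>u. u \<in> carrier F \<Longrightarrow> g u \<in> trace_ideal R W"
    "\<And>u. u \<in> carrier F \<Longrightarrow> l u = c \<otimes> \<rho> u \<ominus> y \<otimes> g u"
proof -
  interpret W: module R W by (rule Wm)
  let ?R = "regular_module R"
  note Rm = regular_module_module
  interpret RM: module R ?R by (rule Rm)
  let ?T = "trace_ideal R W" and ?G = "\<Union>f\<in>Hom R W ?R. f ` carrier W"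
  have Gc: "?G \<subseteq> carrier R" using linear_mapD(1)[OF Hom_linear] by fastforce
  have T: "ideal ?T R" unfolding trace_ideal_def by (rule genideal_ideal[OF Gc])
  have GT: "?G \<subseteq> ?T" unfolding trace_ideal_def by (rule genideal_self[OF Gc])
  interpret T: ideal ?T R by (rule T)
  have rc: "\<rho> u \<in> carrier R" if "u \<in> carrier F" for u using linear_mapD(1)[OF rho(1) that] by simp
  define good where "good c \<longleftrightarrow> (\<exists>l g. linear_map R F ?R l \<and> (\<forall>u\<in>K. l u = \<zero>) \<and> linear_map R F ?R g \<and>
    (\<forall>u\<in>carrier F. g u \<in> ?T) \<and> (\<forall>u\<in>carrier F. l u = c \<otimes> \<rho> u \<ominus> y \<otimes> g u))" for c
  have gen: "good (f w)" if f: "f \<in> Hom R W ?R" and w: "w \<in> carrier W" for f w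
  proof -
    note flin = Hom_linear[OF f]
    let ?P = "?R\<lparr>carrier := PIdl y\<rparr>"
    have Pm: "module R ?P"
      by (rule RM.submodule_module) (simp add: submodule_regular_iff cgenideal_ideal[OF yc])
    obtain q where q: "linear_map R ?P W q" "\<And>r. r \<in> carrier R \<Longrightarrow> q (r \<otimes> y) = r \<odot>\<^bsub>W\<^esub> w"
    proof (rule linear_map_factor[OF Rm Pm Wm _ _ linear_map_of_element[OF Wm w]])
      show "linear_map R ?R ?P (\<lambda>r. r \<otimes> y)"
        using yc by (intro linear_mapI) (auto simp: cgenideal_def l_distr m_assoc)
      show "(\<lambda>r. r \<otimes> y) ` carrier ?R = carrier ?P" by (auto simp: cgenideal_def)
      show "r \<odot>\<^bsub>W\<^esub> w = \<zero>\<^bsub>W\<^esub>" if "r \<in> carrier ?R" "r \<otimes> y = \<zero>\<^bsub>?P\<^esub>" for r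
        using reg[of r] that yc w by (simp add: m_comm)
    qed auto
    have rhoP: "linear_map R KM ?P \<rho>"
      by (rule linear_map_into_sub[OF linear_map_restrict[OF rho(1) Kc]]) (simp add: rho(2))
    obtain h where h: "linear_map R F W h" "\<And>u. u \<in> K \<Longrightarrow> h u = q (\<rho> u)"
      by (rule hom_extends_to_free[OF linear_map_comp[OF rhoP q(1)]]) auto
    have hc: "h u \<in> carrier W" if "u \<in> carrier F" for u by (rule linear_mapD(1)[OF h(1) that])
    define l where "l u = f (\<rho> u \<odot>\<^bsub>W\<^esub> w \<ominus>\<^bsub>W\<^esub> y \<odot>\<^bsub>W\<^esub> h u)" for u
    have "linear_map R F ?R l"
      unfolding l_def
      by (intro linear_map_comp[OF _ flin] linear_map_minus[OF Wm] linear_map_smult[OF Wm h(1) yc]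
          linear_map_comp[OF rho(1) linear_map_of_element[OF Wm w]])
    moreover have "l u = \<zero>" if u: "u \<in> K" for u
    proof -
      obtain r where r: "r \<in> carrier R" "\<rho> u = r \<otimes> y" using rho(2)[OF u] by (auto simp: cgenideal_def)
      have "\<rho> u \<odot>\<^bsub>W\<^esub> w = y \<odot>\<^bsub>W\<^esub> h u"
        using h(2)[OF u] q(2)[OF r(1)] r yc w by (simp add: m_comm[of r y] W.smult_assoc1)
      then have "l u = f \<zero>\<^bsub>W\<^esub>" using hc[of u] Kc u yc by (auto simp: l_def a_minus_def W.M.r_neg subset_iff)
      then show ?thesis using linear_zero[OF Wm Rm flin] by simp
    qed
    moreover have "linear_map R F ?R (\<lambda>u. f (h u))" by (rule linear_map_comp[OF h(1) flin])
    moreover have "f (h u) \<in> ?T" if "u \<in> carrier F" for u using f hc[OF that] GT by blast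
    moreover have "l u = f w \<otimes> \<rho> u \<ominus> y \<otimes> f (h u)" if u: "u \<in> carrier F" for u
      unfolding l_def
      using linear_minus[OF Wm Rm flin, of "\<rho> u \<odot>\<^bsub>W\<^esub> w" "y \<odot>\<^bsub>W\<^esub> h u"] linear_mapD(3)[OF flin rc[OF u] w]
        linear_mapD(3)[OF flin yc hc[OF u]] linear_mapD(1)[OF flin w] rc[OF u] hc[OF u] w yc
      by (simp add: regular_module_minus m_comm)
    ultimately show ?thesis unfolding good_def by blast
  qed
  have "ideal {c \<in> carrier R. good c} R"
  proof (rule idealI')
    have "good \<zero>"
      unfolding good_def using rc yc T.zero_closed linear_map_zero[OF Rm, of F]
      by (intro exI[of _ "\<lambda>_. \<zero>"]) (auto simp: a_minus_def)
    then show "\<zero> \<in> {c \<in> carrier R. good c}" by simp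
    fix a assume "a \<in> {c \<in> carrier R. good c}"
    then obtain l g where a: "a \<in> carrier R" and lg: "linear_map R F ?R l" "\<And>u. u \<in> K \<Longrightarrow> l u = \<zero>"
      "linear_map R F ?R g" "\<And>u. u \<in> carrier F \<Longrightarrow> g u \<in> ?T"
      "\<And>u. u \<in> carrier F \<Longrightarrow> l u = a \<otimes> \<rho> u \<ominus> y \<otimes> g u"
      unfolding good_def by blast
    have gc: "g u \<in> carrier R" if "u \<in> carrier F" for u using linear_mapD(1)[OF lg(3) that] by simp
    { fix b assume "b \<in> {c \<in> carrier R. good c}"
      then obtain l' g' where b: "b \<in> carrier R" and lg': "linear_map R F ?R l'" "\<And>u. u \<in> K \<Longrightarrow> l' u = \<zero>"
        "linear_map R F ?R g'" "\<And>u. u \<in> carrier F \<Longrightarrow> g' u \<in> ?T"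
        "\<And>u. u \<in> carrier F \<Longrightarrow> l' u = b \<otimes> \<rho> u \<ominus> y \<otimes> g' u"
        unfolding good_def by blast
      have gc': "g' u \<in> carrier R" if "u \<in> carrier F" for u using linear_mapD(1)[OF lg'(3) that] by simp
      have "good (a \<oplus> b)"
        unfolding good_def
      proof (intro exI conjI ballI)
        show "linear_map R F ?R (\<lambda>u. l u \<oplus>\<^bsub>?R\<^esub> l' u)" "linear_map R F ?R (\<lambda>u. g u \<oplus>\<^bsub>?R\<^esub> g' u)"
          by (rule linear_map_add[OF Rm lg(1) lg'(1)], rule linear_map_add[OF Rm lg(3) lg'(3)])
        show "l u \<oplus>\<^bsub>?R\<^esub> l' u = \<zero>" if "u \<in> K" for u using lg(2) lg'(2) that by simp
        fix u assume u: "u \<in> carrier F"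
        show "g u \<oplus>\<^bsub>?R\<^esub> g' u \<in> ?T" using lg(4)[OF u] lg'(4)[OF u] by (simp add: T.a_closed)
        have "(a \<otimes> \<rho> u \<ominus> y \<otimes> g u) \<oplus> (b \<otimes> \<rho> u \<ominus> y \<otimes> g' u) = (a \<oplus> b) \<otimes> \<rho> u \<ominus> y \<otimes> (g u \<oplus> g' u)"
          using a b yc rc[OF u] gc[OF u] gc'[OF u] by algebra
        then show "l u \<oplus>\<^bsub>?R\<^esub> l' u = (a \<oplus> b) \<otimes> \<rho> u \<ominus> y \<otimes> (g u \<oplus>\<^bsub>?R\<^esub> g' u)"
          using lg(5)[OF u] lg'(5)[OF u] by simp
      qed
      then show "a \<oplus> b \<in> {c \<in> carrier R. good c}" using a b by simp }
    fix r assume r: "r \<in> carrier R"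
    have "good (r \<otimes> a)"
      unfolding good_def
    proof (intro exI conjI ballI)
      show "linear_map R F ?R (\<lambda>u. r \<odot>\<^bsub>?R\<^esub> l u)" "linear_map R F ?R (\<lambda>u. r \<odot>\<^bsub>?R\<^esub> g u)"
        by (rule linear_map_smult[OF Rm lg(1) r], rule linear_map_smult[OF Rm lg(3) r])
      show "r \<odot>\<^bsub>?R\<^esub> l u = \<zero>" if "u \<in> K" for u using lg(2) that r by simp
      fix u assume u: "u \<in> carrier F"
      show "r \<odot>\<^bsub>?R\<^esub> g u \<in> ?T" using lg(4)[OF u] r by (simp add: T.I_l_closed)
      have "r \<otimes> (a \<otimes> \<rho> u \<ominus> y \<otimes> g u) = (r \<otimes> a) \<otimes> \<rho> u \<ominus> y \<otimes> (r \<otimes> g u)"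
        using a r yc rc[OF u] gc[OF u] by algebra
      then show "r \<odot>\<^bsub>?R\<^esub> l u = (r \<otimes> a) \<otimes> \<rho> u \<ominus> y \<otimes> (r \<odot>\<^bsub>?R\<^esub> g u)" using lg(5)[OF u] by simp
    qed
    then show "r \<otimes> a \<in> {c \<in> carrier R. good c}" using r a by simp
  qed auto
  moreover have "?G \<subseteq> {c \<in> carrier R. good c}" using gen Gc by blast
  ultimately have "?T \<subseteq> {c \<in> carrier R. good c}" unfolding trace_ideal_def by (rule genideal_minimal)
  then have "good c" using c by blast
  then show thesis using that unfolding good_def by blast
qed

text \<open>If the trace ideal is \<open>R\<close>, then \<open>\<rho>\<close> itself lifts modulo \<open>y\<close>.  Otherwise it lies in \<open>\<mm>\<close>, and lifting \<open>y \<rho>\<close>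
  modulo \<open>y \<mm>\<close> gives a multiple of \<open>y\<close>, whose quotient by \<open>y\<close> agrees with \<open>\<rho>\<close> modulo \<open>\<mm>\<close>.  In both cases
  \<open>X\<close> has a functional that takes a unit value.\<close>

lemma unit_functional_if_functional_mod:
  assumes tr: "y \<in> trace_ideal R W"
    and rho: "linear_map R F (regular_module R) \<rho>" "\<And>u. u \<in> K \<Longrightarrow> \<rho> u \<in> PIdl y"
    and e: "e \<in> carrier F" "\<rho> e \<notin> \<mm>"
  shows "\<exists>t\<in>Hom R X (regular_module R). \<exists>u\<in>carrier X. t u = \<one>"
proof -
  let ?R = "regular_module R"
  note Rm = regular_module_module
  interpret X: module R X by (rule Xm)
  have rc: "\<rho> u \<in> carrier R" if "u \<in> carrier F" for u using linear_mapD(1)[OF rho(1) that] by simp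
  have "(\<Union>f\<in>Hom R W ?R. f ` carrier W) \<subseteq> carrier R" using linear_mapD(1)[OF Hom_linear] by fastforce
  then have T: "ideal (trace_ideal R W) R" unfolding trace_ideal_def by (rule genideal_ideal)
  have perturb: "\<rho> e \<ominus> a \<notin> \<mm>" if a: "a \<in> \<mm>" for a
  proof
    assume "\<rho> e \<ominus> a \<in> \<mm>"
    then have "(\<rho> e \<ominus> a) \<oplus> a \<in> \<mm>" using a by (rule a_closed)
    moreover have "(\<rho> e \<ominus> a) \<oplus> a = \<rho> e" using rc[OF e(1)] Icarr[OF a] by algebra
    ultimately show False using e(2) by simp
  qed
  have "\<exists>t. linear_map R F ?R t \<and> (\<forall>u\<in>K. t u = \<zero>) \<and> t e \<notin> \<mm>"
  proof (cases "trace_ideal R W = carrier R")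
    case True
    then have one: "\<one> \<in> trace_ideal R W" by simp
    obtain l g where lg: "linear_map R F ?R l" "\<And>u. u \<in> K \<Longrightarrow> l u = \<zero>" "linear_map R F ?R g"
      "\<And>u. u \<in> carrier F \<Longrightarrow> l u = \<one> \<otimes> \<rho> u \<ominus> y \<otimes> g u"
      by (rule trace_multiple_lifts[OF rho one]) auto
    have "g e \<in> carrier R" using linear_mapD(1)[OF lg(3) e(1)] by simp
    then have "l e \<notin> \<mm>" using lg(4)[OF e(1)] perturb[of "y \<otimes> g e"] I_r_closed[OF y] rc[OF e(1)] by simp
    then show ?thesis using lg by blast
  next
    case False
    then have Tm: "trace_ideal R W \<subseteq> \<mm>" by (rule proper_ideal_subset[OF T])
    obtain l g where lg: "linear_map R F ?R l" "\<And>u. u \<in> K \<Longrightarrow> l u = \<zero>" "linear_map R F ?R g"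
      "\<And>u. u \<in> carrier F \<Longrightarrow> g u \<in> trace_ideal R W"
      "\<And>u. u \<in> carrier F \<Longrightarrow> l u = y \<otimes> \<rho> u \<ominus> y \<otimes> g u"
      by (rule trace_multiple_lifts[OF rho tr]) auto
    have "linear_map R F ?R (\<lambda>u. \<rho> u \<ominus>\<^bsub>?R\<^esub> g u)" by (rule linear_map_minus[OF Rm rho(1) lg(3)])
    moreover have "\<rho> u \<ominus>\<^bsub>?R\<^esub> g u = \<zero>" if u: "u \<in> K" for u
    proof -
      have uF: "u \<in> carrier F" using u Kc by auto
      have gc: "g u \<in> carrier R" using linear_mapD(1)[OF lg(3) uF] by simp
      have "y \<otimes> (\<rho> u \<ominus> g u) = y \<otimes> \<rho> u \<ominus> y \<otimes> g u" using yc rc[OF uF] gc by algebra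
      then have "y \<otimes> (\<rho> u \<ominus> g u) = \<zero>" using lg(5)[OF uF] lg(2)[OF u] by simp
      then show ?thesis using reg[of "\<rho> u \<ominus> g u"] rc[OF uF] gc by (simp add: regular_module_minus)
    qed
    moreover have "\<rho> e \<ominus>\<^bsub>?R\<^esub> g e \<notin> \<mm>"
      unfolding regular_module_minus using lg(4)[OF e(1)] Tm by (intro perturb) auto
    ultimately show ?thesis by blast
  qed
  then obtain t where t: "linear_map R F ?R t" "\<And>u. u \<in> K \<Longrightarrow> t u = \<zero>" "t e \<notin> \<mm>" by blast
  obtain t' where t': "linear_map R X ?R t'" "\<And>u. u \<in> carrier F \<Longrightarrow> t' (p u) = t u"
  proof (rule linear_map_factor[OF Fm Xm Rm p t(1)])
    show "t u = \<zero>\<^bsub>?R\<^esub>" if "u \<in> carrier F" "p u = \<zero>\<^bsub>X\<^esub>" for u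
      using t(2)[of u] that by (simp add: module_ker_def)
  qed auto
  have tec: "t e \<in> carrier R" using linear_mapD(1)[OF t(1) e(1)] by simp
  then have u: "t e \<in> Units R" using t(3) by (rule unit_if_not_mem)
  have pe: "p e \<in> carrier X" by (rule linear_mapD(1)[OF p(1) e(1)])
  have "t' (inv (t e) \<odot>\<^bsub>X\<^esub> p e) = \<one>"
    using linear_mapD(3)[OF t'(1) Units_inv_closed[OF u] pe] t'(2)[OF e(1)] u by simp
  then show ?thesis
    using u pe by (intro bexI[OF _ linear_restrict_Hom[OF Xm t'(1)]] bexI[of _ "inv (t e) \<odot>\<^bsub>X\<^esub> p e"]) simp_all
qed

end

section \<open>Depth one and the \<open>\<delta>\<close>-invariant of cyclic modules\<close>

context cring
begin

lemma coset_regular: "I +>\<^bsub>regular_module R\<^esub> a = I +> a"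
  by (simp add: a_r_coset_def r_coset_def)

lemma mem_coset_iff:
  assumes "ideal I R" "a \<in> carrier R"
  shows "c \<in> I +> a \<longleftrightarrow> c \<in> carrier R \<and> c \<ominus> a \<in> I"
proof
  assume "c \<in> I +> a"
  then obtain i where i: "i \<in> I" "c = i \<oplus> a" by (auto simp: a_r_coset_def r_coset_def)
  have ic: "i \<in> carrier R" by (rule ideal.Icarr[OF assms(1) i(1)])
  have "c \<ominus> a = i" unfolding i(2) using ic assms(2) by algebra
  then show "c \<in> carrier R \<and> c \<ominus> a \<in> I" using i ic assms(2) by simp
next
  assume c: "c \<in> carrier R \<and> c \<ominus> a \<in> I"
  then have "c = (c \<ominus> a) \<oplus> a" using assms(2) by algebra
  then show "c \<in> I +> a" using c by (auto simp: a_r_coset_def r_coset_def)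
qed

lemma coset_eq_iff:
  "ideal I R \<Longrightarrow> a \<in> carrier R \<Longrightarrow> b \<in> carrier R \<Longrightarrow> I +> a = I +> b \<longleftrightarrow> a \<ominus> b \<in> I"
  using quotient_eq_iff_same_a_r_cos by simp

lemma coset_zero: "ideal I R \<Longrightarrow> I +> \<zero> = I"
  using ideal.Icarr[of I R] by (force simp: a_r_coset_def r_coset_def)

lemma quotient_regular_simps:
  assumes "ideal I R"
  shows "carrier (quotient_module (regular_module R) I) = (\<lambda>a. I +> a) ` carrier R"
    "\<zero>\<^bsub>quotient_module (regular_module R) I\<^esub> = I"
    "a \<in> carrier R \<Longrightarrow> b \<in> carrier R \<Longrightarrow>
      (I +> a) \<oplus>\<^bsub>quotient_module (regular_module R) I\<^esub> (I +> b) = I +> (a \<oplus> b)"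
    "r \<in> carrier R \<Longrightarrow> a \<in> carrier R \<Longrightarrow>
      r \<odot>\<^bsub>quotient_module (regular_module R) I\<^esub> (I +> a) = I +> (r \<otimes> a)"
proof -
  interpret I: ideal I R by fact
  have "a_rcosets\<^bsub>regular_module R\<^esub> I = (\<lambda>a. I +> a) ` carrier R"
    by (auto simp: A_RCOSETS_def RCOSETS_def a_r_coset_def r_coset_def)
  then show "carrier (quotient_module (regular_module R) I) = (\<lambda>a. I +> a) ` carrier R"
    by (simp add: quotient_module_def)
  show "\<zero>\<^bsub>quotient_module (regular_module R) I\<^esub> = I" by (simp add: quotient_module_def)
  have "A <+>\<^bsub>regular_module R\<^esub> B = A <+>\<^bsub>R\<^esub> B" for A B
    by (simp add: set_add_def set_mult_def)
  then show "(I +> a) \<oplus>\<^bsub>quotient_module (regular_module R) I\<^esub> (I +> b) = I +> (a \<oplus> b)"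
    if "a \<in> carrier R" "b \<in> carrier R" using I.a_rcos_sum[OF that] by (simp add: quotient_module_def)
  assume r: "r \<in> carrier R" and a: "a \<in> carrier R"
  have "I +> (r \<otimes> c) = I +> (r \<otimes> a)" if "c \<in> I +> a" for c
  proof -
    have c: "c \<in> carrier R" "c \<ominus> a \<in> I" using that mem_coset_iff[OF assms a] by auto
    have "r \<otimes> c \<ominus> r \<otimes> a = r \<otimes> (c \<ominus> a)" using r a c by algebra
    then show ?thesis using I.I_l_closed[OF c(2) r] r a c by (simp add: coset_eq_iff[OF assms])
  qed
  moreover have "a \<in> I +> a"
    using mem_coset_iff[OF assms a] a I.zero_closed by (simp add: a_minus_def r_neg)
  ultimately have "(\<Union>c\<in>I +> a. I +> (r \<otimes> c)) = I +> (r \<otimes> a)" by blast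
  then show "r \<odot>\<^bsub>quotient_module (regular_module R) I\<^esub> (I +> a) = I +> (r \<otimes> a)"
    by (simp add: quotient_module_def coset_regular)
qed

lemma quotient_regular_module:
  assumes "ideal I R"
  shows "module R (quotient_module (regular_module R) I)"
proof -
  note Q = quotient_regular_simps[OF assms]
  let ?Q = "quotient_module (regular_module R) I"
  have zero: "\<zero>\<^bsub>?Q\<^esub> = I +> \<zero>" using Q(2) coset_zero[OF assms] by simp
  show ?thesis
  proof (rule moduleI[OF is_cring])
    show "abelian_group ?Q"
    proof (rule abelian_groupI)
      fix u assume "u \<in> carrier ?Q"
      then obtain a where "a \<in> carrier R" "u = I +> a" unfolding Q(1) by blast
      then show "\<exists>v\<in>carrier ?Q. v \<oplus>\<^bsub>?Q\<^esub> u = \<zero>\<^bsub>?Q\<^esub>"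
        unfolding zero by (intro bexI[of _ "I +> (\<ominus> a)"]) (auto simp: Q(1,3) l_neg)
    qed (auto simp: Q(1,3) zero a_ac)
  qed (auto simp: Q(1,3,4) l_distr r_distr m_assoc)
qed

lemma coset_map_linear:
  "ideal I R \<Longrightarrow> linear_map R (regular_module R) (quotient_module (regular_module R) I) (\<lambda>a. I +> a)"
  by (intro linear_mapI) (auto simp: quotient_regular_simps)

end

lemma span_empty:
  assumes "module R M"
  shows "span_module R M {} = {\<zero>\<^bsub>M\<^esub>}"
proof -
  interpret M: module R M by fact
  have "submodule {\<zero>\<^bsub>M\<^esub>} R M" by (rule M.submoduleI') auto
  then show ?thesis
    using span_minimal[of "{\<zero>\<^bsub>M\<^esub>}" R M "{}"] M.submodule_zero[OF span_submodule[OF assms, of "{}"]] by auto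
qed

lemma set_smult_empty: "module R M \<Longrightarrow> set_smult R {} M = {\<zero>\<^bsub>M\<^esub>}"
  by (simp add: set_smult_def span_empty)

lemma set_smult_mono: "A \<subseteq> B \<Longrightarrow> set_smult R A M \<subseteq> set_smult R B M"
  unfolding set_smult_def span_module_def by blast

lemma exists_regular_if_depth_pos:
  assumes X: "module R X" and depth: "depth R \<mm> X \<noteq> 0"
  shows "\<exists>a\<in>\<mm>. \<forall>u\<in>carrier X. a \<odot>\<^bsub>X\<^esub> u = \<zero>\<^bsub>X\<^esub> \<longrightarrow> u = \<zero>\<^bsub>X\<^esub>"
proof -
  have "\<exists>xs. set xs \<subseteq> \<mm> \<and> regular_sequence R X xs \<and> length xs \<noteq> 0"
  proof (rule ccontr)
    assume "\<not> ?thesis"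
    then have "depth R \<mm> X \<le> 0"
      unfolding depth_def by (intro Sup_least) (auto simp: zero_enat_def)
    then show False using depth by simp
  qed
  then obtain xs where xs: "set xs \<subseteq> \<mm>" "regular_sequence R X xs" "0 < length xs" by blast
  have "u = \<zero>\<^bsub>X\<^esub>" if "u \<in> carrier X" "xs ! 0 \<odot>\<^bsub>X\<^esub> u = \<zero>\<^bsub>X\<^esub>" for u
    using xs(2,3) that set_smult_empty[OF X] unfolding regular_sequence_def by force
  then show ?thesis using xs(1,3) nth_mem by blast
qed

context noetherian_local_ring
begin

text \<open>If every regular element generates an \<open>\<mm>\<close>-primary ideal, then a second element \<open>b\<close> of a regular sequence
  would have a power in the ideal of the first one \<open>a\<close>, which forces \<open>X = aX\<close>.\<close>

lemma depth_eq_1: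
  assumes X: "module R X" and x: "x \<in> \<mm>"
    and xreg: "\<And>u. u \<in> carrier X \<Longrightarrow> x \<odot>\<^bsub>X\<^esub> u = \<zero>\<^bsub>X\<^esub> \<Longrightarrow> u = \<zero>\<^bsub>X\<^esub>"
    and xX: "(\<lambda>u. x \<odot>\<^bsub>X\<^esub> u) ` carrier X \<noteq> carrier X"
    and prim: "\<And>a. a \<in> \<mm> \<Longrightarrow> (\<And>u. u \<in> carrier X \<Longrightarrow> a \<odot>\<^bsub>X\<^esub> u = \<zero>\<^bsub>X\<^esub> \<Longrightarrow> u = \<zero>\<^bsub>X\<^esub>) \<Longrightarrow>
      \<exists>k. ideal_power R \<mm> k \<subseteq> PIdl a"
  shows "depth R \<mm> X = 1"
proof -
  interpret X: module R X by (rule X)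
  have xc: "x \<in> carrier R" using x by (rule Icarr)
  have xmap: "linear_map R X X (\<lambda>u. x \<odot>\<^bsub>X\<^esub> u)"
    by (rule linear_map_smult[OF X _ xc]) (simp add: linear_map_def)
  have "submodule ((\<lambda>u. x \<odot>\<^bsub>X\<^esub> u) ` carrier X) R X"
    by (rule image_submodule[OF X X xmap X.carrier_is_submodule])
  then have "set_smult R {x} X \<subseteq> (\<lambda>u. x \<odot>\<^bsub>X\<^esub> u) ` carrier X"
    unfolding set_smult_def by (rule span_minimal) auto
  then have "set_smult R {x} X \<noteq> carrier X" using xX xc by auto
  then have "regular_sequence R X [x]"
    unfolding regular_sequence_def using xc xreg set_smult_empty[OF X] by auto
  then have lower: "1 \<le> depth R \<mm> X"
    unfolding depth_def using x by (intro Sup_upper) (auto simp: one_enat_def intro!: exI[of _ "[x]"])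
  have "length xs \<le> 1" if xs: "set xs \<subseteq> \<mm>" "regular_sequence R X xs" for xs
  proof (rule ccontr)
    assume "\<not> length xs \<le> 1"
    then obtain a b ys where ab: "xs = a # b # ys" by (cases xs; cases "tl xs") auto
    have am: "a \<in> \<mm>" and bm: "b \<in> \<mm>" using xs(1) ab by auto
    note ac = Icarr[OF am] and bc = Icarr[OF bm]
    let ?A = "set_smult R {a} X"
    have reg: "xs ! i \<odot>\<^bsub>X\<^esub> u \<in> set_smult R (set (take i xs)) X \<Longrightarrow> u \<in> set_smult R (set (take i xs)) X"
      if "i < length xs" "u \<in> carrier X" for i u
      using xs(2) that unfolding regular_sequence_def by blast
    have areg: "u = \<zero>\<^bsub>X\<^esub>" if "u \<in> carrier X" "a \<odot>\<^bsub>X\<^esub> u = \<zero>\<^bsub>X\<^esub>" for u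
      using reg[of 0 u] that ab set_smult_empty[OF X] by simp
    have breg: "u \<in> ?A" if "u \<in> carrier X" "b \<odot>\<^bsub>X\<^esub> u \<in> ?A" for u
      using reg[of 1 u] that ab by simp
    obtain k where k: "ideal_power R \<mm> k \<subseteq> PIdl a" using prim[OF am areg] by blast
    have pow: "b [^] (j::nat) \<in> ideal_power R \<mm> j" for j
      by (rule pow_mem_ideal_power[OF bm])
    obtain r where r: "r \<in> carrier R" "b [^] k = r \<otimes> a" using pow[of k] k by (auto simp: cgenideal_def)
    have all: "u \<in> ?A" if u: "u \<in> carrier X" for u
    proof -
      have "b [^] k \<odot>\<^bsub>X\<^esub> u = a \<odot>\<^bsub>X\<^esub> (r \<odot>\<^bsub>X\<^esub> u)"
        using r u ac by (simp add: X.smult_assoc1 X.smult_commute)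
      moreover have "a \<odot>\<^bsub>X\<^esub> (r \<odot>\<^bsub>X\<^esub> u) \<in> {q \<odot>\<^bsub>X\<^esub> w |q w. q \<in> {a} \<and> w \<in> carrier X}" using r u by blast
      then have "a \<odot>\<^bsub>X\<^esub> (r \<odot>\<^bsub>X\<^esub> u) \<in> ?A"
        unfolding set_smult_def by (rule subsetD[OF span_superset])
      ultimately have "b [^] k \<odot>\<^bsub>X\<^esub> u \<in> ?A" by simp
      then show ?thesis using u
      proof (induction k arbitrary: u)
        case (Suc k)
        have "b [^] k \<odot>\<^bsub>X\<^esub> (b \<odot>\<^bsub>X\<^esub> u) \<in> ?A"
          using Suc.prems bc by (simp add: X.smult_assoc1)
        then have "b \<odot>\<^bsub>X\<^esub> u \<in> ?A" using Suc.IH[of "b \<odot>\<^bsub>X\<^esub> u"] Suc.prems(2) bc by simp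
        then show ?case using breg[OF Suc.prems(2)] by simp
      qed simp
    qed
    have "submodule (set_smult R (set xs) X) R X"
      unfolding set_smult_def using xs(1) Icarr by (intro span_submodule[OF X]) auto
    then have "set_smult R (set xs) X \<subseteq> carrier X" by (rule X.submoduleE(1))
    moreover have "carrier X \<subseteq> set_smult R (set xs) X"
      using all set_smult_mono[of "{a}" "set xs" R X] ab by auto
    ultimately show False using xs(2) unfolding regular_sequence_def by auto
  qed
  then have "depth R \<mm> X \<le> 1"
    unfolding depth_def by (intro Sup_least) (auto simp: one_enat_def)
  then show ?thesis using lower by simp
qed

text \<open>\<open>\<delta>(M)\<close> is the least \<open>n\<close> with this property.\<close>

definition covered :: "('a, 'c) module \<Rightarrow> nat \<Rightarrow> bool" where
  "covered M n \<longleftrightarrow> (\<exists>X :: 'a rmod. MCM R \<mm> X \<and> \<not> has_free_summand R X \<and>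
     (\<exists>f\<in>Hom R (direct_sum X (free_module R n)) M.
        f ` carrier (direct_sum X (free_module R n)) = carrier M))"

lemma delta_eq_1_iff:
  assumes "covered M 1"
  shows "delta R \<mm> M = 1 \<longleftrightarrow> \<not> covered M 0"
proof -
  have "delta R \<mm> M = (LEAST n. covered M n)" by (simp add: delta_def covered_def)
  moreover have "(LEAST n. covered M n) \<le> 1" by (rule Least_le[of "covered M", OF assms])
  moreover have "(LEAST n. covered M n) = 0 \<longleftrightarrow> covered M 0"
    using LeastI[of "covered M", OF assms] Least_le[of "covered M" 0] by auto
  ultimately show ?thesis by auto
qed

lemma free_module_0: "carrier (free_module R 0) = {\<lambda>_. undefined}"
  by simp

lemma covered_0_iff:
  "covered M 0 \<longleftrightarrow> (\<exists>X :: 'a rmod. MCM R \<mm> X \<and> \<not> has_free_summand R X \<and>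
     (\<exists>f. linear_map R X M f \<and> f ` carrier X = carrier M))"
proof -
  have "(\<exists>f\<in>Hom R (direct_sum X (free_module R 0)) M. f ` carrier (direct_sum X (free_module R 0)) = carrier M)
      \<longleftrightarrow> (\<exists>f. linear_map R X M f \<and> f ` carrier X = carrier M)" if "MCM R \<mm> X" for X :: "'a rmod"
  proof
    have Xm: "module R X" using that by (auto simp: MCM_def fg_module_def)
    let ?D = "direct_sum X (free_module R 0)"
    have D: "module R ?D" by (rule direct_sum_module[OF Xm free_module_module])
    have cD: "carrier ?D = (\<lambda>u. (u, \<lambda>_. undefined)) ` carrier X"
      unfolding direct_sum_simps(1) free_module_0 by blast
    { assume "\<exists>f\<in>Hom R ?D M. f ` carrier ?D = carrier M"
      then obtain f where f: "f \<in> Hom R ?D M" "f ` carrier ?D = carrier M" by blast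
      have "linear_map R X ?D (\<lambda>u. (u, \<lambda>_. undefined))"
        by (intro linear_mapI) (simp_all add: restrict_def)
      from linear_map_comp[OF this Hom_linear[OF f(1)]]
      have "linear_map R X M (\<lambda>u. f (u, \<lambda>_. undefined))" .
      moreover have "(\<lambda>u. f (u, \<lambda>_. undefined)) ` carrier X = carrier M"
        using f(2) unfolding cD image_image .
      ultimately show "\<exists>f. linear_map R X M f \<and> f ` carrier X = carrier M" by blast }
    { assume "\<exists>f. linear_map R X M f \<and> f ` carrier X = carrier M"
      then obtain f where f: "linear_map R X M f" "f ` carrier X = carrier M" by blast
      have "linear_map R ?D X fst" by (auto simp: linear_map_def)
      from linear_restrict_Hom[OF D linear_map_comp[OF this f(1)]]
      have "restrict (\<lambda>z. f (fst z)) (carrier ?D) \<in> Hom R ?D M" .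
      moreover have "restrict (\<lambda>z. f (fst z)) (carrier ?D) ` carrier ?D = carrier M"
      proof -
        have "(\<lambda>z. f (fst z)) ` carrier ?D = f ` carrier X" unfolding cD image_image fst_conv ..
        then show ?thesis using f(2) by (simp only: image_restrict_eq)
      qed
      ultimately show "\<exists>f\<in>Hom R ?D M. f ` carrier ?D = carrier M" by blast }
  qed
  then show ?thesis unfolding covered_def by (intro iff_exI conj_cong refl)
qed

text \<open>The module \<open>R\<close> itself maps onto \<open>R/I\<close>, so that one can take \<open>X = 0\<close>.\<close>

lemma covered_1_cyclic:
  assumes I: "ideal I R"
  shows "covered (quotient_module (regular_module R) I) 1"
proof -
  define X :: "'a rmod" where "X = mk_module {{}} {} (\<lambda>_ _. {}) (\<lambda>_ _. {})"
  have Xm: "module R X" unfolding X_def by (rule module_mk_moduleI) (auto simp: is_cring)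
  have "span_module R X {} = carrier X" using span_empty[OF Xm] by (simp add: X_def)
  then have "MCM R \<mm> X" using Xm by (auto simp: MCM_def fg_module_def X_def)
  moreover have "\<not> has_free_summand R X"
  proof
    assume "has_free_summand R X"
    then obtain t e where t: "linear_map R X (regular_module R) t" "e \<in> carrier X" "t e = \<one>"
      using functional_if_has_free_summand[OF Xm] by blast
    have "e = \<zero>\<^bsub>X\<^esub>" using t(2) by (simp add: X_def)
    then have "\<one> = \<zero>" using linear_zero[OF Xm regular_module_module t(1)] t(3) by simp
    then show False using m_proper zero_closed by simp
  qed
  moreover let ?D = "direct_sum X (free_module R 1)" and ?Q = "quotient_module (regular_module R) I"
  have D: "module R ?D" by (rule direct_sum_module[OF Xm free_module_module])
  have snd0: "linear_map R ?D (regular_module R) (\<lambda>z. snd z 0)"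
  proof (rule linear_mapI)
    fix z assume "z \<in> carrier ?D"
    then have "snd z \<in> {..<1} \<rightarrow>\<^sub>E carrier R" unfolding direct_sum_simps mem_Times_iff by simp
    from PiE_mem[OF this, of 0] show "snd z 0 \<in> carrier (regular_module R)" by simp
  qed simp_all
  from linear_restrict_Hom[OF D linear_map_comp[OF snd0 coset_map_linear[OF I]]]
  have "restrict (\<lambda>z. I +> snd z 0) (carrier ?D) \<in> Hom R ?D ?Q" .
  moreover have "restrict (\<lambda>z. I +> snd z 0) (carrier ?D) ` carrier ?D = carrier ?Q"
  proof -
    have "(\<lambda>z. snd z 0) ` carrier ?D = carrier R"
    proof (intro equalityI subsetI)
      fix r assume "r \<in> carrier R"
      then show "r \<in> (\<lambda>z. snd z 0) ` carrier ?D"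
        by (intro image_eqI[of _ _ "({}, \<lambda>i\<in>{..<1}. r)"]) (simp_all add: X_def)
    next
      fix r assume "r \<in> (\<lambda>z. snd z 0) ` carrier ?D"
      then show "r \<in> carrier R" using linear_mapD(1)[OF snd0] by auto
    qed
    then show ?thesis unfolding quotient_regular_simps(1)[OF I] image_restrict_eq
      by (metis image_image)
  qed
  ultimately show ?thesis unfolding covered_def by blast
qed

text \<open>A map from a maximal Cohen-Macaulay module \<open>X\<close> onto \<open>R/I\<close> gives a functional modulo \<open>y\<close> on \<open>X\<close> with a unit value.
  It produces a functional on \<open>X\<close> with value one, and hence a free summand.\<close>

lemma not_covered_0_if_subset_parameter:
  fixes W :: "('a, 'w) module"
  assumes dim: "krull_dim R = 1" and depth: "depth R \<mm> (regular_module R) = 1"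
    and W: "fg_module R W" and fid: "finite_injective_dim R W" and tr: "\<mm> \<subseteq> trace_ideal R W"
    and y: "y \<in> \<mm>" and k: "ideal_power R \<mm> k \<subseteq> PIdl y" and I: "ideal I R" "I \<subseteq> PIdl y"
  shows "\<not> covered (quotient_module (regular_module R) I) 0"
proof
  let ?Q = "quotient_module (regular_module R) I"
  have yc: "y \<in> carrier R" using y by (rule Icarr)
  \<comment> \<open>a power of any \<open>a \<in> \<mm>\<close> is a multiple of \<open>y\<close>, so \<open>y\<close> is regular on every module with a regular \<open>a\<close>\<close>
  have y_regular: "u = \<zero>\<^bsub>M\<^esub>"
    if M: "module R M" and dM: "depth R \<mm> M = 1" and u: "u \<in> carrier M" "y \<odot>\<^bsub>M\<^esub> u = \<zero>\<^bsub>M\<^esub>"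
    for M :: "('a, 'd) module" and u
  proof -
    interpret M: module R M by (rule M)
    obtain a where a: "a \<in> \<mm>" "\<And>u. u \<in> carrier M \<Longrightarrow> a \<odot>\<^bsub>M\<^esub> u = \<zero>\<^bsub>M\<^esub> \<Longrightarrow> u = \<zero>\<^bsub>M\<^esub>"
      using exists_regular_if_depth_pos[OF M, of \<mm>] dM by auto
    have ac: "a \<in> carrier R" by (rule Icarr[OF a(1)])
    have pow: "a [^] (j::nat) \<in> ideal_power R \<mm> j" for j
      by (rule pow_mem_ideal_power[OF a(1)])
    obtain r where r: "r \<in> carrier R" "a [^] k = r \<otimes> y" using pow[of k] k by (auto simp: cgenideal_def)
    have "a [^] k \<odot>\<^bsub>M\<^esub> u = \<zero>\<^bsub>M\<^esub>" using r yc u by (simp add: M.smult_assoc1)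
    then show ?thesis
    proof (induction k)
      case 0
      then show ?case using u(1) by simp
    next
      case (Suc k)
      have "a \<odot>\<^bsub>M\<^esub> (a [^] k \<odot>\<^bsub>M\<^esub> u) = a [^] Suc k \<odot>\<^bsub>M\<^esub> u"
        using ac u(1) by (simp add: M.smult_assoc1[symmetric] m_comm)
      then have "a [^] k \<odot>\<^bsub>M\<^esub> u = \<zero>\<^bsub>M\<^esub>" using Suc.prems a(2) ac u(1) by simp
      then show ?case by (rule Suc.IH)
    qed
  qed
  have reg: "r = \<zero>" if "r \<in> carrier R" "y \<otimes> r = \<zero>" for r
    using y_regular[OF regular_module_module depth, of r] that by simp
  assume "covered ?Q 0"
  then obtain X :: "'a rmod" and q where X: "MCM R \<mm> X" "\<not> has_free_summand R X"
    and q: "linear_map R X ?Q q" "q ` carrier X = carrier ?Q" unfolding covered_0_iff by blast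
  have fg: "fg_module R X" using X(1) by (simp add: MCM_def)
  have Xm: "module R X" using fg by (simp add: fg_module_def)
  interpret X: module R X by (rule Xm)
  have Qm: "module R ?Q" by (rule quotient_regular_module[OF I(1)])
  have "PIdl y \<subseteq> \<mm>" by (rule cgenideal_minimal[OF m_ideal y])
  then have Im: "I \<subseteq> \<mm>" using I(2) by auto
  have one: "I +> \<one> \<in> carrier ?Q" by (simp add: quotient_regular_simps(1)[OF I(1)])
  have "carrier X \<noteq> {\<zero>\<^bsub>X\<^esub>}"
  proof
    assume "carrier X = {\<zero>\<^bsub>X\<^esub>}"
    then have "carrier ?Q = {I}" using q(2) linear_zero[OF Xm Qm q(1)] by (simp add: quotient_regular_simps(2)[OF I(1)])
    then have "I +> \<one> = I +> \<zero>" using one coset_zero[OF I(1)] by simp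
    then have "\<one> \<ominus> \<zero> \<in> I" using coset_eq_iff[OF I(1)] by simp
    then show False using Im m_proper by (auto simp: a_minus_def)
  qed
  then have "depth R \<mm> X = 1" using X(1) dim by (simp add: MCM_def)
  then have Xreg: "u = \<zero>\<^bsub>X\<^esub>" if "u \<in> carrier X" "y \<odot>\<^bsub>X\<^esub> u = \<zero>\<^bsub>X\<^esub>" for u
    using y_regular[OF Xm _ that] by simp
  obtain m v where v: "\<And>i. i < m \<Longrightarrow> v i \<in> carrier X"
    "free_map X m v ` carrier (free_module R m) = carrier X"
    using fg_module_free_cover[OF fg] by metis
  let ?F = "free_module R m" and ?p = "free_map X m v"
  have p: "linear_map R ?F X ?p" by (rule free_map_linear[OF Xm v(1)])
  have qp: "linear_map R ?F ?Q (\<lambda>u. q (?p u))" by (rule linear_map_comp[OF p q(1)])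
  obtain \<rho> where rho: "linear_map R ?F (regular_module R) \<rho>"
    "\<And>u. u \<in> carrier ?F \<Longrightarrow> I +> \<rho> u = q (?p u)"
  proof (rule free_module_projective[OF regular_module_module Qm coset_map_linear[OF I(1)] qp])
    show "q (?p u) \<in> (\<lambda>a. I +> a) ` carrier (regular_module R)" if "u \<in> carrier ?F" for u
      using linear_mapD(1)[OF qp that] by (simp add: quotient_regular_simps(1)[OF I(1)])
  qed auto
  have rc: "\<rho> u \<in> carrier R" if "u \<in> carrier ?F" for u using linear_mapD(1)[OF rho(1) that] by simp
  have rhoK: "\<rho> u \<in> PIdl y" if "u \<in> module_ker ?F X ?p" for u
  proof -
    have u: "u \<in> carrier ?F" "?p u = \<zero>\<^bsub>X\<^esub>" using that by (auto simp: module_ker_def)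
    have "I +> \<rho> u = I +> \<zero>"
      using rho(2)[OF u(1)] u(2) linear_zero[OF Xm Qm q(1)] coset_zero[OF I(1)]
      by (simp add: quotient_regular_simps(2)[OF I(1)])
    then have "\<rho> u \<ominus> \<zero> \<in> I" using coset_eq_iff[OF I(1) rc[OF u(1)]] by simp
    then show ?thesis using I(2) rc[OF u(1)] by (auto simp: a_minus_def)
  qed
  have "I +> \<one> \<in> (\<lambda>u. q (?p u)) ` carrier ?F" using one q(2) v(2) by (metis image_image)
  then obtain e where e: "e \<in> carrier ?F" "I +> \<one> = q (?p e)" by blast
  have "I +> \<one> = I +> \<rho> e" using e rho(2) by simp
  then have diff: "\<one> \<ominus> \<rho> e \<in> \<mm>" using coset_eq_iff[OF I(1) one_closed rc[OF e(1)]] Im by auto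
  have rho_e: "\<rho> e \<notin> \<mm>"
  proof
    assume "\<rho> e \<in> \<mm>"
    then have "(\<one> \<ominus> \<rho> e) \<oplus> \<rho> e \<in> \<mm>" by (rule a_closed[OF diff])
    moreover have "(\<one> \<ominus> \<rho> e) \<oplus> \<rho> e = \<one>" using rc[OF e(1)] by algebra
    ultimately show False using m_proper by simp
  qed
  interpret PM: presented_module R \<mm> y k W X m ?p
    by unfold_locales (fact y reg k W fid fg Xreg p v(2))+
  obtain t u where "t \<in> Hom R X (regular_module R)" "u \<in> carrier X" "t u = \<one>"
    using PM.unit_functional_if_functional_mod[OF subsetD[OF tr y] rho(1) rhoK e(1) rho_e] by auto
  then have "has_free_summand R X" by (intro has_free_summand_if_functional[OF Xm Hom_linear])
  then show False using X(2) by simp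
qed

end

section \<open>Initial forms\<close>

\<comment> \<open>powers of \<open>\<mm>\<close> are to stay folded\<close>
declare Group.nat_pow_Suc [simp del]

context noetherian_local_ring
begin

lemma gr_product_coset:
  assumes c: "c \<in> ideal_power R \<mm> i" and d: "d \<in> ideal_power R \<mm> j"
  shows "gr_product R \<mm> i j (ideal_power R \<mm> (Suc i) +> c) (ideal_power R \<mm> (Suc j) +> d)
    = ideal_power R \<mm> (Suc (i + j)) +> (c \<otimes> d)"
proof -
  note P = ideal_power_ideal[OF m_ideal]
  note car = ideal.Icarr[OF P]
  have cc: "c \<in> carrier R" and dc: "d \<in> carrier R" using car[OF c] car[OF d] .
  have eq: "ideal_power R \<mm> (Suc (i + j)) +> (c' \<otimes> d') = ideal_power R \<mm> (Suc (i + j)) +> (c \<otimes> d)"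
    if "c' \<in> ideal_power R \<mm> (Suc i) +> c" "d' \<in> ideal_power R \<mm> (Suc j) +> d" for c' d'
  proof -
    have c': "c' \<in> carrier R" "c' \<ominus> c \<in> ideal_power R \<mm> (Suc i)"
      using that(1) unfolding mem_coset_iff[OF P cc] by auto
    have d': "d' \<in> carrier R" "d' \<ominus> d \<in> ideal_power R \<mm> (Suc j)"
      using that(2) unfolding mem_coset_iff[OF P dc] by auto
    have "d' \<ominus> d \<in> ideal_power R \<mm> j"
      using d'(2) ideal_power_antimono[OF m_ideal, of j "Suc j"] by auto
    then have "(d' \<ominus> d) \<oplus> d \<in> ideal_power R \<mm> j"
      using d by (intro additive_subgroup.a_closed[OF ideal.axioms(1)[OF P]])
    moreover have "(d' \<ominus> d) \<oplus> d = d'" using d'(1) dc by algebra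
    ultimately have "(c' \<ominus> c) \<otimes> d' \<in> ideal_power R \<mm> (Suc i + j)"
      using ideal_power_mult_mem[OF m_ideal c'(2)] by simp
    moreover have "c \<otimes> (d' \<ominus> d) \<in> ideal_power R \<mm> (i + Suc j)"
      by (rule ideal_power_mult_mem[OF m_ideal c d'(2)])
    ultimately have "(c' \<ominus> c) \<otimes> d' \<oplus> c \<otimes> (d' \<ominus> d) \<in> ideal_power R \<mm> (Suc (i + j))"
      unfolding add_Suc add_Suc_right by (rule additive_subgroup.a_closed[OF ideal.axioms(1)[OF P]])
    moreover have "(c' \<ominus> c) \<otimes> d' \<oplus> c \<otimes> (d' \<ominus> d) = c' \<otimes> d' \<ominus> c \<otimes> d"
      using c'(1) d'(1) cc dc by algebra
    ultimately have "c' \<otimes> d' \<ominus> c \<otimes> d \<in> ideal_power R \<mm> (Suc (i + j))" by (simp only:)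
    then show ?thesis
      using coset_eq_iff[OF P m_closed[OF c'(1) d'(1)] m_closed[OF cc dc]] by simp
  qed
  have self: "a \<in> ideal_power R \<mm> n +> a" if "a \<in> carrier R" for a n
    unfolding mem_coset_iff[OF P that]
    using that additive_subgroup.zero_closed[OF ideal.axioms(1)[OF P]] by (simp add: a_minus_def r_neg)
  show ?thesis
    unfolding gr_product_def 
  proof (intro SUP_eq_const eq)
    show "ideal_power R \<mm> (Suc i) +> c \<noteq> {}" "ideal_power R \<mm> (Suc j) +> d \<noteq> {}"
      using self[OF cc, of "Suc i"] self[OF dc, of "Suc j"] by (simp_all only: ex_in_conv[symmetric]) (rule exI, assumption)+
  qed
qed

lemma initial_form_coset:
  "initial_form R \<mm> t x = (\<lambda>i. ideal_power R \<mm> (Suc i) +> (if i = t then x else \<zero>))"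
  using coset_zero[OF ideal_power_ideal[OF m_ideal]]
  by (simp add: initial_form_def fun_eq_iff)

text \<open>The product of the initial forms of \<open>x\<close> and \<open>r\<close> vanishes, because its only nonzero component could be the
  class of \<open>x r\<close> in degree \<open>t + i\<close>.\<close>

lemma regular_initial_form_cancel:
  assumes x: "x \<in> ideal_power R \<mm> t" and reg: "regular_element (gr_ring R \<mm>) (initial_form R \<mm> t x)"
    and r: "r \<in> ideal_power R \<mm> i" and xr: "x \<otimes> r \<in> ideal_power R \<mm> (Suc (t + i))"
  shows "r \<in> ideal_power R \<mm> (Suc i)"
proof -
  note P = ideal_power_ideal[OF m_ideal]
  note car = ideal.Icarr[OF P]
  have xc: "x \<in> carrier R" and rc: "r \<in> carrier R" using car[OF x] car[OF r] .
  let ?x = "\<lambda>j. if j = t then x else \<zero>" and ?r = "\<lambda>j. if j = i then r else \<zero>"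
  let ?b = "initial_form R \<mm> i r"
  have zm: "\<zero> \<in> ideal_power R \<mm> j" for j by (rule additive_subgroup.zero_closed[OF ideal.axioms(1)[OF P]])
  have xm: "?x j \<in> ideal_power R \<mm> j" and rm: "?r j \<in> ideal_power R \<mm> j" for j using x r zm by auto
  have "?b \<in> carrier (gr_ring R \<mm>)"
  proof -
    have "?b j \<in> gr_component R \<mm> j" for j unfolding initial_form_coset gr_component_def using rm by blast
    moreover have "finite {j. ?b j \<noteq> ideal_power R \<mm> (Suc j)}"
      by (rule finite_subset[of _ "{i}"]) (auto simp: initial_form_def)
    ultimately show ?thesis by (simp add: gr_ring_def)
  qed
  moreover have "initial_form R \<mm> t x \<otimes>\<^bsub>gr_ring R \<mm>\<^esub> ?b = \<zero>\<^bsub>gr_ring R \<mm>\<^esub>"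
  proof -
    have "(\<Oplus>\<^bsub>R Quot ideal_power R \<mm> (Suc n)\<^esub>j\<in>{..n}.
        gr_product R \<mm> j (n - j) (initial_form R \<mm> t x j) (?b (n - j))) = ideal_power R \<mm> (Suc n)" for n
    proof -
      interpret Q: ring "R Quot ideal_power R \<mm> (Suc n)" by (rule ideal.quotient_is_ring[OF P])
      have z: "\<zero>\<^bsub>R Quot ideal_power R \<mm> (Suc n)\<^esub> = ideal_power R \<mm> (Suc n)" by (simp add: FactRing_def)
      have "gr_product R \<mm> j (n - j) (initial_form R \<mm> t x j) (?b (n - j)) = \<zero>\<^bsub>R Quot ideal_power R \<mm> (Suc n)\<^esub>"
        if "j \<in> {..n}" for j
      proof -
        have n: "j + (n - j) = n" using that by simp
        have mem: "?x j \<otimes> ?r (n - j) \<in> ideal_power R \<mm> (Suc n)"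
        proof (cases "j = t \<and> n - j = i")
          case True
          then have nti: "t + i = n" using n by metis
          have "j = t" "n - t = i" using True by auto
          then show ?thesis using xr unfolding nti by simp
        next
          case False
          then have "?x j \<otimes> ?r (n - j) = \<zero>" using xc rc by auto
          then show ?thesis using zm by (simp only:)
        qed
        then have mc: "?x j \<otimes> ?r (n - j) \<in> carrier R" by (rule car)
        have "gr_product R \<mm> j (n - j) (initial_form R \<mm> t x j) (?b (n - j))
            = ideal_power R \<mm> (Suc n) +> (?x j \<otimes> ?r (n - j))"
          using gr_product_coset[OF xm[of j] rm[of "n - j"]] unfolding initial_form_coset n .
        also have "\<dots> = ideal_power R \<mm> (Suc n) +> \<zero>"
          using mem mc by (subst coset_eq_iff[OF P mc ring.ring_simprules(2)[OF ring_axioms]]) (simp only: a_minus_def minus_zero r_zero)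
        finally show ?thesis using z coset_zero[OF P] by simp
      qed
      then have "(\<Oplus>\<^bsub>R Quot ideal_power R \<mm> (Suc n)\<^esub>j\<in>{..n}.
          gr_product R \<mm> j (n - j) (initial_form R \<mm> t x j) (?b (n - j))) = \<zero>\<^bsub>R Quot ideal_power R \<mm> (Suc n)\<^esub>"
        by (rule Q.add.finprod_one_eqI)
      then show ?thesis using z by simp
    qed
    then show ?thesis by (simp add: gr_ring_def)
  qed
  ultimately have "?b = \<zero>\<^bsub>gr_ring R \<mm>\<^esub>" using reg by (simp add: regular_element_def)
  then have "?b i = ideal_power R \<mm> (Suc i)" by (simp add: gr_ring_def)
  then have "ideal_power R \<mm> (Suc i) +> r = ideal_power R \<mm> (Suc i) +> \<zero>"
    using coset_zero[OF P] by (simp add: initial_form_def)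
  then have "r \<ominus> \<zero> \<in> ideal_power R \<mm> (Suc i)" using coset_eq_iff[OF P rc ring.ring_simprules(2)[OF ring_axioms]] by simp
  then show ?thesis using rc by (simp add: a_minus_def)
qed

lemma regular_initial_form_colon:
  assumes x: "x \<in> ideal_power R \<mm> t" and reg: "regular_element (gr_ring R \<mm>) (initial_form R \<mm> t x)"
    and r: "r \<in> carrier R" "x \<otimes> r \<in> ideal_power R \<mm> (t + n)"
  shows "r \<in> ideal_power R \<mm> n"
  using r(2)
proof (induction n)
  case 0
  then show ?case unfolding ideal_power_0 using r(1) by simp
next
  case (Suc n)
  have "x \<otimes> r \<in> ideal_power R \<mm> (t + n)"
    using Suc.prems ideal_power_antimono[OF m_ideal, of "t + n" "t + Suc n"] by auto
  then have "r \<in> ideal_power R \<mm> n" by (rule Suc.IH)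
  then show ?case using regular_initial_form_cancel[OF x reg] Suc.prems by simp
qed

text \<open>Krull's intersection theorem, in the situation where a power of \<open>\<mm>\<close> lies in the ideal of a
  nonzerodivisor \<open>a\<close>: the intersection of the ideals \<open>(a\<^sup>j)\<close> is \<open>a\<close> times itself.\<close>

lemma ideal_powers_Inter_zero:
  assumes a: "a \<in> \<mm>" and reg: "\<And>r. r \<in> carrier R \<Longrightarrow> a \<otimes> r = \<zero> \<Longrightarrow> r = \<zero>"
    and k: "ideal_power R \<mm> k \<subseteq> PIdl a" and d: "\<And>n. d \<in> ideal_power R \<mm> n"
  shows "d = \<zero>"
proof -
  have ac: "a \<in> carrier R" by (rule Icarr[OF a])
  define D where "D = (\<Inter>j::nat. PIdl (a [^] j))"
  have pc: "a [^] (j::nat) \<in> carrier R" for j using ac by simp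
  have sub: "ideal_power R \<mm> (j * k) \<subseteq> PIdl (a [^] (j::nat))" for j
  proof (induction j)
    case 0
    show ?case using ideal_power_0[of \<mm>] unfolding cgenideal_def by force
  next
    case (Suc j)
    have "ideal_power R \<mm> (j * k) \<cdot> ideal_power R \<mm> k \<subseteq> PIdl (a [^] Suc j)"
    proof (rule ideal_prod_subsetI)
      show "ideal (PIdl (a [^] Suc j)) R" using ac by (intro cgenideal_ideal) simp
      fix u v assume "u \<in> ideal_power R \<mm> (j * k)" "v \<in> ideal_power R \<mm> k"
      then have "u \<in> PIdl (a [^] j)" "v \<in> PIdl a" using Suc.IH k by auto
      then obtain p q where pq: "p \<in> carrier R" "q \<in> carrier R" "u = p \<otimes> a [^] j" "v = q \<otimes> a"
        by (auto simp: cgenideal_def)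
      then have "u \<otimes> v = (p \<otimes> q) \<otimes> a [^] Suc j" using ac by (simp add: m_ac)
      then show "u \<otimes> v \<in> PIdl (a [^] Suc j)" using pq unfolding cgenideal_def by blast
    qed
    then show ?case using ideal_power_add[OF m_ideal, of "j * k" k] by (simp add: add.commute)
  qed
  have D: "ideal D R"
    unfolding D_def using cgenideal_ideal[OF pc] by (intro i_Intersect) auto
  have "D \<subseteq> {\<zero>}"
  proof (rule nakayama[OF regular_module_module fg_submodule_regular _ a])
    show "submodule D R (regular_module R)" "submodule {\<zero>} R (regular_module R)"
      unfolding submodule_regular_iff by (rule D, rule zeroideal)
    fix u assume "u \<in> D"
    then have u: "u \<in> PIdl (a [^] j)" for j :: nat by (simp add: D_def)
    obtain c where c: "c \<in> carrier R" "u = c \<otimes> a" using u[of 1] ac by (auto simp: cgenideal_def)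
    have "c \<in> PIdl (a [^] j)" for j :: nat
    proof -
      obtain b where b: "b \<in> carrier R" "u = b \<otimes> (a [^] j \<otimes> a)"
        using u[of "Suc j"] by (auto simp: cgenideal_def)
      have "a \<otimes> (c \<ominus> b \<otimes> a [^] j) = c \<otimes> a \<ominus> b \<otimes> (a [^] j \<otimes> a)"
        using c(1) b(1) ac pc[of j] by algebra
      also have "\<dots> = \<zero>" using b c ac pc[of j] by (simp add: a_minus_def r_neg)
      finally have "c \<ominus> b \<otimes> a [^] j = \<zero>" using reg c(1) b(1) pc by simp
      then have "c = b \<otimes> a [^] j" using c(1) b(1) pc by simp
      then show ?thesis using b(1) unfolding cgenideal_def by blast
    qed
    then have "c \<in> D" by (simp add: D_def)
    then show "\<exists>l\<in>{\<zero>}. \<exists>h'\<in>D. u = l \<oplus>\<^bsub>regular_module R\<^esub> a \<odot>\<^bsub>regular_module R\<^esub> h'"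
      using c ac by (intro bexI[of _ \<zero>] bexI[of _ c]) (simp_all add: m_comm)
  qed
  moreover have "d \<in> D" unfolding D_def using d sub by (intro INT_I) (rule subsetD)
  ultimately show ?thesis by blast
qed

section \<open>A cover of \<open>R/\<mm>\<^sup>n\<close> by an ideal\<close>

lemma fg_module_of_submodule_image:
  assumes M: "module R M" and N: "submodule N R M" "fg_submodule R M N" and X: "module R X"
    and f: "linear_map R (M\<lparr>carrier := N\<rparr>) X f" "f ` N = carrier X"
  shows "fg_module R X"
proof -
  interpret M: module R M by (rule M)
  interpret X: module R X by (rule X)
  note Nm = M.submodule_module[OF N(1)]
  obtain S where S: "finite S" "span_module R M S = N" using N(2) by (auto simp: fg_submodule_def)
  have SN: "S \<subseteq> N" using span_superset[of S R M] S(2) by simp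
  have fS: "f ` S \<subseteq> carrier X" using SN f(2) by auto
  have D: "submodule (span_module R X (f ` S)) R X" by (rule span_submodule[OF X fS])
  have "submodule {u \<in> carrier (M\<lparr>carrier := N\<rparr>). f u \<in> span_module R X (f ` S)} R M"
    by (rule M.submodule_of_submodule[OF N(1) preimage_submodule[OF Nm X f(1) D]])
  then have "span_module R M S \<subseteq> {u \<in> carrier (M\<lparr>carrier := N\<rparr>). f u \<in> span_module R X (f ` S)}"
    using SN span_superset[of "f ` S" R X] by (intro span_minimal) auto
  then have "carrier X \<subseteq> span_module R X (f ` S)" unfolding S(2) f(2)[symmetric] by blast
  then have "span_module R X (f ` S) = carrier X" using X.submoduleE(1)[OF D] by auto
  then show ?thesis unfolding fg_module_def using X S(1) fS by blast
qed

text \<open>A nonprincipal ideal containing a nonzerodivisor \<open>x \<in> \<mm>\<close> is maximal Cohen-Macaulay without free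
  summand, since a functional with value one on it makes it principal.\<close>

lemma covered_0_if_ideal_onto:
  assumes dim: "krull_dim R = 1" and x: "x \<in> \<mm>"
    and reg: "\<And>r. r \<in> carrier R \<Longrightarrow> x \<otimes> r = \<zero> \<Longrightarrow> r = \<zero>"
    and I: "ideal I R" "x \<in> I" "I \<subseteq> \<mm>" and nonprincipal: "\<And>e. e \<in> I \<Longrightarrow> I \<noteq> PIdl e"
    and f: "linear_map R ((regular_module R)\<lparr>carrier := I\<rparr>) M f" "f ` I = carrier M"
  shows "covered M 0"
proof -
  let ?I = "(regular_module R)\<lparr>carrier := I\<rparr>"
  interpret RM: module R "regular_module R" by (rule regular_module_module)
  have xc: "x \<in> carrier R" by (rule Icarr[OF x])
  note Ic = ideal.Icarr[OF I(1)]
  have Is: "submodule I R (regular_module R)" using I(1) by (simp add: submodule_regular_iff)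
  note Im = RM.submodule_module[OF Is]
  define c where "c = (\<lambda>a::'a. {\<lambda>_::nat. a})"
  have inj: "inj_on c (carrier ?I)" by (auto simp: c_def inj_on_def fun_eq_iff)
  define X where "X = copy_module c ?I"
  define d where "d = inv_into I c"
  have X: "module R X" "carrier X = c ` I" "linear_map R ?I X c" "linear_map R X ?I d"
    using copy_module[OF Im inj] by (auto simp: X_def d_def)
  interpret X: module R X by (rule X(1))
  have dc: "d (c u) = u" if "u \<in> I" for u using inj that by (simp add: d_def)
  have cd: "c (d u) = u" if "u \<in> carrier X" for u using that X(2) dc by auto
  have dI: "d u \<in> I" if "u \<in> carrier X" for u using linear_mapD(1)[OF X(4) that] by simp
  have dsm: "d (r \<odot>\<^bsub>X\<^esub> u) = r \<otimes> d u" if "r \<in> carrier R" "u \<in> carrier X" for r u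
    using linear_mapD(3)[OF X(4) that] by simp
  have d0: "d \<zero>\<^bsub>X\<^esub> = \<zero>" using linear_zero[OF X(1) Im X(4)] by simp
  have c0: "c \<zero> = \<zero>\<^bsub>X\<^esub>" using linear_zero[OF Im X(1,3)] by simp
  have "fg_module R X"
    by (rule fg_module_of_submodule_image[OF regular_module_module Is fg_submodule_regular[OF Is] X(1,3)])
      (simp add: X(2))
  moreover have "depth R \<mm> X = 1"
  proof (rule depth_eq_1[OF X(1) x])
    fix u assume u: "u \<in> carrier X" "x \<odot>\<^bsub>X\<^esub> u = \<zero>\<^bsub>X\<^esub>"
    then have "x \<otimes> d u = \<zero>" using dsm[OF xc u(1)] d0 by simp
    then have "d u = \<zero>" using reg Ic[OF dI[OF u(1)]] by simp
    then show "u = \<zero>\<^bsub>X\<^esub>" using cd[OF u(1)] c0 by simp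
  next
    have cx: "c x \<in> carrier X" using X(2) I(2) by simp
    have "c x \<noteq> x \<odot>\<^bsub>X\<^esub> u" if u: "u \<in> carrier X" for u
    proof
      assume "c x = x \<odot>\<^bsub>X\<^esub> u"
      then have e: "x = x \<otimes> d u" using dsm[OF xc u] dc[OF I(2)] by simp
      have uc: "d u \<in> carrier R" by (rule Ic[OF dI[OF u]])
      have "x \<otimes> (\<one> \<ominus> d u) = x \<ominus> x \<otimes> d u" using xc uc by algebra
      then have "x \<otimes> (\<one> \<ominus> d u) = \<zero>" using e xc by (simp add: a_minus_def r_neg)
      then have "\<one> \<ominus> d u = \<zero>" using reg uc by simp
      then have "\<one> = d u" using uc by simp
      then show False using dI[OF u] I(3) m_proper by auto
    qed
    then show "(\<lambda>u. x \<odot>\<^bsub>X\<^esub> u) ` carrier X \<noteq> carrier X" using cx by blast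
  next
    fix a assume a: "a \<in> \<mm>" and areg: "\<And>u. u \<in> carrier X \<Longrightarrow> a \<odot>\<^bsub>X\<^esub> u = \<zero>\<^bsub>X\<^esub> \<Longrightarrow> u = \<zero>\<^bsub>X\<^esub>"
    have ac: "a \<in> carrier R" by (rule Icarr[OF a])
    show "\<exists>k. ideal_power R \<mm> k \<subseteq> PIdl a"
    proof (rule nonzerodivisor_m_primary[OF dim a])
      fix r assume r: "r \<in> carrier R" "a \<otimes> r = \<zero>"
      have rx: "r \<otimes> x \<in> I" using ideal.I_l_closed[OF I(1,2) r(1)] .
      have "a \<otimes> (r \<otimes> x) = \<zero>" using r ac xc by (simp add: m_assoc[symmetric])
      then have "a \<odot>\<^bsub>X\<^esub> c (r \<otimes> x) = \<zero>\<^bsub>X\<^esub>"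
        using linear_mapD(3)[OF X(3) ac, of "r \<otimes> x"] rx c0 by simp
      then have "c (r \<otimes> x) = \<zero>\<^bsub>X\<^esub>" using areg X(2) rx by simp
      then have "r \<otimes> x = \<zero>" using dc[OF rx] d0 by simp
      then show "r = \<zero>" using reg r(1) xc by (simp add: m_comm)
    qed
  qed
  ultimately have "MCM R \<mm> X" using dim by (simp add: MCM_def)
  moreover have "\<not> has_free_summand R X"
  proof
    assume "has_free_summand R X"
    then obtain t e where t: "linear_map R X (regular_module R) t" and e: "e \<in> carrier X" "t e = \<one>"
      using functional_if_has_free_summand[OF X(1)] by blast
    have tau: "linear_map R ?I (regular_module R) (\<lambda>u. t (c u))" by (rule linear_map_comp[OF X(3) t])
    have "u \<in> PIdl (d e)" if u: "u \<in> I" for u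
    proof -
      have tu: "t (c u) \<in> carrier R" using linear_mapD(1)[OF tau] u by simp
      have "t (c (d e \<otimes> u)) = d e \<otimes> t (c u)"
        using linear_mapD(3)[OF tau Ic[OF dI[OF e(1)]], of u] u by simp
      moreover have "t (c (u \<otimes> d e)) = u"
        using linear_mapD(3)[OF tau Ic[OF u], of "d e"] dI[OF e(1)] cd[OF e(1)] e(2) Ic[OF u] by simp
      ultimately have "u = t (c u) \<otimes> d e"
        using Ic[OF u] Ic[OF dI[OF e(1)]] tu by (simp add: m_comm)
      then show ?thesis using tu unfolding cgenideal_def by blast
    qed
    then have "I = PIdl (d e)" using cgenideal_minimal[OF I(1) dI[OF e(1)]] by auto
    then show False using nonprincipal dI[OF e(1)] by blast
  qed
  moreover have "linear_map R X M (\<lambda>u. f (d u))" by (rule linear_map_comp[OF X(4) f(1)])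
  moreover have "(\<lambda>u. f (d u)) ` carrier X = carrier M"
    using f(2) dc unfolding X(2) by (simp add: image_image)
  ultimately show ?thesis unfolding covered_0_iff by blast
qed

text \<open>The ideal \<open>xR + \<mm>^(t+n)\<close> maps onto \<open>R/\<mm>^(n+1)\<close> by \<open>x \<mapsto> 1\<close>.  The values on \<open>\<mm>^(t+n)\<close> come from a complement of
  the image of \<open>x \<mm>^n\<close> in the vector space \<open>\<mm>^(t+n) / \<mm>^(t+n+1)\<close>, that is from an ideal \<open>C\<close> maximal with
  \<open>C \<inter> x \<mm>^n \<subseteq> \<mm>^(t+n+1)\<close>.  This agrees with \<open>x \<mapsto> 1\<close> on the overlap, because \<open>x r\<close> lies in
  \<open>\<mm>^(t+n+1)\<close> only for \<open>r\<close> in \<open>\<mm>^(n+1)\<close>.\<close>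

lemma covered_0_if_power_not_subset:
  assumes dim: "krull_dim R = 1" and x: "x \<in> ideal_power R \<mm> t" "x \<notin> ideal_power R \<mm> (Suc t)" and t: "t \<ge> 1"
    and reg: "\<And>r. r \<in> carrier R \<Longrightarrow> x \<otimes> r = \<zero> \<Longrightarrow> r = \<zero>"
    and colon: "\<And>r i. r \<in> carrier R \<Longrightarrow> x \<otimes> r \<in> ideal_power R \<mm> (t + i) \<Longrightarrow> r \<in> ideal_power R \<mm> i"
    and not_sub: "\<not> ideal_power R \<mm> (t + n) \<subseteq> PIdl x"
  shows "covered (quotient_module (regular_module R) (ideal_power R \<mm> (Suc n))) 0"
proof -
  note P = ideal_power_ideal[OF m_ideal]
  note car = ideal.Icarr[OF P]
  have xc: "x \<in> carrier R" by (rule car[OF x(1)])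
  have m1: "ideal_power R \<mm> i \<subseteq> \<mm>" if "i \<ge> 1" for i
    using ideal_power_antimono[OF m_ideal that] ideal_power_1[OF m_ideal] by simp
  have xm: "x \<in> \<mm>" using m1[OF t] x(1) by auto
  let ?V = "ideal_power R \<mm> (t + n)" and ?W = "ideal_power R \<mm> (t + Suc n)"
  let ?J = "ideal_power R \<mm> (Suc n)" and ?B = "ideal_power R \<mm> n"
  have mV: "r \<otimes> v \<in> ?W" if "r \<in> \<mm>" "v \<in> ?V" for r v
  proof -
    have "v \<otimes> r \<in> ?W" unfolding add_Suc_right ideal_power_Suc using that(2,1) by (rule ideal_prod.prod)
    then show ?thesis using m_comm[OF Icarr[OF that(1)] car[OF that(2)]] by simp
  qed
  have xB: "x \<otimes> b \<in> ?V" if "b \<in> ?B" for b by (rule ideal_power_mult_mem[OF m_ideal x(1) that])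
  have xJ: "x \<otimes> b \<in> ?W" if "b \<in> ?J" for b by (rule ideal_power_mult_mem[OF m_ideal x(1) that])
  have WV: "?W \<subseteq> ?V" by (rule ideal_power_antimono[OF m_ideal]) simp
  define ok where "ok C \<longleftrightarrow> ?W \<subseteq> C \<and> C \<subseteq> ?V \<and> (\<forall>b\<in>?B. x \<otimes> b \<in> C \<longrightarrow> x \<otimes> b \<in> ?W)" for C
  obtain C where C: "ideal C R" "ok C"
    and max: "\<And>D. ideal D R \<Longrightarrow> ok D \<Longrightarrow> C \<subseteq> D \<Longrightarrow> D = C"
    by (rule exists_maximal_ideal_with[where Q = ok, OF P[of "t + Suc n"]]) (use WV in \<open>auto simp: ok_def\<close>)
  interpret C: ideal C R by (rule C(1))
  have WC: "?W \<subseteq> C" and CV: "C \<subseteq> ?V" using C(2) by (auto simp: ok_def)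
  have CB: "x \<otimes> b \<in> ?W" if "b \<in> ?B" "x \<otimes> b \<in> C" for b using C(2) that by (auto simp: ok_def)
  have key: "x \<otimes> z \<in> C \<longleftrightarrow> z \<in> ?J" if z: "z \<in> carrier R" for z
  proof
    assume a: "x \<otimes> z \<in> C"
    have "x \<otimes> z \<in> ?V" using a CV by (rule_tac subsetD)
    then have "z \<in> ?B" by (rule colon[OF z])
    then have "x \<otimes> z \<in> ?W" using a by (rule CB)
    then show "z \<in> ?J" by (rule colon[OF z])
  next
    assume "z \<in> ?J"
    from xJ[OF this] show "x \<otimes> z \<in> C" using WC by (rule_tac subsetD)
  qed
  \<comment> \<open>by maximality, \<open>C\<close> and \<open>x \<mm>\<^sup>n\<close> span \<open>\<mm>\<close> to the power \<open>t + n\<close>\<close>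
  have decV: "\<exists>s\<in>carrier R. \<exists>c\<in>C. v = x \<otimes> s \<oplus> c" if v: "v \<in> ?V" for v
  proof (cases "v \<in> C")
    case True
    have "v = x \<otimes> \<zero> \<oplus> v" using xc car[OF v] by simp
    then show ?thesis using True by blast
  next
    case False
    have vc: "v \<in> carrier R" by (rule car[OF v])
    let ?D = "set_add R C (PIdl v)"
    have Pv: "ideal (PIdl v) R" by (rule cgenideal_ideal[OF vc])
    have D: "ideal ?D R" by (rule add_ideals[OF C(1) Pv])
    note sub = subset_add_ideals[OF C(1) Pv]
    have vD: "v \<in> ?D" using sub(2) cgenideal_self[OF vc] by (rule_tac subsetD)
    have "?D \<noteq> C" using vD False by blast
    then have "\<not> ok ?D" using max[OF D _ sub(1)] by blast
    moreover have "?W \<subseteq> ?D" using WC sub(1) by (rule subset_trans)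
    moreover have "?D \<subseteq> ?V"
    proof
      fix u :: 'a assume "u \<in> ?D"
      then obtain p q where "p \<in> C" "q \<in> PIdl v" "u = p \<oplus> q" by (rule set_addE)
      moreover have "PIdl v \<subseteq> ?V" by (rule cgenideal_minimal[OF P v])
      ultimately show "u \<in> ?V" using CV additive_subgroup.a_closed[OF ideal.axioms(1)[OF P]] by blast
    qed
    ultimately obtain b where b: "b \<in> ?B" "x \<otimes> b \<in> ?D" "x \<otimes> b \<notin> ?W" unfolding ok_def by blast
    obtain c q where cq: "c \<in> C" "q \<in> PIdl v" "x \<otimes> b = c \<oplus> q" using b(2) by (rule set_addE)
    obtain r where r: "r \<in> carrier R" "q = r \<otimes> v" using cq(2) by (auto simp: cgenideal_def)
    note cc = C.Icarr[OF cq(1)] and bc = car[OF b(1)]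
    have "r \<notin> \<mm>"
    proof
      assume "r \<in> \<mm>"
      then have "q \<in> C" using mV[OF _ v] WC r(2) by (auto intro: subsetD)
      then have "x \<otimes> b \<in> C" unfolding cq(3) by (rule C.a_closed[OF cq(1)])
      then show False using CB[OF b(1)] b(3) by simp
    qed
    then have u: "r \<in> Units R" by (rule unit_if_not_mem[OF r(1)])
    note ic = Units_inv_closed[OF u]
    have "v = inv r \<otimes> (r \<otimes> v)" using u vc r(1) by (simp add: m_assoc[symmetric])
    also have "r \<otimes> v = x \<otimes> b \<ominus> c"
    proof -
      have "(c \<oplus> r \<otimes> v) \<ominus> c = r \<otimes> v" using cc r(1) vc by algebra
      then show ?thesis using cq(3) r(2) by simp
    qed
    also have "inv r \<otimes> (x \<otimes> b \<ominus> c) = x \<otimes> (inv r \<otimes> b) \<oplus> (\<ominus> (inv r)) \<otimes> c"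
      using ic xc bc cc by algebra
    finally have "v = x \<otimes> (inv r \<otimes> b) \<oplus> (\<ominus> (inv r)) \<otimes> c" .
    moreover have "(\<ominus> (inv r)) \<otimes> c \<in> C" using ic by (intro C.I_l_closed[OF cq(1)]) simp
    moreover have "inv r \<otimes> b \<in> carrier R" using ic bc by simp
    ultimately show ?thesis by blast
  qed
  let ?I = "set_add R (PIdl x) ?V"
  have Px: "ideal (PIdl x) R" by (rule cgenideal_ideal[OF xc])
  have I: "ideal ?I R" by (rule add_ideals[OF Px P])
  note subI = subset_add_ideals[OF Px P, of "t + n"]
  have xI: "x \<in> ?I" using subI(1) cgenideal_self[OF xc] by (rule_tac subsetD)
  have Im: "?I \<subseteq> \<mm>"
  proof
    fix u :: 'a assume "u \<in> ?I"
    then obtain p q where "p \<in> PIdl x" "q \<in> ?V" "u = p \<oplus> q" by (rule set_addE)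
    moreover have "PIdl x \<subseteq> \<mm>" by (rule cgenideal_minimal[OF m_ideal xm])
    moreover have "?V \<subseteq> \<mm>" using t by (intro m1) simp
    ultimately show "u \<in> \<mm>" using a_closed by (simp add: subset_iff)
  qed
  have dec: "\<exists>s\<in>carrier R. \<exists>c\<in>C. u = x \<otimes> s \<oplus> c" if u: "(u::'a) \<in> ?I" for u
  proof -
    obtain p v where pv: "p \<in> PIdl x" "v \<in> ?V" "u = p \<oplus> v" using u by (rule set_addE)
    obtain q where q: "q \<in> carrier R" "p = q \<otimes> x" using pv(1) by (auto simp: cgenideal_def)
    obtain s c where sc: "s \<in> carrier R" "c \<in> C" "v = x \<otimes> s \<oplus> c" using decV[OF pv(2)] by blast
    have "u = x \<otimes> (q \<oplus> s) \<oplus> c" unfolding pv(3) q(2) sc(3) using q(1) sc(1) xc C.Icarr[OF sc(2)] by algebra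
    then show ?thesis using q(1) sc(1,2) by blast
  qed
  have nonprincipal: "?I \<noteq> PIdl e" if e: "e \<in> ?I" for e
  proof
    assume eq: "?I = PIdl e"
    have ec: "e \<in> carrier R" by (rule ideal.Icarr[OF I e])
    have "x \<in> PIdl e" using xI unfolding eq .
    then obtain q where q: "q \<in> carrier R" "x = q \<otimes> e" by (auto simp: cgenideal_def)
    obtain p v where pv: "p \<in> PIdl x" "v \<in> ?V" "e = p \<oplus> v" using e by (rule set_addE)
    obtain s where s: "s \<in> carrier R" "p = s \<otimes> x" using pv(1) by (auto simp: cgenideal_def)
    note vc = car[OF pv(2)]
    show False
    proof (cases "q \<in> \<mm>")
      case True
      have "x = q \<otimes> (s \<otimes> x \<oplus> v)" using q(2) pv(3) s(2) by simp
      then have "x \<ominus> q \<otimes> (s \<otimes> x \<oplus> v) = \<zero>" using xc by (simp add: a_minus_def r_neg)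
      moreover have "(\<one> \<ominus> q \<otimes> s) \<otimes> x = (x \<ominus> q \<otimes> (s \<otimes> x \<oplus> v)) \<oplus> q \<otimes> v"
        using q(1) s(1) vc xc by algebra
      ultimately have "(\<one> \<ominus> q \<otimes> s) \<otimes> x = q \<otimes> v" using q(1) vc by simp
      then have *: "(\<one> \<ominus> q \<otimes> s) \<otimes> x \<in> ?W" using mV[OF True pv(2)] by simp
      have u: "\<one> \<ominus> q \<otimes> s \<in> Units R" by (rule one_minus_unit[OF I_r_closed[OF True s(1)]])
      have "inv (\<one> \<ominus> q \<otimes> s) \<otimes> ((\<one> \<ominus> q \<otimes> s) \<otimes> x) \<in> ?W"
        by (rule ideal.I_l_closed[OF P * Units_inv_closed[OF u]])
      then have "x \<in> ?W" using u xc Units_closed[OF u] by (simp add: m_assoc[symmetric])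
      moreover have "?W \<subseteq> ideal_power R \<mm> (Suc t)" by (rule ideal_power_antimono[OF m_ideal]) simp
      ultimately show False using x(2) by (auto intro: subsetD)
    next
      case False
      then have u: "q \<in> Units R" by (rule unit_if_not_mem[OF q(1)])
      have "e = inv q \<otimes> x" using q u ec by (simp add: m_assoc[symmetric])
      then have "e \<in> PIdl x" using Units_inv_closed[OF u] unfolding cgenideal_def by blast
      then have "?I \<subseteq> PIdl x" unfolding eq by (rule cgenideal_minimal[OF Px])
      then show False using subI(2) not_sub by (meson subset_trans)
    qed
  qed
  let ?Q = "quotient_module (regular_module R) ?J"
  \<comment> \<open>\<open>C\<close> is to be the kernel, so the coset of \<open>r\<close> is the value at \<open>u\<close> if \<open>u - x r\<close> lies in \<open>C\<close>\<close>
  define f where "f u = {r \<in> carrier R. u \<ominus> x \<otimes> r \<in> C}" for u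
  have f: "f (x \<otimes> s \<oplus> c) = ?J +> s" if s: "s \<in> carrier R" and c: "c \<in> C" for s c
  proof -
    note cc = C.Icarr[OF c]
    have "x \<otimes> s \<oplus> c \<ominus> x \<otimes> r \<in> C \<longleftrightarrow> r \<ominus> s \<in> ?J" if r: "r \<in> carrier R" for r
    proof -
      have "x \<otimes> s \<oplus> c \<ominus> x \<otimes> r = c \<ominus> x \<otimes> (r \<ominus> s)" "x \<otimes> (r \<ominus> s) = c \<ominus> (x \<otimes> s \<oplus> c \<ominus> x \<otimes> r)"
        using r s xc cc by algebra+
      then have "x \<otimes> s \<oplus> c \<ominus> x \<otimes> r \<in> C \<longleftrightarrow> x \<otimes> (r \<ominus> s) \<in> C"
        using ideal_minus_closed[OF C(1) c] by metis
      then show ?thesis using key[of "r \<ominus> s"] r s by simp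
    qed
    then show ?thesis unfolding f_def using mem_coset_iff[OF P s] by blast
  qed
  note Qs = quotient_regular_simps[OF P]
  show ?thesis
  proof (rule covered_0_if_ideal_onto[OF dim xm reg I xI Im nonprincipal])
    show "linear_map R ((regular_module R)\<lparr>carrier := ?I\<rparr>) ?Q f"
    proof (rule linear_mapI)
      fix u assume "u \<in> carrier ((regular_module R)\<lparr>carrier := ?I\<rparr>)"
      then obtain s c where u: "s \<in> carrier R" "c \<in> C" "u = x \<otimes> s \<oplus> c" using dec by force
      note cc = C.Icarr[OF u(2)]
      show "f u \<in> carrier ?Q" unfolding u(3) f[OF u(1,2)] Qs(1) by (rule imageI[OF u(1)])
      { fix v assume "v \<in> carrier ((regular_module R)\<lparr>carrier := ?I\<rparr>)"
        then obtain s' c' where v: "s' \<in> carrier R" "c' \<in> C" "v = x \<otimes> s' \<oplus> c'" using dec by force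
        have e: "u \<oplus> v = x \<otimes> (s \<oplus> s') \<oplus> (c \<oplus> c')"
          unfolding u(3) v(3) using u(1) v(1) cc C.Icarr[OF v(2)] xc by algebra
        have "f (u \<oplus> v) = ?J +> (s \<oplus> s')"
          unfolding e using u v C.a_closed by (intro f) auto
        also have "\<dots> = f u \<oplus>\<^bsub>?Q\<^esub> f v"
          unfolding u(3) v(3) f[OF u(1,2)] f[OF v(1,2)] by (rule Qs(3)[OF u(1) v(1), symmetric])
        finally show "f (u \<oplus>\<^bsub>(regular_module R)\<lparr>carrier := ?I\<rparr>\<^esub> v) = f u \<oplus>\<^bsub>?Q\<^esub> f v" by simp }
      fix r assume r: "r \<in> carrier R"
      have e: "r \<otimes> u = x \<otimes> (r \<otimes> s) \<oplus> r \<otimes> c"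
        unfolding u(3) using u(1) r cc xc by algebra
      have "f (r \<otimes> u) = ?J +> (r \<otimes> s)"
        unfolding e using u r C.I_l_closed by (intro f) auto
      also have "\<dots> = r \<odot>\<^bsub>?Q\<^esub> f u" unfolding u(3) f[OF u(1,2)] by (rule Qs(4)[OF r u(1), symmetric])
      finally show "f (r \<odot>\<^bsub>(regular_module R)\<lparr>carrier := ?I\<rparr>\<^esub> u) = r \<odot>\<^bsub>?Q\<^esub> f u" by simp
    qed
    show "f ` ?I = carrier ?Q"
    proof (intro equalityI subsetI)
      fix z assume "z \<in> f ` ?I"
      then obtain u where "u \<in> ?I" "z = f u" by blast
      then obtain s c where "s \<in> carrier R" "c \<in> C" "z = f (x \<otimes> s \<oplus> c)" using dec by blast
      then show "z \<in> carrier ?Q" using f Qs(1) by auto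
    next
      fix z assume "z \<in> carrier ?Q"
      then obtain s where s: "s \<in> carrier R" "z = ?J +> s" unfolding Qs(1) by blast
      have "x \<otimes> s \<in> ?I" by (rule ideal.I_r_closed[OF I xI s(1)])
      moreover have "f (x \<otimes> s) = z" using f[OF s(1) C.zero_closed] s xc by simp
      ultimately show "z \<in> f ` ?I" by blast
    qed
  qed
qed

end

theorem corollary2p5:
  fixes R :: "('a, 'r) ring_scheme" and \<mm> :: "'a set" and \<omega> :: "('a, 'b) module"
    and x :: 'a and t :: nat
  assumes "CM_local_ring R \<mm>"
    and "krull_dim R = 1"
    and "canonical_module R \<mm> \<omega>"
    and "\<mm> \<subseteq> trace_ideal R \<omega>"
    and "t \<ge> 1"
    and "x \<in> ideal_power R \<mm> t - ideal_power R \<mm> (t + 1)"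
    and "regular_element (gr_ring R \<mm>) (initial_form R \<mm> t x)"
  shows "ring_index R \<mm> \<le> gen_loewy_length R \<mm> \<and>
         gen_loewy_length R \<mm> \<le> ring_index R \<mm> + enat t - 1"
proof -
  have "noetherian_local_ring R \<mm>" using assms(1) by (simp add: CM_local_ring_def)
  then interpret noetherian_local_ring R \<mm> .
  have depth: "depth R \<mm> (regular_module R) = 1" using assms(1,2) by (simp add: CM_local_ring_def)
  have fg: "fg_module R \<omega>" and fid: "finite_injective_dim R \<omega>"
    using assms(3) by (auto simp: canonical_module_def MCM_def)
  let ?Q = "\<lambda>n. quotient_module (regular_module R) (ideal_power R \<mm> n)"
  note P = ideal_power_ideal[OF m_ideal]
  have delta: "delta R \<mm> (?Q n) = 1 \<longleftrightarrow> \<not> covered (?Q n) 0" for n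
    by (rule delta_eq_1_iff[OF covered_1_cyclic[OF P]])
  have Idl: "Idl\<^bsub>R\<^esub> {y} = PIdl\<^bsub>R\<^esub> y" if "y \<in> \<mm>" for y
    using cgenideal_eq_genideal[OF Icarr[OF that]] by simp
  have "ring_index R \<mm> \<le> gen_loewy_length R \<mm>"
    unfolding ring_index_def gen_loewy_length_def
  proof (rule Inf_superset_mono, rule subsetI)
    fix l assume "l \<in> {enat n | n. n \<ge> 1 \<and>
      (\<exists>xs. system_of_parameters R \<mm> xs \<and> ideal_power R \<mm> n \<subseteq> Idl\<^bsub>R\<^esub> (set xs))}"
    then obtain n xs where n: "l = enat n" "n \<ge> 1" and xs: "system_of_parameters R \<mm> xs"
      "ideal_power R \<mm> n \<subseteq> Idl\<^bsub>R\<^esub> (set xs)" by blast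
    have "length xs = 1" using xs(1) assms(2) by (simp add: system_of_parameters_def one_enat_def)
    then obtain y where y: "xs = [y]" by (cases xs) auto
    have ym: "y \<in> \<mm>" using xs(1) y by (simp add: system_of_parameters_def)
    obtain k where k: "ideal_power R \<mm> k \<subseteq> PIdl\<^bsub>R\<^esub> y"
      using xs(1) y Idl[OF ym] by (auto simp: system_of_parameters_def)
    have "ideal_power R \<mm> n \<subseteq> PIdl\<^bsub>R\<^esub> y" using xs(2) y Idl[OF ym] by simp
    then have "\<not> covered (?Q n) 0"
      by (rule not_covered_0_if_subset_parameter[OF assms(2) depth fg fid assms(4) ym k P])
    then show "l \<in> {enat n | n. n \<ge> 1 \<and> delta R \<mm> (?Q n) = 1}" using n delta by blast
  qed
  moreover have "gen_loewy_length R \<mm> \<le> ring_index R \<mm> + enat t - 1"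
  proof (cases "ring_index R \<mm>")
    case infinity
    then show ?thesis by simp
  next
    case (enat i)
    let ?S = "{enat n | n. n \<ge> 1 \<and> delta R \<mm> (?Q n) = 1}"
    have "?S \<noteq> {}"
    proof
      assume "?S = {}"
      then show False using enat unfolding ring_index_def by (simp only: Inf_enat_def) simp
    qed
    then have "Inf ?S \<in> ?S" unfolding ex_in_conv[symmetric] by (elim exE) (rule wellorder_InfI)
    then have "enat i \<in> ?S" using enat unfolding ring_index_def by (simp only:)
    then have i: "i \<ge> 1" "delta R \<mm> (?Q i) = 1" by simp_all
    have x: "x \<in> ideal_power R \<mm> t" "x \<notin> ideal_power R \<mm> (Suc t)" using assms(6) by auto
    have xm: "x \<in> \<mm>"
      using x(1) ideal_power_antimono[OF m_ideal assms(5)] ideal_power_1[OF m_ideal] by auto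
    obtain a where a: "a \<in> \<mm>"
      "\<forall>u\<in>carrier R. a \<otimes>\<^bsub>R\<^esub> u = \<zero>\<^bsub>R\<^esub> \<longrightarrow> u = \<zero>\<^bsub>R\<^esub>"
      using exists_regular_if_depth_pos[OF regular_module_module, of \<mm>] depth by auto
    then have areg: "r = \<zero>\<^bsub>R\<^esub>" if "r \<in> carrier R" "a \<otimes>\<^bsub>R\<^esub> r = \<zero>\<^bsub>R\<^esub>" for r
      using that by simp
    have "\<exists>k. ideal_power R \<mm> k \<subseteq> PIdl\<^bsub>R\<^esub> a"
      by (rule nonzerodivisor_m_primary[OF assms(2) a(1)]) (rule areg)
    then obtain k where k: "ideal_power R \<mm> k \<subseteq> PIdl\<^bsub>R\<^esub> a" ..
    note colon = regular_initial_form_colon[OF x(1) assms(7)]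
    have xreg: "r = \<zero>\<^bsub>R\<^esub>" if r: "r \<in> carrier R" "x \<otimes>\<^bsub>R\<^esub> r = \<zero>\<^bsub>R\<^esub>" for r
    proof (rule ideal_powers_Inter_zero[OF a(1) areg k])
      have "x \<otimes>\<^bsub>R\<^esub> r \<in> ideal_power R \<mm> (t + j)" for j
        unfolding r(2) by (rule additive_subgroup.zero_closed[OF ideal.axioms(1)[OF P]])
      then show "r \<in> ideal_power R \<mm> j" for j by (rule colon[OF r(1)])
    qed
    obtain n where n: "i = Suc n" using i(1) by (cases i) auto
    have sub: "ideal_power R \<mm> (t + n) \<subseteq> PIdl\<^bsub>R\<^esub> x"
    proof (rule ccontr)
      assume not_sub: "\<not> ideal_power R \<mm> (t + n) \<subseteq> PIdl\<^bsub>R\<^esub> x"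
      have "covered (?Q (Suc n)) 0"
      proof (rule covered_0_if_power_not_subset[OF assms(2) x assms(5) _ _ not_sub])
        show "r = \<zero>\<^bsub>R\<^esub>" if "r \<in> carrier R" "x \<otimes>\<^bsub>R\<^esub> r = \<zero>\<^bsub>R\<^esub>" for r
          by (rule xreg[OF that])
        show "r \<in> ideal_power R \<mm> j" if "r \<in> carrier R" "x \<otimes>\<^bsub>R\<^esub> r \<in> ideal_power R \<mm> (t + j)" for r j
          by (rule colon[OF that])
      qed
      then show False using i(2) delta n by simp
    qed
    have "system_of_parameters R \<mm> [x]"
      using assms(2) xm sub Idl[OF xm] by (auto simp: system_of_parameters_def one_enat_def)
    then have "gen_loewy_length R \<mm> \<le> enat (t + n)"
      unfolding gen_loewy_length_def using assms(5) sub Idl[OF xm]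
      by (intro Inf_lower) (auto intro!: exI[of _ "[x]"])
    also have "enat (t + n) = ring_index R \<mm> + enat t - 1"
      unfolding enat n by (simp add: one_enat_def)
    finally show ?thesis .
  qed
  ultimately show ?thesis by simp
qed

end
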